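(* Let $q:\mathbb{R}^2\to\mathbb{C}$ be a quadratic form (dimension $n=1$) which is partially elliptic with trivial singular space. Let $\lambda$ be the unique (algebraically simple) eigenvalue of the Hamilton map $F$ of $q$ with positive imaginary part, let $$\mu_N=\frac{\lambda}{i}(2N+1),\qquad N\in\mathbb{N}_0,$$ and write $\Pi_N=P_{\{\mu_N\},q^w(x,D_x)}:L^2(\mathbb{R}^1)\to L^2(\mathbb{R}^1)$ for the spectral projection of $q^w(x,D_x)$ and $\{\mu_N\}$. Let $C_+\in\mathbb{C}$ be the complex number associated with $q$ in the context; it satisfies $|C_+|<1$. Then there exists a complete asymptotic expansion $$\left(\frac{1-|C_+|}{1+|C_+|}\right)^{N/2}\|\Pi_N\|_{\mathcal{L}(L^2(\mathbb{R}^1))}\sim\sum_{j=0}^\infty c_jN^{-j-1/2},\qquad N\to\infty,$$ for some sequence $\{c_j\}_{j=0}^\infty$ of real numbers depending only on $C_+$. Furthermore, $$c_0=(2\pi|C_+|)^{-1/2}\left(\frac{1+|C_+|}{1-|C_+|}\right)^{1/4}.$$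
   Context: Write $q(x,\xi)=q_{20}x^2+q_{11}x\xi+q_{02}\xi^2$ with complex coefficients. With $D_x=-i\,d/dx$, $q^w(x,D_x)=q_{20}x^2+\frac{q_{11}}2(xD_x+D_xx)+q_{02}D_x^2$ (the classical case, $h=1$), viewed as a closed, densely defined unbounded operator on $L^2(\mathbb{R})$ (with maximal domain). The Hamilton map is $F=\frac12\begin{pmatrix}\partial_\xi\partial_xq&\partial_\xi^2q\\-\partial_x^2q&-\partial_x\partial_\xi q\end{pmatrix}$ acting on $\mathbb{C}^2$; $\operatorname{Re}F$, $\operatorname{Im}F$ are entrywise. "Partially elliptic with trivial singular space" means $\operatorname{Re}q\ge0$ on $\mathbb{R}^2$ and $\bigcap_{k\ge0}\ker((\operatorname{Re}F)(\operatorname{Im}F)^k)=\{0\}$. Then $F$ has one eigenvalue $\lambda$ with positive imaginary part and one with negative imaginary part; let $\Lambda^+$, $\Lambda^-\subset\mathbb{C}^2$ be the corresponding eigenspaces. The spectrum of $q^w(x,D_x)$ is $\{\mu_N:N\in\mathbb{N}_0\}$. Definition of $C_+$: one has $\Lambda^-=\{(y,A_-y):y\in\mathbb{C}\}$ with $A_-\in\mathbb{C}$, $\operatorname{Im}A_-<0$. Let $\kappa=\begin{pmatrix}(-\operatorname{Im}A_-)^{1/2}&0\\-(-\operatorname{Im}A_-)^{-1/2}\operatorname{Re}A_-&(-\operatorname{Im}A_-)^{-1/2}\end{pmatrix}$. Then $\kappa(\Lambda^+)=\{(y,A_+y):y\in\mathbb{C}\}$ with $\operatorname{Im}A_+>0$,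 and $C_+=(1-iA_+)^{-1}(1+iA_+)$. Spectral projection: $P_{\{z\},A}=(2\pi i)^{-1}\int_\Gamma(\zeta-A)^{-1}d\zeta$, $\Gamma$ a positively oriented small circle about $z$ enclosing no other point of $\operatorname{Spec}A$. The relation $a_N\sim\sum_{j\ge0}c_jN^{-j-1/2}$ means that for each $J\in\mathbb{N}$, $a_N-\sum_{j=0}^{J-1}c_jN^{-j-1/2}=\mathcal{O}(N^{-J-1/2})$ as $N\to\infty$.
   Formalization: The expansion and the formula for c_0 are asserted only when C_+ ≠ 0; for C_+ = 0 (e.g. q = x²+ξ²) the left side is identically 1, so no such expansion exists, and c_0 is undefined. *)

theory Defs
  imports "HOL-Analysis.Analysis" "HOL-Library.Landau_Symbols"
begin

section \<open>The Hilbert space of square-integrable functions on the real line\<close>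

definition sq_integrable :: "(real \<Rightarrow> complex) \<Rightarrow> bool" where
  "sq_integrable f \<longleftrightarrow>
     f \<in> borel_measurable lborel \<and> integrable lborel (\<lambda>x. (cmod (f x))\<^sup>2)"

lemma sq_integrableD [dest]:
  assumes "sq_integrable f"
  shows "f \<in> borel_measurable lborel" "f \<in> borel_measurable borel"
    "integrable lborel (\<lambda>x. (cmod (f x))\<^sup>2)"
  using assms by (auto simp: sq_integrable_def)

lemma sq_integrable_0: "sq_integrable (\<lambda>x. 0)"
  by (auto simp: sq_integrable_def)

lemma sq_integrable_mult:
  assumes "sq_integrable f"
  shows "sq_integrable (\<lambda>x. c * f x)"
  using assms by (auto simp: sq_integrable_def norm_mult power_mult_distrib)

lemma sq_integrable_add:
  assumes "sq_integrable f" "sq_integrable g"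
  shows "sq_integrable (\<lambda>x. f x + g x)"
proof -
  note [measurable] = sq_integrableD(1)[OF assms(1)] sq_integrableD(1)[OF assms(2)]
  have "integrable lborel (\<lambda>x. 2 * (cmod (f x))\<^sup>2 + 2 * (cmod (g x))\<^sup>2)"
    using assms by (auto simp: sq_integrable_def)
  moreover have "norm ((cmod (f x + g x))\<^sup>2) \<le> norm (2 * (cmod (f x))\<^sup>2 + 2 * (cmod (g x))\<^sup>2)" for x
  proof -
    have "(cmod (f x + g x))\<^sup>2 \<le> (cmod (f x) + cmod (g x))\<^sup>2"
      by (intro power_mono norm_triangle_ineq) auto
    also have "\<dots> \<le> 2 * (cmod (f x))\<^sup>2 + 2 * (cmod (g x))\<^sup>2"
      using sum_squares_bound[of "cmod (f x)" "cmod (g x)"]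
      by (simp add: power2_sum)
    finally show ?thesis by simp
  qed
  ultimately have "integrable lborel (\<lambda>x. (cmod (f x + g x))\<^sup>2)"
    by (intro Bochner_Integration.integrable_bound[where g = "\<lambda>x. (cmod (f x + g x))\<^sup>2"] AE_I2) auto
  then show ?thesis by (auto simp: sq_integrable_def)
qed

lemma sq_integrable_uminus: "sq_integrable f \<Longrightarrow> sq_integrable (\<lambda>x. - f x)"
  using sq_integrable_mult[of f "-1"] by simp

lemma sq_integrable_diff:
  "sq_integrable f \<Longrightarrow> sq_integrable g \<Longrightarrow> sq_integrable (\<lambda>x. f x - g x)"
  using sq_integrable_add[of f "\<lambda>x. - g x"] sq_integrable_uminus[of g] by simp

lemma sq_integrable_scaleR: "sq_integrable f \<Longrightarrow> sq_integrable (\<lambda>x. r *\<^sub>R f x)"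
  using sq_integrable_mult[of f "of_real r"] by (simp add: scaleR_conv_of_real)

lemma integrable_inner_L2:
  assumes "sq_integrable f" "sq_integrable g"
  shows "integrable lborel (\<lambda>x. f x \<bullet> g x)"
proof -
  note [measurable] = sq_integrableD(1)[OF assms(1)] sq_integrableD(1)[OF assms(2)]
  have "integrable lborel (\<lambda>x. (cmod (f x))\<^sup>2 + (cmod (g x))\<^sup>2)"
    using assms by (auto simp: sq_integrable_def)
  moreover have "norm (f x \<bullet> g x) \<le> norm ((cmod (f x))\<^sup>2 + (cmod (g x))\<^sup>2)" for x
  proof -
    have "\<bar>f x \<bullet> g x\<bar> \<le> cmod (f x) * cmod (g x)" by (rule Cauchy_Schwarz_ineq2)
    also have "\<dots> \<le> (cmod (f x))\<^sup>2 + (cmod (g x))\<^sup>2"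
      using sum_squares_bound[of "cmod (f x)" "cmod (g x)"]
        mult_nonneg_nonneg[OF norm_ge_zero[of "f x"] norm_ge_zero[of "g x"]]
      unfolding mult.assoc by linarith
    finally show ?thesis by simp
  qed
  ultimately show ?thesis
    by (intro Bochner_Integration.integrable_bound[where g = "\<lambda>x. f x \<bullet> g x"] AE_I2) auto
qed

quotient_type L2 = "real \<Rightarrow> complex" / partial:
  "\<lambda>f g. sq_integrable f \<and> sq_integrable g \<and> (AE x in lborel. f x = g x)"
proof (rule part_equivpI)
  show "\<exists>f. sq_integrable f \<and> sq_integrable f \<and> (AE x in lborel. f x = f x)"
    by (rule exI[of _ "\<lambda>x. 0"]) (simp add: sq_integrable_0)
qed (auto intro!: sympI transpI elim: eventually_elim2)

instantiation L2 :: real_vector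
begin

lift_definition zero_L2 :: L2 is "\<lambda>x. 0"
  by (simp add: sq_integrable_0)

lift_definition plus_L2 :: "L2 \<Rightarrow> L2 \<Rightarrow> L2" is "\<lambda>f g x. f x + g x"
  by (auto intro: sq_integrable_add elim: eventually_elim2)

lift_definition minus_L2 :: "L2 \<Rightarrow> L2 \<Rightarrow> L2" is "\<lambda>f g x. f x - g x"
  by (auto intro: sq_integrable_diff elim: eventually_elim2)

lift_definition uminus_L2 :: "L2 \<Rightarrow> L2" is "\<lambda>f x. - f x"
  by (auto intro: sq_integrable_uminus)

lift_definition scaleR_L2 :: "real \<Rightarrow> L2 \<Rightarrow> L2" is "\<lambda>r f x. r *\<^sub>R f x"
  by (auto intro: sq_integrable_scaleR)

instance
proof
  fix u v w :: L2 and r s :: real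
  note [simp] = sq_integrable_0 sq_integrable_add sq_integrable_diff sq_integrable_uminus
    sq_integrable_scaleR
  show "u + v + w = u + (v + w)" by transfer (simp add: add.assoc)
  show "u + v = v + u" by transfer (simp add: add.commute)
  show "0 + u = u" by transfer simp
  show "- u + u = 0" by transfer simp
  show "u - v = u + - v" by transfer simp
  show "r *\<^sub>R (u + v) = r *\<^sub>R u + r *\<^sub>R v" by transfer (simp add: scaleR_add_right)
  show "(r + s) *\<^sub>R u = r *\<^sub>R u + s *\<^sub>R u" by transfer (simp add: scaleR_add_left)
  show "r *\<^sub>R s *\<^sub>R u = (r * s) *\<^sub>R u" by transfer simp
  show "1 *\<^sub>R u = u" by transfer simp
qed

end

instantiation L2 :: real_inner
begin

text \<open>The real inner product is the real part of the usual Hermitian one; it induces the same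
  norm.\<close>

lift_definition inner_L2 :: "L2 \<Rightarrow> L2 \<Rightarrow> real" is "\<lambda>f g. \<integral>x. f x \<bullet> g x \<partial>lborel"
proof -
  fix f f' g g' :: "real \<Rightarrow> complex"
  assume f: "sq_integrable f \<and> sq_integrable f' \<and> (AE x in lborel. f x = f' x)"
    and g: "sq_integrable g \<and> sq_integrable g' \<and> (AE x in lborel. g x = g' x)"
  then have [measurable]: "f \<in> borel_measurable lborel" "f' \<in> borel_measurable lborel"
    "g \<in> borel_measurable lborel" "g' \<in> borel_measurable lborel" by auto
  have "AE x in lborel. f x \<bullet> g x = f' x \<bullet> g' x"
    using f g by (auto elim: eventually_elim2)
  then show "(\<integral>x. f x \<bullet> g x \<partial>lborel) = (\<integral>x. f' x \<bullet> g' x \<partial>lborel)"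
    by (intro integral_cong_AE) auto
qed

definition norm_L2 :: "L2 \<Rightarrow> real" where "norm_L2 u = sqrt (u \<bullet> u)"
definition sgn_L2 :: "L2 \<Rightarrow> L2" where "sgn_L2 u = inverse (norm u) *\<^sub>R u"
definition dist_L2 :: "L2 \<Rightarrow> L2 \<Rightarrow> real" where "dist_L2 u v = norm (u - v)"
definition uniformity_L2 :: "(L2 \<times> L2) filter" where
  "uniformity_L2 = (INF e\<in>{0<..}. principal {(u, v). dist u v < e})"
definition open_L2 :: "L2 set \<Rightarrow> bool" where
  "open_L2 U \<longleftrightarrow> (\<forall>u\<in>U. \<forall>\<^sub>F (u', v) in uniformity. u' = u \<longrightarrow> v \<in> U)"

instance
proof
  fix u v w :: L2 and r :: real and U :: "L2 set"
  show "dist u v = norm (u - v)" by (simp add: dist_L2_def)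
  show "sgn u = inverse (norm u) *\<^sub>R u" by (simp add: sgn_L2_def)
  show "uniformity = (INF e\<in>{0<..}. principal {(u::L2, v). dist u v < e})"
    by (simp add: uniformity_L2_def)
  show "open U = (\<forall>u\<in>U. \<forall>\<^sub>F (u', v) in uniformity. u' = u \<longrightarrow> v \<in> U)"
    by (simp add: open_L2_def)
  show "u \<bullet> v = v \<bullet> u"
    by transfer (simp add: inner_commute)
  show "(u + v) \<bullet> w = u \<bullet> w + v \<bullet> w"
    by transfer (simp add: inner_add_left integrable_inner_L2)
  show "(r *\<^sub>R u) \<bullet> v = r * (u \<bullet> v)"
    by transfer (simp add: integrable_inner_L2)
  show "0 \<le> u \<bullet> u"
    by transfer simp
  show "(u \<bullet> u = 0) = (u = 0)"
  proof transfer
    fix f assume "sq_integrable f \<and> sq_integrable f \<and> (AE x in lborel. f x = f x)"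
    then have f: "sq_integrable f" by simp
    have "(\<integral>x. f x \<bullet> f x \<partial>lborel) = 0 \<longleftrightarrow> (AE x in lborel. f x \<bullet> f x = 0)"
      by (rule integral_nonneg_eq_0_iff_AE) (auto intro: integrable_inner_L2 f)
    then show "((\<integral>x. f x \<bullet> f x \<partial>lborel) = 0) =
        (sq_integrable f \<and> sq_integrable (\<lambda>x. 0) \<and> (AE x in lborel. f x = 0))"
      using f by (simp add: sq_integrable_0)
  qed
  show "norm u = sqrt (u \<bullet> u)" by (simp add: norm_L2_def)
qed

end

lemma norm_L2_abs:
  assumes "sq_integrable f"
  shows "(norm (abs_L2 f))\<^sup>2 = (\<integral>x. (cmod (f x))\<^sup>2 \<partial>lborel)"
proof -
  have "abs_L2 f \<bullet> abs_L2 f = (\<integral>x. f x \<bullet> f x \<partial>lborel)"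
    using assms by (simp add: inner_L2.abs_eq)
  then show ?thesis
    by (simp add: power2_norm_eq_inner)
qed

lemma sq_integrable_rep: "sq_integrable (rep_L2 u)"
  using Quotient_rep_reflp[OF Quotient_L2] by auto

lemma abs_rep_L2: "abs_L2 (rep_L2 u) = u"
  by (rule Quotient_abs_rep[OF Quotient_L2])

instance L2 :: banach
proof
  fix X :: "nat \<Rightarrow> L2" assume "Cauchy X"
  then have "\<forall>k. \<exists>N. \<forall>m\<ge>N. \<forall>n\<ge>N. dist (X m) (X n) < (1/2) ^ k"
    by (auto simp: Cauchy_def)
  then obtain N where N: "\<And>k m n. m \<ge> N k \<Longrightarrow> n \<ge> N k \<Longrightarrow> dist (X m) (X n) < (1/2) ^ k"
    by metis
  define r where "r k = (\<Sum>i\<le>k. N i)" for k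
  have rN: "r m \<ge> N k" if "k \<le> m" for k m
    unfolding r_def using that by (intro member_le_sum) auto
  define f where "f k = rep_L2 (X (r k))" for k
  have f: "sq_integrable (f k)" for k
    by (simp add: f_def sq_integrable_rep)
  note [measurable] = sq_integrableD(1)[OF f] sq_integrableD(2)[OF f]
  have fX: "abs_L2 (f k) = X (r k)" for k
    by (simp add: f_def abs_rep_L2)
  have diff: "abs_L2 (\<lambda>x. f m x - f k x) = X (r m) - X (r k)" for m k
    using minus_L2.abs_eq[of "f m" "f k"] f by (simp add: fX)
  have nn: "(\<integral>\<^sup>+x. ennreal ((cmod (f m x - f k x))\<^sup>2) \<partial>lborel) \<le> ennreal ((1/4) ^ k)"
    if "k \<le> m" for m k
  proof -
    have "(\<integral>\<^sup>+x. ennreal ((cmod (f m x - f k x))\<^sup>2) \<partial>lborel)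
        = ennreal (\<integral>x. (cmod (f m x - f k x))\<^sup>2 \<partial>lborel)"
      using sq_integrableD(3)[OF sq_integrable_diff[OF f f]]
      by (intro nn_integral_eq_integral) auto
    also have "(\<integral>x. (cmod (f m x - f k x))\<^sup>2 \<partial>lborel) = (dist (X (r m)) (X (r k)))\<^sup>2"
      using norm_L2_abs[OF sq_integrable_diff[OF f f]] by (simp add: diff dist_norm)
    also have "\<dots> \<le> ((1/2) ^ k)\<^sup>2"
      using N[of k "r m" "r k"] rN that by (intro power_mono) (auto intro: less_imp_le)
    also have "((1/2) ^ k)\<^sup>2 = ((1/4) ^ k :: real)"
      by (simp flip: power_mult_distrib add: power2_eq_square)
    finally show ?thesis by (simp add: ennreal_leI)
  qed
  define S where "S x = (\<Sum>k. ennreal (2 ^ k * (cmod (f (Suc k) x - f k x))\<^sup>2))" for x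
  have "(\<integral>\<^sup>+x. S x \<partial>lborel)
      = (\<Sum>k. \<integral>\<^sup>+x. ennreal (2 ^ k * (cmod (f (Suc k) x - f k x))\<^sup>2) \<partial>lborel)"
    unfolding S_def by (rule nn_integral_suminf) measurable
  also have "\<dots> \<le> (\<Sum>k. ennreal ((1/2) ^ k))"
  proof (rule suminf_le)
    fix k
    have "(\<integral>\<^sup>+x. ennreal (2 ^ k * (cmod (f (Suc k) x - f k x))\<^sup>2) \<partial>lborel)
        = ennreal (2 ^ k) * (\<integral>\<^sup>+x. ennreal ((cmod (f (Suc k) x - f k x))\<^sup>2) \<partial>lborel)"
      by (simp add: ennreal_mult nn_integral_cmult)
    also have "\<dots> \<le> ennreal (2 ^ k) * ennreal ((1/4) ^ k)"
      by (intro mult_left_mono nn) auto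
    also have "\<dots> = ennreal ((1/2) ^ k)"
      by (simp flip: ennreal_mult power_mult_distrib)
    finally show "(\<integral>\<^sup>+x. ennreal (2 ^ k * (cmod (f (Suc k) x - f k x))\<^sup>2) \<partial>lborel)
        \<le> ennreal ((1/2) ^ k)" .
  qed auto
  also have "\<dots> < \<infinity>"
    using summable_geometric[of "1/2::real"] by (simp add: suminf_ennreal2 del: power_divide)
  finally have "(\<integral>\<^sup>+x. S x \<partial>lborel) \<noteq> \<infinity>" by simp
  moreover have "S \<in> borel_measurable lborel"
    unfolding S_def by measurable
  ultimately have "AE x in lborel. S x \<noteq> \<infinity>"
    by (intro nn_integral_noteq_infinite) auto
  moreover have conv: "convergent (\<lambda>k. f k x)" if "S x \<noteq> \<infinity>" for x
  proof -
    have "summable (\<lambda>k. 2 ^ k * (cmod (f (Suc k) x - f k x))\<^sup>2)"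
      using that unfolding S_def by (intro summable_suminf_not_top) auto
    then have "Bseq (\<lambda>k. 2 ^ k * (cmod (f (Suc k) x - f k x))\<^sup>2)"
      by (rule convergent_imp_Bseq[OF convergentI[OF summable_LIMSEQ_zero]])
    then obtain M where M: "M > 0" "\<And>k. norm (2 ^ k * (cmod (f (Suc k) x - f k x))\<^sup>2) \<le> M"
      by (auto elim: BseqE)
    have "cmod (f (Suc k) x - f k x) \<le> sqrt M * sqrt (1/2) ^ k" for k
    proof -
      have "(cmod (f (Suc k) x - f k x))\<^sup>2 \<le> M * (1/2) ^ k"
        using M(2)[of k] by (simp add: field_simps)
      then have "cmod (f (Suc k) x - f k x) \<le> sqrt (M * (1/2) ^ k)"
        by (rule real_le_rsqrt)
      then show ?thesis by (simp add: real_sqrt_mult real_sqrt_power real_sqrt_divide)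
    qed
    moreover have "summable (\<lambda>k. sqrt M * sqrt (1/2) ^ k)"
      by (intro summable_mult summable_geometric) (simp add: real_sqrt_divide)
    ultimately have "summable (\<lambda>k. f (Suc k) x - f k x)"
      by (rule summable_comparison_test'[where N = 0, rotated]) 
    then have "convergent (\<lambda>n. f 0 x + (\<Sum>k<n. f (Suc k) x - f k x))"
      by (intro convergent_add convergent_const) (simp add: summable_iff_convergent)
    moreover have "f 0 x + (\<Sum>k<n. f (Suc k) x - f k x) = f n x" for n
      using sum_lessThan_telescope[of "\<lambda>k. f k x" n] by simp
    ultimately show ?thesis by simp
  qed
  ultimately have AE: "AE x in lborel. convergent (\<lambda>k. f k x)"
    by (auto elim: eventually_mono)
  define g where "g x = lim (\<lambda>k. f k x)" for x
  have g_meas [measurable]: "g \<in> borel_measurable lborel"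
    unfolding g_def by (rule borel_measurable_lim_metric) measurable
  have fatou: "(\<integral>\<^sup>+x. ennreal ((cmod (g x - f k x))\<^sup>2) \<partial>lborel) \<le> ennreal ((1/4) ^ k)" for k
  proof -
    have "AE x in lborel. ennreal ((cmod (g x - f k x))\<^sup>2)
        = liminf (\<lambda>m. ennreal ((cmod (f m x - f k x))\<^sup>2))"
      using AE
    proof eventually_elim
      case (elim x)
      then have "(\<lambda>m. f m x) \<longlonglongrightarrow> g x" by (simp add: g_def convergent_LIMSEQ_iff)
      then have "(\<lambda>m. ennreal ((cmod (f m x - f k x))\<^sup>2)) \<longlonglongrightarrow> ennreal ((cmod (g x - f k x))\<^sup>2)"
        by (intro tendsto_intros)
      then show ?case by (intro lim_imp_Liminf[symmetric]) simp_all
    qed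
    then have "(\<integral>\<^sup>+x. ennreal ((cmod (g x - f k x))\<^sup>2) \<partial>lborel)
        = (\<integral>\<^sup>+x. liminf (\<lambda>m. ennreal ((cmod (f m x - f k x))\<^sup>2)) \<partial>lborel)"
      by (rule nn_integral_cong_AE)
    also have "\<dots> \<le> liminf (\<lambda>m. \<integral>\<^sup>+x. ennreal ((cmod (f m x - f k x))\<^sup>2) \<partial>lborel)"
      by (rule nn_integral_liminf) measurable
    also have "\<dots> \<le> liminf (\<lambda>m::nat. ennreal ((1/4) ^ k))"
      by (rule Liminf_mono) (auto intro!: nn eventually_sequentiallyI)
    also have "\<dots> = ennreal ((1/4) ^ k)" by (simp add: Liminf_const)
    finally show ?thesis .
  qed
  have gf: "sq_integrable (\<lambda>x. g x - f k x)" for k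
    unfolding sq_integrable_def
  proof
    show "integrable lborel (\<lambda>x. (cmod (g x - f k x))\<^sup>2)"
      using fatou[of k] by (intro integrableI_nonneg) (auto simp: order.strict_trans1)
  qed measurable
  have g: "sq_integrable g"
    using sq_integrable_add[OF gf[of 0] f[of 0]] by simp
  have lim: "dist (X (r k)) (abs_L2 g) \<le> (1/2) ^ k" for k
  proof -
    have "abs_L2 (\<lambda>x. g x - f k x) = abs_L2 g - X (r k)"
      using minus_L2.abs_eq[of g "f k"] f g by (simp add: fX)
    then have "(dist (X (r k)) (abs_L2 g))\<^sup>2 = (\<integral>x. (cmod (g x - f k x))\<^sup>2 \<partial>lborel)"
      using norm_L2_abs[OF gf[of k]] by (simp add: dist_norm norm_minus_commute)
    also have "ennreal \<dots> = (\<integral>\<^sup>+x. ennreal ((cmod (g x - f k x))\<^sup>2) \<partial>lborel)"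
      using sq_integrableD(3)[OF gf] by (intro nn_integral_eq_integral[symmetric]) auto
    also note fatou[of k]
    finally have "(dist (X (r k)) (abs_L2 g))\<^sup>2 \<le> (1/4) ^ k" by simp
    also have "(1/4) ^ k = (((1/2) ^ k)\<^sup>2 :: real)"
      by (simp flip: power_mult_distrib add: power2_eq_square)
    finally show ?thesis by (rule power2_le_imp_le) simp
  qed
  have "X \<longlonglongrightarrow> abs_L2 g"
  proof (rule metric_LIMSEQ_I)
    fix e :: real assume "e > 0"
    then obtain k where k: "(1/2) ^ k < e / 2"
      using real_arch_pow_inv[of "e / 2" "1 / 2"] by auto
    have "dist (X n) (abs_L2 g) < e" if "n \<ge> N k" for n
      using dist_triangle[of "X n" "abs_L2 g" "X (r k)"] N[of k n "r k"] rN[of k k] that lim[of k] k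
      by simp
    then show "\<exists>n0. \<forall>n\<ge>n0. dist (X n) (abs_L2 g) < e" by auto
  qed
  then show "convergent X" by (auto simp: convergent_def)
qed

lift_definition scaleC :: "complex \<Rightarrow> L2 \<Rightarrow> L2" (infixr "*\<^sub>C" 75) is "\<lambda>c f x. c * f x"
  by (auto intro: sq_integrable_mult)

lemma norm_scaleC: "norm (c *\<^sub>C u) = cmod c * norm u"
proof -
  have "(c *\<^sub>C u) \<bullet> (c *\<^sub>C u) = (cmod c)\<^sup>2 * (u \<bullet> u)"
    by transfer (simp add: power2_norm_eq_inner[symmetric] norm_mult power_mult_distrib)
  then show ?thesis by (simp add: norm_L2_def real_sqrt_mult)
qed

lemma bounded_linear_scaleC: "bounded_linear (\<lambda>u. c *\<^sub>C u)"
proof (rule bounded_linear_intro[where K = "cmod c"])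
  show "c *\<^sub>C (u + v) = c *\<^sub>C u + c *\<^sub>C v" for u v
    by transfer (simp add: sq_integrable_mult sq_integrable_add distrib_left)
  show "c *\<^sub>C (r *\<^sub>R u) = r *\<^sub>R (c *\<^sub>C u)" for r u
    by transfer (simp add: sq_integrable_mult sq_integrable_scaleR)
qed (simp add: norm_scaleC)

text \<open>Bounded operators are real-linear here, and carry the operator norm; those below are
  complex-linear, being built from inverses of complex-linear operators.\<close>

definition scaleC_op :: "complex \<Rightarrow> (L2 \<Rightarrow>\<^sub>L L2) \<Rightarrow> (L2 \<Rightarrow>\<^sub>L L2)" where
  "scaleC_op c T = Blinfun (\<lambda>u. c *\<^sub>C blinfun_apply T u)"

lemma scaleC_op_apply [simp]: "blinfun_apply (scaleC_op c T) u = c *\<^sub>C blinfun_apply T u"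
  unfolding scaleC_op_def
  by (subst bounded_linear_Blinfun_apply)
    (auto intro: bounded_linear_compose[OF bounded_linear_scaleC] blinfun.bounded_linear_right)


section \<open>Unbounded operators, spectrum and spectral projections\<close>

text \<open>An unbounded operator is given by its graph. A bounded operator \<open>R\<close> inverts
  \<open>\<zeta> - A\<close> iff the graph of \<open>\<zeta> - A\<close> is the converse of the graph of \<open>R\<close>, where \<open>(\<zeta> - A) u = f\<close>
  means that \<open>u\<close> is in the domain of \<open>A\<close> and \<open>A u = \<zeta> u - f\<close>.\<close>

type_synonym unbounded_op = "(L2 \<times> L2) set"

definition is_resolvent :: "unbounded_op \<Rightarrow> complex \<Rightarrow> (L2 \<Rightarrow>\<^sub>L L2) \<Rightarrow> bool" where
  "is_resolvent A \<zeta> R \<longleftrightarrow> (\<forall>u f. (u, \<zeta> *\<^sub>C u - f) \<in> A \<longleftrightarrow> u = blinfun_apply R f)"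

definition spectrum :: "unbounded_op \<Rightarrow> complex set" where
  "spectrum A = {\<zeta>. \<nexists>R. is_resolvent A \<zeta> R}"

definition resolvent :: "unbounded_op \<Rightarrow> complex \<Rightarrow> (L2 \<Rightarrow>\<^sub>L L2)" where
  "resolvent A \<zeta> = (THE R. is_resolvent A \<zeta> R)"

text \<open>The contour is \<open>\<zeta>(t) = z + r exp (i t)\<close>. Any admissible radius will do, since the resolvent
  is holomorphic off the spectrum.\<close>

definition isolating_radius :: "unbounded_op \<Rightarrow> complex \<Rightarrow> real" where
  "isolating_radius A z = (SOME r. r > 0 \<and> spectrum A \<inter> cball z r \<subseteq> {z})"

definition spectral_projection :: "unbounded_op \<Rightarrow> complex \<Rightarrow> (L2 \<Rightarrow>\<^sub>L L2)" where
  "spectral_projection A z =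
     (let r = isolating_radius A z in
      scaleC_op (1 / (2 * of_real pi * \<i>))
        (integral {0..2 * pi}
          (\<lambda>t. scaleC_op (of_real r * \<i> * cis t) (resolvent A (z + of_real r * cis t)))))"


section \<open>Quadratic forms and their Weyl quantization\<close>

datatype quadratic_form = QForm (q20: complex) (q11: complex) (q02: complex)

definition symbol :: "quadratic_form \<Rightarrow> real \<Rightarrow> real \<Rightarrow> complex" where
  "symbol q x \<xi> = q20 q * of_real x ^ 2 + q11 q * of_real x * of_real \<xi> + q02 q * of_real \<xi> ^ 2"

definition test_function :: "(real \<Rightarrow> complex) \<Rightarrow> bool" where
  "test_function \<phi> \<longleftrightarrow>
     (\<forall>k x. ((\<lambda>f y. vector_derivative f (at y)) ^^ k) \<phi> differentiable at x) \<and>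
     (\<exists>R. \<forall>x. R < \<bar>x\<bar> \<longrightarrow> \<phi> x = 0)"

text \<open>Distributions are functionals on test functions; \<open>D\<^sub>x = -i d/dx\<close> acts by
  \<open>(D\<^sub>x T)(\<phi>) = - T (D\<^sub>x \<phi>)\<close>.\<close>

type_synonym distribution = "(real \<Rightarrow> complex) \<Rightarrow> complex"

definition of_L2 :: "L2 \<Rightarrow> distribution" where
  "of_L2 u = (\<lambda>\<phi>. \<integral>x. rep_L2 u x * \<phi> x \<partial>lborel)"

definition mult_x :: "distribution \<Rightarrow> distribution" where
  "mult_x T = (\<lambda>\<phi>. T (\<lambda>x. of_real x * \<phi> x))"

definition D_x :: "distribution \<Rightarrow> distribution" where
  "D_x T = (\<lambda>\<phi>. - T (\<lambda>x. - \<i> * vector_derivative \<phi> (at x)))"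

definition weyl_dist :: "quadratic_form \<Rightarrow> distribution \<Rightarrow> distribution" where
  "weyl_dist q T = (\<lambda>\<phi>.
     q20 q * mult_x (mult_x T) \<phi>
     + q11 q / 2 * (mult_x (D_x T) \<phi> + D_x (mult_x T) \<phi>)
     + q02 q * D_x (D_x T) \<phi>)"

text \<open>Maximal realization: the domain consists of all \<open>u\<close> in \<open>L\<^sup>2\<close> for which the
  distribution \<open>q\<^sup>w u\<close> is again in \<open>L\<^sup>2\<close>.\<close>

definition weyl :: "quadratic_form \<Rightarrow> unbounded_op" where
  "weyl q = {(u, v). \<forall>\<phi>. test_function \<phi> \<longrightarrow> weyl_dist q (of_L2 u) \<phi> = of_L2 v \<phi>}"


section \<open>The Hamilton map and the number \<open>C\<^sub>+\<close>\<close>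

definition partial_x :: "(real \<Rightarrow> real \<Rightarrow> complex) \<Rightarrow> real \<Rightarrow> real \<Rightarrow> complex" where
  "partial_x f x \<xi> = vector_derivative (\<lambda>y. f y \<xi>) (at x)"

definition partial_xi :: "(real \<Rightarrow> real \<Rightarrow> complex) \<Rightarrow> real \<Rightarrow> real \<Rightarrow> complex" where
  "partial_xi f x \<xi> = vector_derivative (\<lambda>\<eta>. f x \<eta>) (at \<xi>)"

text \<open>The second derivatives are constant, so it does not matter that they are taken at the
  origin.\<close>

definition hamilton_map :: "quadratic_form \<Rightarrow> complex^2^2" where
  "hamilton_map q = (1/2) *\<^sub>R vector [
     vector [partial_xi (partial_x (symbol q)) 0 0, partial_xi (partial_xi (symbol q)) 0 0],
     vector [- partial_x (partial_x (symbol q)) 0 0, - partial_x (partial_xi (symbol q)) 0 0]]"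

lemma partial_x_symbol:
  "partial_x (symbol q) = (\<lambda>x \<xi>. 2 * q20 q * of_real x + q11 q * of_real \<xi>)"
  unfolding partial_x_def symbol_def
  by (intro ext vector_derivative_at)
    (auto intro!: derivative_eq_intros simp: power2_eq_square algebra_simps)

lemma partial_xi_symbol:
  "partial_xi (symbol q) = (\<lambda>x \<xi>. q11 q * of_real x + 2 * q02 q * of_real \<xi>)"
  unfolding partial_xi_def symbol_def
  by (intro ext vector_derivative_at)
    (auto intro!: derivative_eq_intros simp: power2_eq_square algebra_simps)

lemma hamilton_map_eq:
  "hamilton_map q = vector [vector [q11 q / 2, q02 q], vector [- q20 q, - q11 q / 2]]"
proof -
  have "partial_xi (partial_x (symbol q)) 0 0 = q11 q"
    "partial_x (partial_xi (symbol q)) 0 0 = q11 q"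
    "partial_x (partial_x (symbol q)) 0 0 = 2 * q20 q"
    "partial_xi (partial_xi (symbol q)) 0 0 = 2 * q02 q"
    unfolding partial_x_symbol partial_xi_symbol unfolding partial_x_def partial_xi_def
    by (auto intro!: vector_derivative_at derivative_eq_intros)
  then show ?thesis
    by (simp add: hamilton_map_def vec_eq_iff forall_2 scaleR_conv_of_real[where 'a = complex])
qed

definition Re_mat :: "complex^2^2 \<Rightarrow> real^2^2" where
  "Re_mat M = (\<chi> i j. Re (M $ i $ j))"

definition Im_mat :: "complex^2^2 \<Rightarrow> real^2^2" where
  "Im_mat M = (\<chi> i j. Im (M $ i $ j))"

text \<open>The power \<open>(Im F)\<^sup>k\<close> is iterated application (the power operation on the type of
  matrices would be entrywise).\<close>

definition singular_space :: "quadratic_form \<Rightarrow> (real^2) set" where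
  "singular_space q = (\<Inter>k. {v. Re_mat (hamilton_map q) *v
     (((\<lambda>w. Im_mat (hamilton_map q) *v w) ^^ k) v) = 0})"

definition partially_elliptic :: "quadratic_form \<Rightarrow> bool" where
  "partially_elliptic q \<longleftrightarrow> (\<forall>x \<xi>. 0 \<le> Re (symbol q x \<xi>))"

definition eigenspace :: "complex^2^2 \<Rightarrow> complex \<Rightarrow> (complex^2) set" where
  "eigenspace M l = {v. M *v v = l *s v}"

definition eigenvalue :: "complex^2^2 \<Rightarrow> complex \<Rightarrow> bool" where
  "eigenvalue M l \<longleftrightarrow> (\<exists>v. v \<noteq> 0 \<and> M *v v = l *s v)"

definition lambda_plus :: "quadratic_form \<Rightarrow> complex" where
  "lambda_plus q = (THE l. eigenvalue (hamilton_map q) l \<and> Im l > 0)"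

definition lambda_minus :: "quadratic_form \<Rightarrow> complex" where
  "lambda_minus q = (THE l. eigenvalue (hamilton_map q) l \<and> Im l < 0)"

definition Lambda_plus :: "quadratic_form \<Rightarrow> (complex^2) set" where
  "Lambda_plus q = eigenspace (hamilton_map q) (lambda_plus q)"

definition Lambda_minus :: "quadratic_form \<Rightarrow> (complex^2) set" where
  "Lambda_minus q = eigenspace (hamilton_map q) (lambda_minus q)"

definition graph_slope :: "(complex^2) set \<Rightarrow> complex" where
  "graph_slope \<Lambda> = (THE a. \<Lambda> = {vector [y, a * y] | y. True})"

definition A_minus :: "quadratic_form \<Rightarrow> complex" where
  "A_minus q = graph_slope (Lambda_minus q)"

definition kappa :: "quadratic_form \<Rightarrow> complex^2^2" where
  "kappa q = (let s = sqrt (- Im (A_minus q)) in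
     vector [vector [of_real s, 0],
             vector [of_real (- (inverse s * Re (A_minus q))), of_real (inverse s)]])"

definition A_plus :: "quadratic_form \<Rightarrow> complex" where
  "A_plus q = graph_slope ((\<lambda>v. kappa q *v v) ` Lambda_plus q)"

definition C_plus :: "quadratic_form \<Rightarrow> complex" where
  "C_plus q = inverse (1 - \<i> * A_plus q) * (1 + \<i> * A_plus q)"

definition mu :: "quadratic_form \<Rightarrow> nat \<Rightarrow> complex" where
  "mu q N = lambda_plus q / \<i> * of_nat (2 * N + 1)"


section \<open>Asymptotic expansions in half-integer powers\<close>

definition has_half_power_expansion :: "(nat \<Rightarrow> real) \<Rightarrow> (nat \<Rightarrow> real) \<Rightarrow> bool" where
  "has_half_power_expansion a c \<longleftrightarrow>
     (\<forall>J. (\<lambda>N. a N - (\<Sum>j<J. c j * real N powr (- real j - 1/2)))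
            \<in> O(\<lambda>N. real N powr (- real J - 1/2)))"

end

(* Write q = k (xi - p x)(xi - m x) with Im p > 0 > Im m and put sigma = -ip/2, tau = im/2,
   gamma = sigma + tau. On functions P(x) exp(-sigma x^2), P a polynomial, the operator acts through
   the ladder operators d/dx + 2 sigma x and d/dx - 2 tau x, so its eigenfunctions are
   u_N = H_N exp(-sigma x^2) with H_N a Hermite polynomial for the weight exp(-gamma x^2), and those of
   the transposed operator are v_N = H_N exp(-tau x^2). The form q/(gamma k) has positive definite real
   part, which gives a lower bound for |(zeta - q^w) u| when Re (zeta/(gamma k)) < 0; the ladder carries
   it past the eigenvalues one at a time. Together with the density of the functions
   P exp(-sigma x^2) and P exp(-tau x^2) this bound yields the resolvent, whose contour integral is then
   determined by its values on the u_n: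
   Pi_N u = (int u v_N / int u_N v_N) u_N. Expanding H_N in Hermite polynomials for the real
   weights exp(-2 Re sigma x^2) and exp(-2 Re tau x^2) gives, with c = |C_+|,
   |Pi_N| = (1 - c^2)^(-N/2 - 1/4) (1/(2 pi)) int (1 + c cos theta)^N d theta over the circle,
   and Laplace's method finishes the proof. *)

theory Submission
  imports Defs "HOL-Probability.Probability" "HOL-Complex_Analysis.Complex_Analysis"
begin


section \<open>The eigenspaces of the Hamilton map\<close>

text \<open>In general the operator is not normal: its eigenfunctions are not orthogonal and
  expansions in them need not converge, so no eigenfunction series can define the resolvent. On the
  core of functions \<open>P exp (- \<sigma> x^2)\<close> solving the resolvent equation is plain
  algebra, and only the bound on the solution needs analysis. The quadratic form controls the
  operator in a half plane only, which is why the ladder is needed. As the domain is maximal,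
  uniqueness has to hold for every distributional solution; for this the weak equation is extended
  from compactly supported test functions to the functions \<open>P exp (- \<tau> x^2)\<close>. All
  pairings are bilinear because the transposed operator, unlike the adjoint, is again of the same
  form with \<sigma> and \<tau> exchanged, and because the integral of
  \<open>H_j H_k exp (- \<gamma> x^2)\<close> vanishes for distinct indices although \<gamma> is
  complex. The integral over the circle enters because the squared expansion coefficients of
  \<open>H_N\<close> contain central binomial coefficients, which are the moments of
  \<open>cos \<theta>\<close>.\<close>

lemma matrix2_mult_vector2:
  fixes a b c d x y :: "'a::comm_ring_1"
  shows "(vector [vector [a, b], vector [c, d]] :: 'a^2^2) *v vector [x, y]
    = vector [a * x + b * y, c * x + d * y]"
  by (simp add: matrix_vector_mult_def vec_eq_iff forall_2 sum_2)

lemma vector2_eq_iff: "(vector [a, b] :: 'a::zero^2) = vector [c, d] \<longleftrightarrow> a = c \<and> b = d"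
  by (auto simp: vec_eq_iff forall_2)

lemma vector2_cases:
  obtains x y where "(v :: 'a::zero^2) = vector [x, y]"
proof
  show "v = vector [v $ 1, v $ 2]" by (simp add: vec_eq_iff forall_2)
qed

lemma Re_mat_vector2: "Re_mat (vector [vector [a, b], vector [c, d]])
    = vector [vector [Re a, Re b], vector [Re c, Re d]]"
  by (simp add: Re_mat_def vec_eq_iff forall_2)

lemma Im_mat_vector2: "Im_mat (vector [vector [a, b], vector [c, d]])
    = vector [vector [Im a, Im b], vector [Im c, Im d]]"
  by (simp add: Im_mat_def vec_eq_iff forall_2)

section \<open>Real zeros of the symbol and the singular space\<close>

lemma Re_symbol: "Re (symbol q x \<xi>)
    = Re (q20 q) * x\<^sup>2 + Re (q11 q) * x * \<xi> + Re (q02 q) * \<xi>\<^sup>2"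
  by (simp add: symbol_def power2_eq_square)

lemma Im_symbol: "Im (symbol q x \<xi>)
    = Im (q20 q) * x\<^sup>2 + Im (q11 q) * x * \<xi> + Im (q02 q) * \<xi>\<^sup>2"
  by (simp add: symbol_def power2_eq_square)

text \<open>Near \<open>t = 0\<close> the linear term dominates, so a nonzero slope would make the
  expression negative on one side. It serves twice: for the kernel of a nonnegative form and for the
  variational argument behind orthogonal projection.\<close>

lemma nonneg_linear_plus_quadratic:
  fixes b c :: real
  assumes "\<And>t. 0 \<le> b * t + c * t\<^sup>2"
  shows "b = 0"
proof (rule ccontr)
  assume "b \<noteq> 0"
  \<comment> \<open>A strictly positive majorant of \<open>c\<close>, so that the vertex
    \<open>- b / (2 * e)\<close> makes sense for every \<open>c\<close>.\<close>
  define e where "e = \<bar>c\<bar> + 1"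
  have "e > 0" by (simp add: e_def)
  define t where "t = - b / (2 * e)"
  have "b * t + c * t\<^sup>2 \<le> b * t + \<bar>c\<bar> * t\<^sup>2"
    by (intro add_left_mono mult_right_mono) auto
  also have "\<dots> \<le> b * t + e * t\<^sup>2" 
    by (intro add_left_mono mult_right_mono) (auto simp: e_def)
  also have "\<dots> = - b\<^sup>2 / (4 * e)"
    unfolding t_def using \<open>e > 0\<close> by (simp add: field_simps power2_eq_square)
  also have "\<dots> < 0" using \<open>b \<noteq> 0\<close> \<open>e > 0\<close> by (simp add: divide_neg_pos)
  finally show False using assms[of t] by simp
qed

text \<open>A zero of a nonnegative form is a minimum, so both partial derivatives vanish there. The
  conclusions are halves of these derivatives and, up to sign, the two components of
  \<open>Re F\<close> applied to \<open>(x, y)\<close>.\<close>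

lemma nonneg_form_kernel:
  fixes a b c x y :: real
  assumes nn: "\<And>x y. 0 \<le> a * x\<^sup>2 + b * x * y + c * y\<^sup>2"
    and 0: "a * x\<^sup>2 + b * x * y + c * y\<^sup>2 = 0"
  shows "b / 2 * x + c * y = 0" "a * x + b / 2 * y = 0"
proof -
  have "0 \<le> (b * x + 2 * c * y) * t + c * t\<^sup>2" for t
    using nn[of x "y + t"] 0 by (simp add: power2_eq_square algebra_simps)
  from nonneg_linear_plus_quadratic[OF this] show "b / 2 * x + c * y = 0" by (simp add: field_simps)
  have "0 \<le> (2 * a * x + b * y) * t + a * t\<^sup>2" for t
    using nn[of "x + t" y] 0 by (simp add: power2_eq_square algebra_simps)
  from nonneg_linear_plus_quadratic[OF this] show "a * x + b / 2 * y = 0" by (simp add: field_simps)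
qed

lemma parallel_of_symplectic_zero:
  fixes x y u v :: real
  assumes "u * y = v * x" "x \<noteq> 0 \<or> y \<noteq> 0"
  obtains c where "u = c * x" "v = c * y"
proof (cases "x = 0")
  case True
  then show ?thesis using assms that[of "v / y"] by simp
next
  case False
  then show ?thesis using assms that[of "u / x"] by (simp add: field_simps)
qed

text \<open>At a real zero \<open>v\<close>, the real part of \<open>q\<close> is minimal, so
  \<open>Re F\<close> kills \<open>v\<close>. The vanishing of the imaginary part says that
  \<open>v\<close> and \<open>Im F v\<close> have symplectic product zero, hence are parallel in the
  plane. So \<open>v\<close> is an eigenvector of \<open>Im F\<close> and lies in the singular
  space.\<close>

lemma symbol_eq_0_imp:
  assumes pe: "partially_elliptic q" and S: "singular_space q = {0}"
    and 0: "symbol q x \<xi> = 0"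
  shows "x = 0 \<and> \<xi> = 0"
proof (rule ccontr)
  assume nz: "\<not> (x = 0 \<and> \<xi> = 0)"
  let ?v = "vector [x, \<xi>] :: real^2"
  have nn: "0 \<le> Re (q20 q) * x\<^sup>2 + Re (q11 q) * x * y + Re (q02 q) * y\<^sup>2" for x y
    using pe by (simp add: partially_elliptic_def Re_symbol)
  have ker: "Re_mat (hamilton_map q) *v ?v = 0"
    using nonneg_form_kernel[of "Re (q20 q)" "Re (q11 q)" "Re (q02 q)" x \<xi>, OF nn]
      arg_cong[OF 0, of Re]
    by (simp add: hamilton_map_eq Re_mat_vector2 matrix2_mult_vector2 Re_symbol
        vec_eq_iff forall_2)
  define u v where "u = Im (q11 q) / 2 * x + Im (q02 q) * \<xi>"
    and "v = - Im (q20 q) * x - Im (q11 q) / 2 * \<xi>"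
  have "u * \<xi> = v * x"
    using arg_cong[OF 0, of Im]
    by (simp add: Im_symbol u_def v_def power2_eq_square algebra_simps)
  then obtain c where c: "u = c * x" "v = c * \<xi>"
    using parallel_of_symplectic_zero nz by metis
  have ImF: "Im_mat (hamilton_map q) *v (d *\<^sub>R ?v) = (c * d) *\<^sub>R ?v" for d
  proof -
    have "Im_mat (hamilton_map q) *v ?v = c *\<^sub>R ?v"
      using c by (simp add: hamilton_map_eq Im_mat_vector2 matrix2_mult_vector2 u_def v_def
          vec_eq_iff forall_2 algebra_simps)
    then show ?thesis
      by (simp add: matrix_vector_mult_scaleR mult.commute)
  qed
  have "((\<lambda>w. Im_mat (hamilton_map q) *v w) ^^ k) ?v = (c ^ k) *\<^sub>R ?v" for k
    by (induction k) (simp_all add: ImF)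
  then have "?v \<in> singular_space q"
    using ker by (simp add: singular_space_def matrix_vector_mult_scaleR)
  then show False using S nz by (simp add: vec_eq_iff forall_2)
qed

lemma real_part_nonzero:
  assumes S: "singular_space q = {0}"
  shows "Re (q20 q) \<noteq> 0 \<or> Re (q11 q) \<noteq> 0 \<or> Re (q02 q) \<noteq> 0"
proof (rule ccontr)
  assume "\<not> ?thesis"
  then have "Re_mat (hamilton_map q) *v vector [x, y] = 0" for x y
    by (simp add: hamilton_map_eq Re_mat_vector2 matrix2_mult_vector2)
      (simp add: vec_eq_iff forall_2)
  then have "Re_mat (hamilton_map q) *v v = 0" for v
    by (metis vector2_cases)
  then have "vector [1, 0] \<in> singular_space q"
    by (simp add: singular_space_def)
  then show False using S by (simp add: vec_eq_iff forall_2)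
qed

text \<open>The eigenspaces of the Hamilton map are the two lines \<open>\<xi> = p x\<close> and \<open>\<xi> = m x\<close> on which the
  form vanishes.\<close>

definition factored_form :: "complex \<Rightarrow> complex \<Rightarrow> complex \<Rightarrow> quadratic_form" where
  "factored_form k p m = QForm (k * p * m) (- k * (p + m)) k"

text \<open>Exchanging \<open>p\<close> and \<open>m\<close> leaves the form unchanged and reverses
  the sign of \<open>k * (p - m) / 2\<close>. Applied to both roots, the lemma therefore puts them
  on opposite sides of the real axis.\<close>

lemma symbol_factored_form_root_sign:
  assumes pe: "partially_elliptic q" and S: "singular_space q = {0}"
    and q: "q = factored_form k p m"
  shows "Im p \<noteq> 0" "Im (k * (p - m) / 2) * Im p > 0"
proof -
  have cp: "symbol q x \<xi> = k * (of_real \<xi> - p * of_real x) * (of_real \<xi> - m * of_real x)" for x \<xi>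
    by (simp add: q factored_form_def symbol_def power2_eq_square algebra_simps)
  show im: "Im p \<noteq> 0"
  proof
    assume "Im p = 0"
    then have "symbol q 1 (Re p) = 0" by (simp add: cp complex_eq_iff)
    then show False using symbol_eq_0_imp[OF pe S] by fastforce
  qed
  have nn: "0 \<le> Re (q20 q) * x\<^sup>2 + Re (q11 q) * x * y + Re (q02 q) * y\<^sup>2" for x y
    using pe by (simp add: partially_elliptic_def Re_symbol)
  \<comment> \<open>The chain ends in the Hermitian extension of \<open>Re q\<close>, evaluated at
    the eigenvector \<open>(1, p) = (1, Re p) + \<i> (0, Im p)\<close>.\<close>
  have "2 * (Im (k * (p - m) / 2) * Im p) = Im (k * (p - m)) * Im p"
    by simp
  also have "\<dots> = Re (symbol q 1 (Re p)) + Re (symbol q 0 (Im p))"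
    unfolding cp by (simp add: algebra_simps)
  finally have id: "2 * (Im (k * (p - m) / 2) * Im p)
      = Re (symbol q 1 (Re p)) + Re (symbol q 0 (Im p))" .
  moreover have n1: "Re (symbol q 1 (Re p)) \<ge> 0" and n2: "Re (symbol q 0 (Im p)) \<ge> 0"
    using pe by (auto simp: partially_elliptic_def)
  \<comment> \<open>Two independent zeros of a nonnegative form in the plane would make it vanish
    identically, and then the singular space would be everything.\<close>
  moreover have "\<not> (Re (symbol q 1 (Re p)) = 0 \<and> Re (symbol q 0 (Im p)) = 0)"
  proof
    assume *: "Re (symbol q 1 (Re p)) = 0 \<and> Re (symbol q 0 (Im p)) = 0"
    then have c: "Re (q02 q) = 0" using im by (simp add: Re_symbol)
    have "Re (q20 q) * 1\<^sup>2 + Re (q11 q) * 1 * Re p + Re (q02 q) * (Re p)\<^sup>2 = 0"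
      using * by (simp add: Re_symbol)
    from nonneg_form_kernel[OF nn this]
    have "Re (q11 q) / 2 * 1 + Re (q02 q) * Re p = 0" "Re (q20 q) * 1 + Re (q11 q) / 2 * Re p = 0"
      by simp_all
    with c real_part_nonzero[OF S] show False by auto
  qed
  ultimately show "Im (k * (p - m) / 2) * Im p > 0" by linarith
qed

lemma factored_form_exists:
  assumes pe: "partially_elliptic q" and S: "singular_space q = {0}"
  obtains k p m where "q = factored_form k p m" "k \<noteq> 0" "Im p > 0" "Im m < 0"
    "Im (k * (p - m) / 2) > 0"
proof -
  define k where "k = q02 q"
  have k: "k \<noteq> 0"
    using symbol_eq_0_imp[OF pe S, of 0 1] by (auto simp: symbol_def k_def)
  define d where "d = csqrt ((q11 q)\<^sup>2 - 4 * k * q20 q)"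
  have d2: "d\<^sup>2 = (q11 q)\<^sup>2 - 4 * k * q20 q" by (simp add: d_def)
  define p m where "p = (- q11 q + d) / (2 * k)" and "m = (- q11 q - d) / (2 * k)"
  have "4 * k * (k * p * m) = (q11 q)\<^sup>2 - d\<^sup>2"
    using k by (simp add: p_def m_def field_simps power2_eq_square)
  also have "\<dots> = 4 * k * q20 q" by (simp add: d2)
  finally have "k * p * m = q20 q" using k by simp
  moreover have "- k * (p + m) = q11 q"
    using k by (simp add: p_def m_def field_simps)
  ultimately have q: "q = factored_form k p m"
    by (cases q) (simp add: factored_form_def k_def)
  have q': "q = factored_form k m p"
    by (simp add: q factored_form_def mult_ac add.commute)
  note P = symbol_factored_form_root_sign[OF pe S q]
  note M = symbol_factored_form_root_sign[OF pe S q']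
  have "k * (m - p) / 2 = - (k * (p - m) / 2)"
    by (simp add: field_simps)
  then have neg: "Im (k * (m - p) / 2) = - Im (k * (p - m) / 2)"
    by (metis uminus_complex.sel(2))
  show ?thesis
  proof (cases "Im p > 0")
    case True
    then have "Im (k * (p - m) / 2) > 0" using P(2) by (simp add: zero_less_mult_iff)
    moreover from this have "Im m < 0" using M(2) neg by (smt (verit) zero_less_mult_iff)
    ultimately show ?thesis using that[OF q k True] by blast
  next
    case False
    then have "Im p < 0" using P(1) by simp
    then have "Im (k * (m - p) / 2) > 0" using P(2) neg by (smt (verit) zero_less_mult_iff)
    moreover from this have "Im m > 0" using M(2) by (simp add: zero_less_mult_iff)
    ultimately show ?thesis using that[OF q' k] \<open>Im p < 0\<close> by blast
  qed
qed

section \<open>Eigenvalues, eigenspaces and \<open>C_plus\<close> in terms of the roots\<close>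

lemma hamilton_map_factored_form:
  "hamilton_map (factored_form k p m)
    = vector [vector [- k * (p + m) / 2, k], vector [- k * p * m, k * (p + m) / 2]]"
  by (simp add: hamilton_map_eq factored_form_def)

lemma eigen_factored_form_iff:
  assumes "k \<noteq> 0" 
  shows "hamilton_map (factored_form k p m) *v vector [x, y] = (k * (p - m) / 2) *s vector [x, y]
    \<longleftrightarrow> y = p * x"
proof -
  have "hamilton_map (factored_form k p m) *v vector [x, y] = (k * (p - m) / 2) *s vector [x, y]
    \<longleftrightarrow> k * (y - p * x) = 0 \<and> k * m * (y - p * x) = 0"
    unfolding hamilton_map_factored_form matrix2_mult_vector2
    by (simp add: vec_eq_iff forall_2 field_simps)
  then show ?thesis using assms by auto
qed

lemma eigen_factored_form_iff':
  assumes "k \<noteq> 0" 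
  shows "hamilton_map (factored_form k p m) *v vector [x, y] = (- (k * (p - m) / 2)) *s vector [x, y]
    \<longleftrightarrow> y = m * x"
  using eigen_factored_form_iff[OF assms, of m p x y]
  by (simp add: factored_form_def mult_ac add.commute minus_divide_left right_diff_distrib)

text \<open>The Hamilton map has trace zero, so its eigenvalues are the two square roots of minus
  its determinant.\<close>

lemma eigenvalue_factored_form_iff:
  assumes k: "k \<noteq> 0" 
  shows "eigenvalue (hamilton_map (factored_form k p m)) l \<longleftrightarrow>
    l = k * (p - m) / 2 \<or> l = - (k * (p - m) / 2)"
proof
  assume "l = k * (p - m) / 2 \<or> l = - (k * (p - m) / 2)"
  moreover have "vector [1, p] \<noteq> (0 :: complex^2)" "vector [1, m] \<noteq> (0 :: complex^2)"
    by (auto simp: vec_eq_iff forall_2)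
  ultimately show "eigenvalue (hamilton_map (factored_form k p m)) l"
    using eigen_factored_form_iff[OF k, of p m 1 p] eigen_factored_form_iff'[OF k, of p m 1 m]
    unfolding eigenvalue_def by (metis mult.right_neutral)
next
  assume "eigenvalue (hamilton_map (factored_form k p m)) l"
  then obtain v where v: "v \<noteq> 0" "hamilton_map (factored_form k p m) *v v = l *s v"
    by (auto simp: eigenvalue_def)
  obtain x y where xy: "v = vector [x, y]" by (rule vector2_cases)
  define a b where "a = - k * (p + m) / 2" and "b = - k * p * m"
  have e: "a * x + k * y = l * x" "b * x - a * y = l * y"
    using v(2) unfolding xy hamilton_map_factored_form matrix2_mult_vector2
    by (simp_all add: vec_eq_iff forall_2 a_def b_def)
  have "(l\<^sup>2 - a\<^sup>2 - k * b) * x = 0 \<and> (l\<^sup>2 - a\<^sup>2 - k * b) * y = 0"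
    using e by algebra
  moreover have "x \<noteq> 0 \<or> y \<noteq> 0" using v(1) xy by (auto simp: vec_eq_iff forall_2)
  ultimately have "l\<^sup>2 - a\<^sup>2 - k * b = 0" by auto
  then have "l\<^sup>2 = a\<^sup>2 + k * b" by algebra
  also have "\<dots> = (k * (p - m) / 2)\<^sup>2"
    by (simp add: a_def b_def power2_eq_square field_simps)
  finally show "l = k * (p - m) / 2 \<or> l = - (k * (p - m) / 2)"
    by (simp add: power2_eq_iff)
qed

lemma graph_slope_eq:
  assumes "\<Lambda> = {vector [y, a * y] | y. True}"
  shows "graph_slope \<Lambda> = a"
  unfolding graph_slope_def
proof (rule the_equality)
  fix b assume "\<Lambda> = {vector [y, b * y] | y. True}"
  then have "vector [1, a * 1] \<in> {vector [y, b * y] :: complex^2 | y. True}" using assms by blast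
  then show "b = a" by (auto simp: vector2_eq_iff)
qed (rule assms)

lemma lambda_factored_form:
  assumes k: "k \<noteq> 0" and im: "Im (k * (p - m) / 2) > 0"
  shows "lambda_plus (factored_form k p m) = k * (p - m) / 2"
    "lambda_minus (factored_form k p m) = - (k * (p - m) / 2)"
  unfolding lambda_plus_def lambda_minus_def eigenvalue_factored_form_iff[OF k]
  by (rule the_equality; use im in \<open>force simp del: times_divide_eq_left times_divide_eq_right\<close>)+

lemma Lambda_factored_form:
  assumes k: "k \<noteq> 0" and im: "Im (k * (p - m) / 2) > 0"
  shows "Lambda_plus (factored_form k p m) = {vector [y, p * y] | y. True}"
    "Lambda_minus (factored_form k p m) = {vector [y, m * y] | y. True}"
proof -
  have "v \<in> Lambda_plus (factored_form k p m) \<longleftrightarrow> v \<in> {vector [y, p * y] | y. True}" for v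
    using eigen_factored_form_iff[OF k]
    by (cases v rule: vector2_cases) (simp add: Lambda_plus_def eigenspace_def lambda_factored_form[OF assms] vector2_eq_iff)
  then show "Lambda_plus (factored_form k p m) = {vector [y, p * y] | y. True}" by blast
  have "v \<in> Lambda_minus (factored_form k p m) \<longleftrightarrow> v \<in> {vector [y, m * y] | y. True}" for v
    using eigen_factored_form_iff'[OF k]
    by (cases v rule: vector2_cases) (simp add: Lambda_minus_def eigenspace_def lambda_factored_form[OF assms] vector2_eq_iff)
  then show "Lambda_minus (factored_form k p m) = {vector [y, m * y] | y. True}" by blast
qed

text \<open>\<open>kappa\<close> takes the line of slope \<open>a\<close> to the line of slope
  \<open>(a - Re m) / (- Im m)\<close>; in particular it normalises \<open>Lambda_minus\<close> to
  slope \<open>- \<i>\<close>. Hence \<open>1 - \<i> * A_plus\<close> and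
  \<open>1 + \<i> * A_plus\<close> are multiples of \<open>p - m\<close> and
  \<open>p - cnj m\<close>.\<close>

lemma C_plus_factored_form:
  assumes k: "k \<noteq> 0" and im: "Im (k * (p - m) / 2) > 0" and m: "Im m < 0" and p: "Im p > 0"
  shows "C_plus (factored_form k p m) = - ((p - cnj m) / (p - m))"
proof -
  let ?q = "factored_form k p m"
  have A: "A_minus ?q = m"
    unfolding A_minus_def by (rule graph_slope_eq) (rule Lambda_factored_form[OF k im])
  define s where "s = sqrt (- Im m)"
  have s: "s > 0" "s * s = - Im m" using m by (auto simp: s_def)
  have kap: "kappa ?q *v vector [y, p * y]
      = vector [of_real s * y, ((p - of_real (Re m)) / of_real (- Im m)) * (of_real s * y)]" for y
  proof -
    have "kappa ?q = vector [vector [of_real s, 0],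
             vector [of_real (- (inverse s * Re m)), of_real (inverse s)]]"
      unfolding kappa_def Let_def A s_def ..
    moreover have "of_real (- (inverse s * Re m)) * y + of_real (inverse s) * (p * y)
       = ((p - of_real (Re m)) / of_real (- Im m)) * (of_real s * y)"
      unfolding s(2)[symmetric] using s(1) by (simp add: field_simps)
    ultimately show ?thesis by (simp add: matrix2_mult_vector2)
  qed
  have "A_plus ?q = (p - of_real (Re m)) / of_real (- Im m)" (is "_ = ?a")
    unfolding A_plus_def
  proof (rule graph_slope_eq)
    show "(\<lambda>v. kappa ?q *v v) ` Lambda_plus ?q = {vector [y, ?a * y] | y. True}" (is "?L = ?R")
    proof
      show "?L \<subseteq> ?R" unfolding Lambda_factored_form(1)[OF k im] by (auto simp: kap)
      show "?R \<subseteq> ?L"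
      proof
        fix v assume "v \<in> ?R"
        then obtain y where y: "v = vector [y, ?a * y]" by blast
        have "v = kappa ?q *v vector [y / of_real s, p * (y / of_real s)]"
          unfolding kap using s by (simp add: y)
        then show "v \<in> ?L" unfolding Lambda_factored_form(1)[OF k im] by blast
      qed
    qed
  qed
  moreover have "1 - \<i> * ?a = - \<i> * (p - m) / of_real (- Im m)"
    "1 + \<i> * ?a = \<i> * (p - cnj m) / of_real (- Im m)"
    using m by (auto simp: field_simps complex_eq_iff)
  moreover have "p - m \<noteq> 0" using m p by auto
  ultimately have "C_plus ?q = inverse (- \<i> * (p - m) / of_real (- Im m))
      * (\<i> * (p - cnj m) / of_real (- Im m))"
    unfolding C_plus_def by metis
  also have "\<dots> = - ((p - cnj m) / (p - m))"
    using m \<open>p - m \<noteq> 0\<close> by (simp add: field_simps)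
  finally show ?thesis .
qed


section \<open>Polynomials times Gaussians\<close>

definition gp :: "complex \<Rightarrow> complex poly \<Rightarrow> real \<Rightarrow> complex" where
  "gp s P x = poly P (of_real x) * exp (- s * (of_real x)\<^sup>2)"

text \<open>This is \<open>- d/dx\<close> conjugated by the weight \<open>exp (- g x^2)\<close>,
  which makes it the transpose of \<open>pderiv\<close> for that weight.\<close>

definition raise :: "complex \<Rightarrow> complex poly \<Rightarrow> complex poly" where
  "raise g P = [:0, 2 * g:] * P - pderiv P"

text \<open>For \<open>g = 1\<close> these are the physicists' Hermite polynomials. For complex
  \<open>g\<close> the exponential generating function is
  \<open>exp (2 g x z - g z^2)\<close>.\<close>

fun herm :: "complex \<Rightarrow> nat \<Rightarrow> complex poly" where
  "herm g 0 = 1"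
| "herm g (Suc n) = raise g (herm g n)"

text \<open>As an operation on polynomials this is \<open>- raise s\<close>. Two names are kept
  because in the operator estimates \<open>raise\<close> carries the sum of two exponents, whereas
  \<open>gp_deriv\<close> is differentiation of a function with one of them.\<close>

definition gp_deriv :: "complex \<Rightarrow> complex poly \<Rightarrow> complex poly" where
  "gp_deriv s P = pderiv P - [:0, 2 * s:] * P"

section \<open>Decay, integrability and integration by parts\<close>

lemma gp_continuous [continuous_intros]: "continuous_on A (gp s P)"
  unfolding gp_def by (intro continuous_intros)

lemma gp_measurable [measurable]: "gp s P \<in> borel_measurable borel"
  by (intro borel_measurable_continuous_onI gp_continuous)

lemma gp_add: "gp s (P + Q) x = gp s P x + gp s Q x"
  by (simp add: gp_def algebra_simps)

lemma gp_diff: "gp s (P - Q) x = gp s P x - gp s Q x"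
  by (simp add: gp_def algebra_simps)

lemma gp_smult: "gp s (smult c P) x = c * gp s P x"
  by (simp add: gp_def algebra_simps)

lemma gp_0: "gp s 0 x = 0" by (simp add: gp_def)

lemma gp_mult: "gp s P x * gp t Q x = gp (s + t) (P * Q) x"
  by (simp add: gp_def algebra_simps exp_add[symmetric])

lemma gp_cnj: "cnj (gp s P x) = gp (cnj s) (map_poly cnj P) x"
  unfolding gp_def complex_cnj_mult poly_cnj exp_cnj by simp

lemma gp_has_derivative [derivative_intros]:
  "((gp s P) has_vector_derivative gp s (gp_deriv s P) x) (at x within A)"
proof -
  have "((\<lambda>z. poly P z * exp (- s * z\<^sup>2)) has_field_derivative 
      (poly (gp_deriv s P) z * exp (- s * z\<^sup>2))) (at z)" for z
    by (auto intro!: derivative_eq_intros simp: gp_deriv_def algebra_simps)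
  from has_vector_derivative_real_field[OF this] show ?thesis 
    unfolding gp_def[abs_def]
    by (rule has_vector_derivative_at_within)
qed

lemma poly_exp_bound:
  fixes P :: "complex poly"
  obtains C b where "C \<ge> 0" "\<And>x::real. cmod (poly P (of_real x)) \<le> C * exp (b * \<bar>x\<bar>)"
proof -
  have "\<exists>C b. C \<ge> 0 \<and> b \<ge> 0 \<and> (\<forall>x::real. cmod (poly P (of_real x)) \<le> C * exp (b * \<bar>x\<bar>))"
  proof (induction P)
    case 0
    show ?case by (intro exI[of _ 0]) auto
  next
    case (pCons a P)
    then obtain C b where C: "C \<ge> 0" "b \<ge> 0" 
      "\<And>x::real. cmod (poly P (of_real x)) \<le> C * exp (b * \<bar>x\<bar>)" by blast
    have "cmod (poly (pCons a P) (of_real x)) \<le> (cmod a + C) * exp ((b + 1) * \<bar>x\<bar>)" for x :: real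
    proof -
      have "cmod (poly (pCons a P) (of_real x)) \<le> cmod a + \<bar>x\<bar> * cmod (poly P (of_real x))"
        using norm_triangle_ineq[of a "of_real x * poly P (of_real x)"] by (simp add: norm_mult)
      also have "\<dots> \<le> cmod a * exp ((b + 1) * \<bar>x\<bar>) + exp \<bar>x\<bar> * (C * exp (b * \<bar>x\<bar>))"
      proof (intro add_mono mult_mono C)
        show "\<bar>x\<bar> \<le> exp \<bar>x\<bar>" using exp_ge_add_one_self[of "\<bar>x\<bar>"] by linarith
        show "cmod a \<le> cmod a * exp ((b + 1) * \<bar>x\<bar>)"
          using C by (simp add: mult_le_cancel_left1)
      qed auto
      also have "\<dots> = (cmod a + C) * exp ((b + 1) * \<bar>x\<bar>)"
        by (simp add: algebra_simps exp_add)
      finally show ?thesis .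
    qed
    then show ?case using C by (intro exI[of _ "cmod a + C"] exI[of _ "b + 1"]) auto
  qed
  then show ?thesis using that by blast
qed

text \<open>A Gaussian beats every exponential, so the rate \<open>r\<close> is free. The moment
  argument later needs a rate that depends on a frequency \<open>t\<close>, in order to absorb
  \<open>exp \<bar>t * x\<bar>\<close>.\<close>

lemma gp_exp_bound:
  assumes "Re s > 0"
  obtains K where "K \<ge> 0" "\<And>x. cmod (gp s P x) \<le> K * exp (- r * \<bar>x\<bar>)"
proof -
  obtain C b where C: "C \<ge> 0" "\<And>x::real. cmod (poly P (of_real x)) \<le> C * exp (b * \<bar>x\<bar>)"
    using poly_exp_bound[of P] by blast
  let ?a = "Re s"
  have "cmod (gp s P x) \<le> (C * exp ((b + r)\<^sup>2 / (4 * ?a))) * exp (- r * \<bar>x\<bar>)" for x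
  proof -
    \<comment> \<open>Completing the square: \<open>(b + r)^2 / (4 * ?a)\<close> is the maximum of
      \<open>(b + r) * y - ?a * y^2\<close>.\<close>
    have "0 \<le> (2 * ?a * \<bar>x\<bar> - (b + r))\<^sup>2 / (4 * ?a)" using assms by simp
    also have "\<dots> = ?a * x\<^sup>2 - (b + r) * \<bar>x\<bar> + (b + r)\<^sup>2 / (4 * ?a)"
    proof -
      have "(2 * ?a * \<bar>x\<bar> - (b + r))\<^sup>2 = (4 * ?a) * (?a * \<bar>x\<bar>\<^sup>2 - (b + r) * \<bar>x\<bar>) + (b + r)\<^sup>2"
        by (simp add: power2_eq_square algebra_simps)
      then show ?thesis using assms by (simp add: add_divide_distrib)
    qed
    finally have le: "b * \<bar>x\<bar> - ?a * x\<^sup>2 \<le> (b + r)\<^sup>2 / (4 * ?a) - r * \<bar>x\<bar>"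
      by (simp add: algebra_simps)
    have "Re ((of_real x)\<^sup>2 * s) = ?a * x\<^sup>2"
      by (simp flip: of_real_power)
    then have "cmod (gp s P x) = cmod (poly P (of_real x)) * exp (- ?a * x\<^sup>2)"
      by (simp add: gp_def norm_mult mult.commute)
    also have "\<dots> \<le> C * exp (b * \<bar>x\<bar>) * exp (- ?a * x\<^sup>2)"
      by (intro mult_right_mono C) auto
    also have "\<dots> = C * exp (b * \<bar>x\<bar> - ?a * x\<^sup>2)"
      by (simp add: exp_add[symmetric])
    also have "\<dots> \<le> C * exp ((b + r)\<^sup>2 / (4 * ?a) - r * \<bar>x\<bar>)"
      using le C(1) by (intro mult_left_mono) auto
    also have "\<dots> = (C * exp ((b + r)\<^sup>2 / (4 * ?a))) * exp (- r * \<bar>x\<bar>)"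
      by (simp add: exp_add[symmetric])
    finally show ?thesis .
  qed
  then show ?thesis using that C(1) by (meson mult_nonneg_nonneg exp_ge_zero)
qed

lemma integrable_exp_abs: "integrable lborel (\<lambda>x::real. exp (- \<bar>x\<bar>))"
proof -
  have "has_bochner_integral lborel (\<lambda>x::real. x ^ 0 * exp (- x) * indicator {0..} x) (fact 0)"
    using nn_intergal_power_times_exp_Ici[of 0]
    by (intro has_bochner_integral_nn_integral)
      (auto simp: ennreal_mult' ennreal_indicator)
  also have "(\<lambda>x::real. x ^ 0 * exp (- x) * indicator {0..} x)
      = (\<lambda>x. indicator {0..} x *\<^sub>R exp (- \<bar>x\<bar>))"
    by (auto simp: indicator_def)
  finally show ?thesis
    by (rule integrable.intros[OF has_bochner_integral_even_function]) auto
qed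

lemma gp_tendsto_0:
  assumes "Re s > 0"
  shows "(gp s P \<longlongrightarrow> 0) at_top" "(gp s P \<longlongrightarrow> 0) at_bot"
proof -
  obtain K where K: "K \<ge> 0" "\<And>x. cmod (gp s P x) \<le> K * exp (- 1 * \<bar>x\<bar>)"
    using gp_exp_bound[OF assms] by blast
  have "((\<lambda>x::real. K * exp (- 1 * \<bar>x\<bar>)) \<longlongrightarrow> 0) at_top" "((\<lambda>x::real. K * exp (- 1 * \<bar>x\<bar>)) \<longlongrightarrow> 0) at_bot"
    by real_asymp+
  note lim = this
  show "(gp s P \<longlongrightarrow> 0) at_top" "(gp s P \<longlongrightarrow> 0) at_bot"
    by (rule Lim_null_comparison[OF always_eventually lim(1)], use K(2) in blast)
      (rule Lim_null_comparison[OF always_eventually lim(2)], use K(2) in blast)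
qed

lemma integrable_gp:
  assumes "Re s > 0"
  shows "integrable lborel (gp s P)"
proof -
  obtain K where K: "K \<ge> 0" "\<And>x. cmod (gp s P x) \<le> K * exp (- 1 * \<bar>x\<bar>)"
    using gp_exp_bound[OF assms] by blast
  show ?thesis
    by (rule Bochner_Integration.integrable_bound[of _ "\<lambda>x. K * exp (- \<bar>x\<bar>)"])
      (use K integrable_exp_abs in auto)
qed

text \<open>Integration by parts on the whole line, with \<open>F\<close> as boundary term. The two
  limits at infinity cover Gaussians as well as functions of compact support.\<close>

lemma integral_derivative_eq_0:
  fixes F f :: "real \<Rightarrow> 'a::euclidean_space"
  assumes "\<And>x. (F has_vector_derivative f x) (at x)" "continuous_on UNIV f"
    "integrable lborel f" "(F \<longlongrightarrow> 0) at_top" "(F \<longlongrightarrow> 0) at_bot"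
  shows "(\<integral>x. f x \<partial>lborel) = 0"
proof -
  have "(LBINT x=-\<infinity>..\<infinity>. f x) = 0 - 0"
  proof (rule interval_integral_FTC_integrable)
    show "set_integrable lborel (einterval (- \<infinity>) \<infinity>) f"
      using assms(3) by (simp add: set_integrable_def)
    show "((F \<circ> real_of_ereal) \<longlongrightarrow> 0) (at_right (- \<infinity>))" "((F \<circ> real_of_ereal) \<longlongrightarrow> 0) (at_left \<infinity>)"
      using assms(4,5) by (simp_all add: ereal_tendsto_simps)
  qed (use assms in \<open>auto simp: continuous_on_eq_continuous_at\<close>)
  then show ?thesis
    by (simp add: interval_lebesgue_integral_def set_lebesgue_integral_def)
qed

section \<open>Hermite polynomials for a complex Gaussian weight\<close>

definition gp_integral :: "complex \<Rightarrow> complex poly \<Rightarrow> complex" where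
  "gp_integral s P = (\<integral>x. gp s P x \<partial>lborel)"

lemma gp_integral_add: "Re s > 0 \<Longrightarrow> gp_integral s (P + Q) = gp_integral s P + gp_integral s Q"
  by (simp add: gp_integral_def gp_add integrable_gp)

lemma gp_integral_diff: "Re s > 0 \<Longrightarrow> gp_integral s (P - Q) = gp_integral s P - gp_integral s Q"
  by (simp add: gp_integral_def gp_diff integrable_gp)

lemma gp_integral_smult: "gp_integral s (smult c P) = c * gp_integral s P"
  by (simp add: gp_integral_def gp_smult)

lemma gp_integral_gp_deriv: 
  assumes "Re s > 0" 
  shows "gp_integral s (gp_deriv s P) = 0"
  unfolding gp_integral_def
  by (rule integral_derivative_eq_0[where F = "gp s P"])
    (use assms in \<open>auto intro: gp_has_derivative gp_continuous integrable_gp gp_tendsto_0\<close>)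

text \<open>The difference \<open>P * pderiv Q - raise s P * Q\<close>, multiplied by the weight, is
  the derivative of \<open>P * Q\<close> times the weight.\<close>

lemma gp_integral_raise_mult:
  assumes "Re s > 0"
  shows "gp_integral s (raise s P * Q) = gp_integral s (P * pderiv Q)"
proof -
  have "gp_deriv s (P * Q) = P * pderiv Q - raise s P * Q"
    by (simp add: gp_deriv_def raise_def pderiv_mult algebra_simps)
  then show ?thesis
    using gp_integral_gp_deriv[OF assms, of "P * Q"] assms by (simp add: gp_integral_diff)
qed

text \<open>The canonical commutation relation \<open>[pderiv, raise g] = 2 * g\<close>, on which
  the whole ladder rests.\<close>

lemma pderiv_raise: "pderiv (raise g P) = smult (2 * g) P + raise g (pderiv P)"
  by (simp add: raise_def pderiv_mult pderiv_diff pderiv_pCons pderiv_smult algebra_simps)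

lemma raise_smult: "raise g (smult c P) = smult c (raise g P)"
  by (simp add: raise_def pderiv_smult algebra_simps smult_diff_right)

lemma raise_add: "raise g (P + Q) = raise g P + raise g Q"
  by (simp add: raise_def pderiv_add algebra_simps smult_add_right)

lemma pderiv_herm: "pderiv (herm g (Suc n)) = smult (2 * g * of_nat (Suc n)) (herm g n)"
proof (induction n)
  case 0
  then show ?case by (simp add: raise_def pderiv_pCons pderiv_mult)
next
  case (Suc n)
  have "pderiv (herm g (Suc (Suc n))) = smult (2 * g) (herm g (Suc n)) + raise g (pderiv (herm g (Suc n)))"
    by (simp only: herm.simps(2)[of g "Suc n"] pderiv_raise)
  also have "\<dots> = smult (2 * g) (herm g (Suc n)) + smult (2 * g * of_nat (Suc n)) (herm g (Suc n))"
    by (simp only: Suc raise_smult herm.simps(2)[of g n, symmetric])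
  also have "\<dots> = smult (2 * g + 2 * g * of_nat (Suc n)) (herm g (Suc n))"
    by (simp only: smult_add_left)
  also have "2 * g + 2 * g * of_nat (Suc n) = 2 * g * of_nat (Suc (Suc n))"
    by (simp add: algebra_simps)
  finally show ?case .
qed

lemma herm_rec: "herm g (Suc (Suc n)) = [:0, 2 * g:] * herm g (Suc n) - smult (2 * g * of_nat (Suc n)) (herm g n)"
  using pderiv_herm[of g n] by (simp only: herm.simps(2)[of g "Suc n"] raise_def)

text \<open>Since nothing is conjugated, orthogonality persists for complex \<open>g\<close>. Each
  \<open>raise\<close> crosses over as a \<open>pderiv\<close>, which lowers the other index and
  contributes a factor \<open>2 * g * k\<close>.\<close>

lemma gp_integral_herm_herm:
  assumes "Re g > 0"
  shows "gp_integral g (herm g j * herm g k) = (if j = k then (2 * g) ^ j * fact j * gp_integral g 1 else 0)"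
proof (induction j arbitrary: k)
  case 0
  show ?case
  proof (cases k)
    case (Suc k')
    then show ?thesis 
      using gp_integral_raise_mult[OF assms, of "herm g k'" 1] by (simp add: gp_integral_def gp_0)
  qed simp
next
  case (Suc j)
  have *: "gp_integral g (herm g (Suc j) * herm g k) = gp_integral g (herm g j * pderiv (herm g k))"
    by (simp add: gp_integral_raise_mult[OF assms])
  show ?case
  proof (cases k)
    case 0
    then show ?thesis using * by (simp add: gp_integral_def gp_0)
  next
    case (Suc k')
    have "gp_integral g (herm g (Suc j) * herm g k) = (2 * g * of_nat (Suc k')) * gp_integral g (herm g j * herm g k')"
      using * by (simp add: Suc pderiv_herm gp_integral_smult del: herm.simps)
    then show ?thesis using Suc.IH[of k'] Suc by (simp del: herm.simps)
  qed
qed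

section \<open>The modulus of the Gaussian integral\<close>

lemma gp_integral_1_real:
  assumes "a > 0"
  shows "gp_integral (of_real a) 1 = of_real (sqrt (pi / a))"
proof -
  have "has_bochner_integral lborel (\<lambda>x::real. exp (- x\<^sup>2)) (sqrt pi)"
    using has_bochner_integral_even_function[OF gaussian_moment_0] by simp
  from lborel_has_bochner_integral_real_affine_iff[of "sqrt a" "\<lambda>x. exp (- x\<^sup>2)" "sqrt pi" 0, THEN iffD1, OF _ this]
  have "has_bochner_integral lborel (\<lambda>x::real. exp (- a * x\<^sup>2)) (sqrt pi / sqrt a)"
    using assms by (simp add: power_mult_distrib divide_inverse_commute)
  then have "has_bochner_integral lborel (\<lambda>x::real. complex_of_real (exp (- a * x\<^sup>2))) (of_real (sqrt pi / sqrt a))"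
    by (rule has_bochner_integral_of_real)
  moreover have "(\<lambda>x::real. complex_of_real (exp (- a * x\<^sup>2))) = gp (of_real a) 1"
    by (auto simp: gp_def exp_of_real[symmetric])
  ultimately show ?thesis
    by (simp add: gp_integral_def has_bochner_integral_integral_eq real_sqrt_divide)
qed

lemma has_vector_derivative_complexI:
  fixes f :: "real \<Rightarrow> complex"
  assumes "((\<lambda>h. (f (t + h) - f t) / of_real h) \<longlongrightarrow> D) (at 0)"
  shows "(f has_vector_derivative D) (at t)"
proof -
  have "((\<lambda>h. norm ((f (t + h) - f t) / of_real h - D)) \<longlongrightarrow> 0) (at 0)"
    using assms by (simp add: tendsto_norm_zero_iff LIM_zero_iff)
  moreover have "\<forall>\<^sub>F h in at 0. norm ((f (t + h) - f t) / of_real h - D)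
      = norm (f (t + h) - f t - h *\<^sub>R D) / norm h"
  proof (rule eventually_at_filter[THEN iffD2, OF always_eventually], safe)
    fix h :: real assume "h \<noteq> 0"
    then have "(f (t + h) - f t) / of_real h - D = (f (t + h) - f t - h *\<^sub>R D) / of_real h"
      by (simp add: field_simps scaleR_conv_of_real)
    then show "norm ((f (t + h) - f t) / of_real h - D) = norm (f (t + h) - f t - h *\<^sub>R D) / norm h"
      by (simp add: norm_divide)
  qed
  ultimately show ?thesis
    unfolding has_vector_derivative_def has_derivative_at
    by (auto simp: bounded_linear_scaleR_left elim: Lim_transform_eventually)
qed

text \<open>Only the imaginary part of the exponent moves, so the modulus of the Gaussian is fixed,
  and \<open>cmod (exp (\<i> y) - 1) \<le> \<bar>y\<bar>\<close> dominates the difference quotients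
  by \<open>x^2\<close> times that modulus.\<close>

lemma gp_integral_1_has_derivative:
  assumes a: "a > 0"
  shows "((\<lambda>t::real. gp_integral (Complex a t) 1) has_vector_derivative 
     - \<i> * gp_integral (Complex a t) [:0, 0, 1:]) (at t)"
proof -
  let ?c = "Complex a t"
  define D where "D h x = (gp (Complex a (t + h)) 1 x - gp ?c 1 x) / of_real h" for h x
  have Dint: "integrable lborel (D h)" for h
    unfolding D_def using a by (intro Bochner_Integration.integrable_diff integrable_gp integrable_divide) auto
  have D_eq: "D h x = gp ?c 1 x * ((iexp (- h * x\<^sup>2) - 1) / of_real h)" for h x
  proof -
    have "Complex a (t + h) = ?c + \<i> * of_real h" by (simp add: complex_eq_iff)
    then have "- Complex a (t + h) * (of_real x)\<^sup>2 = - ?c * (of_real x)\<^sup>2 + \<i> * of_real (- h * x\<^sup>2)"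
      by (simp only: of_real_mult of_real_minus of_real_power) (simp add: algebra_simps)
    then have "exp (- Complex a (t + h) * (of_real x)\<^sup>2) = exp (- ?c * (of_real x)\<^sup>2) * iexp (- h * x\<^sup>2)"
      by (simp only: exp_add)
    then show ?thesis by (simp add: D_def gp_def field_simps)
  qed
  have "((\<lambda>h. (\<integral>x. D h x \<partial>lborel)) \<longlongrightarrow> (\<integral>x. gp ?c [:0, 0, - \<i>:] x \<partial>lborel)) (at 0)"
    unfolding tendsto_at_iff_sequentially comp_def
  proof safe
    fix X :: "nat \<Rightarrow> real" assume X: "\<forall>i. X i \<in> UNIV - {0}" "X \<longlonglongrightarrow> 0"
    show "(\<lambda>i. (\<integral>x. D (X i) x \<partial>lborel)) \<longlonglongrightarrow> (\<integral>x. gp ?c [:0, 0, - \<i>:] x \<partial>lborel)"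
    proof (rule integral_dominated_convergence[where w = "\<lambda>x. cmod (gp ?c [:0, 0, 1:] x)"])
      show "integrable lborel (\<lambda>x. cmod (gp ?c [:0, 0, 1:] x))"
        using a by (intro integrable_norm integrable_gp) auto
      show "AE x in lborel. (\<lambda>i. D (X i) x) \<longlonglongrightarrow> gp ?c [:0, 0, - \<i>:] x"
      proof (rule AE_I2)
        fix x :: real
        have "((\<lambda>z. exp (\<i> * (- z * of_real (x\<^sup>2)))) has_field_derivative (- \<i> * of_real (x\<^sup>2))) (at 0)"
          by (auto intro!: derivative_eq_intros)
        then have "((\<lambda>z. (exp (\<i> * (- z * of_real (x\<^sup>2))) - 1) / z) \<longlongrightarrow> - \<i> * of_real (x\<^sup>2)) (at 0)"
          by (simp add: DERIV_def)
        moreover have "filterlim (\<lambda>i. complex_of_real (X i)) (at 0) sequentially"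
          using X tendsto_of_real_iff[of X 0 sequentially, where 'a = complex]
          by (simp add: filterlim_at)
        ultimately have "(\<lambda>i. (exp (\<i> * (- complex_of_real (X i) * of_real (x\<^sup>2))) - 1) / complex_of_real (X i))
            \<longlonglongrightarrow> - \<i> * of_real (x\<^sup>2)"
          by (rule filterlim_compose)
        then have "(\<lambda>i. (iexp (- X i * x\<^sup>2) - 1) / complex_of_real (X i)) \<longlonglongrightarrow> - \<i> * of_real (x\<^sup>2)"
          by simp
        then have "(\<lambda>i. D (X i) x) \<longlonglongrightarrow> gp ?c 1 x * (- \<i> * of_real (x\<^sup>2))"
          unfolding D_eq by (rule tendsto_mult_left)
        also have "gp ?c 1 x * (- \<i> * of_real (x\<^sup>2)) = gp ?c [:0, 0, - \<i>:] x"
          by (simp add: gp_def power2_eq_square)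
        finally show "(\<lambda>i. D (X i) x) \<longlonglongrightarrow> gp ?c [:0, 0, - \<i>:] x" .
      qed
      show "AE x in lborel. norm (D (X i) x) \<le> cmod (gp ?c [:0, 0, 1:] x)" for i
      proof (rule AE_I2)
        fix x :: real
        have "cmod (iexp (- X i * x\<^sup>2) - 1) \<le> \<bar>X i\<bar> * x\<^sup>2"
          using iexp_approx1[of "- X i * x\<^sup>2" 0] by (simp add: abs_mult)
        then have "cmod (gp ?c 1 x) * (cmod (iexp (- X i * x\<^sup>2) - 1) / \<bar>X i\<bar>) \<le> cmod (gp ?c 1 x) * x\<^sup>2"
          using X by (intro mult_left_mono) (auto simp: field_simps)
        then show "norm (D (X i) x) \<le> cmod (gp ?c [:0, 0, 1:] x)"
          unfolding D_eq norm_mult norm_divide by (simp add: gp_def norm_mult power2_eq_square mult_ac)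
      qed
    qed (use Dint in auto)
  qed
  moreover have "(\<integral>x. D h x \<partial>lborel) = (gp_integral (Complex a (t + h)) 1 - gp_integral ?c 1) / of_real h" for h
    unfolding D_def gp_integral_def using a by (simp add: integrable_gp)
  moreover have "(\<integral>x. gp ?c [:0, 0, - \<i>:] x \<partial>lborel) = - \<i> * gp_integral ?c [:0, 0, 1:]"
    using gp_integral_smult[of ?c "- \<i>" "[:0, 0, 1:]"] by (simp add: gp_integral_def)
  ultimately show ?thesis
    by (intro has_vector_derivative_complexI) simp
qed

text \<open>Along a vertical line \<open>Re s = a\<close> the integral satisfies a linear
  differential equation, by which its squared modulus \<open>n\<close> makes
  \<open>n^2 * (a^2 + t^2)\<close> constant; comparison with \<open>t = 0\<close> gives the value.
  Working with the modulus avoids choosing a branch of the complex square root.\<close>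

lemma cmod_gp_integral_1:
  assumes "Re s > 0"
  shows "cmod (gp_integral s 1) = sqrt (pi / cmod s)"
proof -
  define a where "a = Re s"
  have a: "a > 0" using assms by (simp add: a_def)
  define G where "G t = gp_integral (Complex a t) 1" for t
  have dG: "(G has_vector_derivative (- \<i> / (2 * Complex a t)) * G t) (at t)" for t
  proof -
    have "Complex a t \<noteq> 0" using a by (simp add: complex_eq_iff)
    \<comment> \<open>The derivative of \<open>x exp (- c x^2)\<close> integrates to zero and so
      expresses the second moment by the zeroth.\<close>
    moreover have "gp_deriv (Complex a t) [:0, 1:] = 1 - smult (2 * Complex a t) [:0, 0, 1:]"
      by (simp add: gp_deriv_def pderiv_pCons one_pCons)
    then have "gp_integral (Complex a t) 1 = 2 * Complex a t * gp_integral (Complex a t) [:0, 0, 1:]"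
      using gp_integral_gp_deriv[of "Complex a t" "[:0, 1:]"] a
      by (simp add: gp_integral_diff gp_integral_smult del: smult_pCons)
    ultimately have "gp_integral (Complex a t) [:0, 0, 1:] = G t / (2 * Complex a t)"
      by (simp add: G_def field_simps)
    then show ?thesis
      using gp_integral_1_has_derivative[OF a, of t] by (simp add: G_def[abs_def])
  qed
  define n where "n t = (cmod (G t))\<^sup>2" for t
  have dn: "(n has_real_derivative - (t / (a\<^sup>2 + t\<^sup>2)) * n t) (at t)" for t
  proof -
    have "((\<lambda>t. G t \<bullet> G t) has_vector_derivative
        (G t \<bullet> ((- \<i> / (2 * Complex a t)) * G t) + ((- \<i> / (2 * Complex a t)) * G t) \<bullet> G t)) (at t)"
      by (rule bounded_bilinear.has_vector_derivative[OF bounded_bilinear_inner dG dG])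
    moreover have "(w * z) \<bullet> z = Re w * (cmod z)\<^sup>2" for w z :: complex
      by (simp add: inner_complex_def cmod_power2) (simp add: power2_eq_square algebra_simps)
    moreover have "Re (- \<i> / (2 * Complex a t)) = - (t / (a\<^sup>2 + t\<^sup>2)) / 2"
    proof -
      have *: "\<i> / Complex a t = \<i> * cnj (Complex a t) / of_real (a\<^sup>2 + t\<^sup>2)"
        by (subst complex_div_cnj) (simp add: cmod_power2)
      have "- \<i> / (2 * Complex a t) = - (\<i> / Complex a t) / 2" by simp
      then show ?thesis unfolding * by (simp del: of_real_add of_real_power)
    qed
    ultimately have "((\<lambda>t. G t \<bullet> G t) has_vector_derivative
        (- (t / (a\<^sup>2 + t\<^sup>2)) / 2 * n t + - (t / (a\<^sup>2 + t\<^sup>2)) / 2 * n t)) (at t)"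
      unfolding inner_commute[of "G t" "_ * G t"] n_def by metis
    moreover have "x / 2 * y + x / 2 * y = x * y" for x y :: real by simp
    ultimately have "((\<lambda>t. G t \<bullet> G t) has_vector_derivative (- (t / (a\<^sup>2 + t\<^sup>2)) * n t)) (at t)"
      by metis
    then show ?thesis
      by (simp add: has_real_derivative_iff_has_vector_derivative n_def[abs_def] power2_norm_eq_inner)
  qed
  have "((\<lambda>t. (n t)\<^sup>2 * (a\<^sup>2 + t\<^sup>2)) has_real_derivative 0) (at t)" for t
  proof -
    have "a\<^sup>2 + t\<^sup>2 > 0" using a by (simp add: add_pos_nonneg)
    then show ?thesis
      by (auto intro!: derivative_eq_intros dn simp: power2_eq_square divide_simps)
  qed
  then have "(n (Im s))\<^sup>2 * (a\<^sup>2 + (Im s)\<^sup>2) = (n 0)\<^sup>2 * (a\<^sup>2 + 0\<^sup>2)"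
    by (rule DERIV_isconst_all[rule_format])
  also have "n 0 = pi / a"
  proof -
    have "Complex a 0 = of_real a" by (simp add: complex_of_real_def)
    then show ?thesis using a gp_integral_1_real[OF a] by (simp add: n_def G_def)
  qed
  also have "a\<^sup>2 + (Im s)\<^sup>2 = (cmod s)\<^sup>2" by (simp add: a_def cmod_power2)
  finally have "(n (Im s) * cmod s)\<^sup>2 = pi\<^sup>2"
    using a by (simp add: power_mult_distrib power_divide)
  then have "n (Im s) * cmod s = pi"
    by (simp add: n_def)
  then have "(cmod (G (Im s)))\<^sup>2 = pi / cmod s"
    using assms by (subst nonzero_eq_divide_eq) (auto simp: n_def)
  moreover have "Complex a (Im s) = s" by (simp add: a_def)
  ultimately show ?thesis
    by (metis G_def norm_ge_zero real_sqrt_unique)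
qed

lemma cmod_gp_power2: "of_real ((cmod (gp s P x))\<^sup>2) = gp (of_real (2 * Re s)) (P * map_poly cnj P) x"
proof -
  have "of_real ((cmod (gp s P x))\<^sup>2) = gp s P x * cnj (gp s P x)"
    by (rule complex_norm_square)
  also have "\<dots> = gp (s + cnj s) (P * map_poly cnj P) x"
    by (simp add: gp_cnj gp_mult)
  also have "s + cnj s = of_real (2 * Re s)"
    by (simp add: complex_eq_iff)
  finally show ?thesis .
qed

lemma sq_integrable_gp:
  assumes "Re s > 0"
  shows "sq_integrable (gp s P)"
proof -
  have "integrable lborel (\<lambda>x. complex_of_real ((cmod (gp s P x))\<^sup>2))"
    unfolding cmod_gp_power2 using assms by (intro integrable_gp) simp
  then have "integrable lborel (\<lambda>x. (cmod (gp s P x))\<^sup>2)"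
    using integrable_Re by fastforce
  then show ?thesis by (simp add: sq_integrable_def)
qed


section \<open>Norms of Hermite functions\<close>

text \<open>Needed so that conjugating an expansion in these polynomials conjugates its coefficients
  only.\<close>

lemma poly_herm_real: "poly (herm (of_real s) n) (of_real x) \<in> \<real>"
proof (induction n rule: induct_nat_012)
  case 1
  show ?case by (simp add: raise_def)
next
  case (ge2 n)
  then show ?case
    unfolding herm_rec by (simp del: herm.simps add: Reals_mult Reals_diff Reals_add)
qed simp

lemma gp_integral_sum: "Re s > 0 \<Longrightarrow> gp_integral s (\<Sum>l\<in>A. P l) = (\<Sum>l\<in>A. gp_integral s (P l))"
  by (induction A rule: infinite_finite_induct) (simp_all add: gp_integral_add gp_integral_def[of _ 0] gp_0)



text \<open>The squared modulus of \<open>gp s P\<close> carries the real weight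
  \<open>exp (- r x^2)\<close>, for which the Hermite polynomials are real and orthogonal; the
  formula is Parseval's identity.\<close>

lemma integral_gp_sum_herm:
  assumes s: "Re s > 0" and r: "r = 2 * Re s"
    and P: "P = (\<Sum>l\<le>N. smult (c l) (herm (of_real r) l))"
  shows "(\<integral>x. (cmod (gp s P x))\<^sup>2 \<partial>lborel)
    = sqrt (pi / r) * (\<Sum>l\<le>N. (cmod (c l))\<^sup>2 * ((2 * r) ^ l * fact l))"
proof -
  let ?H = "herm (of_real r)"
  have r0: "r > 0" using s r by simp
  have eq: "complex_of_real ((cmod (gp s P x))\<^sup>2)
      = gp (of_real r) (\<Sum>l\<le>N. \<Sum>l'\<le>N. smult (c l * cnj (c l')) (?H l * ?H l')) x" for x
  proof -
    have "cnj (gp s P x) = cnj (poly P (of_real x)) * exp (- cnj s * (of_real x)\<^sup>2)"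
      unfolding gp_def complex_cnj_mult exp_cnj by simp
    moreover have "cnj (poly P (of_real x)) = (\<Sum>l\<le>N. cnj (c l) * poly (?H l) (of_real x))"
      using poly_herm_real[of r _ x] by (simp add: P poly_sum Reals_cnj_iff)
    moreover have "complex_of_real ((cmod (gp s P x))\<^sup>2) = gp s P x * cnj (gp s P x)"
      by (rule complex_norm_square)
    moreover have "of_real r = s + cnj s" by (simp add: r complex_eq_iff)
    moreover have "poly (\<Sum>l\<le>N. \<Sum>l'\<le>N. smult (c l * cnj (c l')) (?H l * ?H l')) (of_real x)
        = poly P (of_real x) * (\<Sum>l\<le>N. cnj (c l) * poly (?H l) (of_real x))"
      by (simp add: P poly_sum sum_product mult_ac)
    moreover have "exp (- (s + cnj s) * (of_real x)\<^sup>2)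
        = exp (- s * (of_real x)\<^sup>2) * exp (- cnj s * (of_real x)\<^sup>2)"
      by (simp add: exp_add[symmetric] algebra_simps)
    ultimately show ?thesis
      by (simp only: gp_def mult_ac)
  qed
  have "complex_of_real (\<integral>x. (cmod (gp s P x))\<^sup>2 \<partial>lborel)
    = gp_integral (of_real r) (\<Sum>l\<le>N. \<Sum>l'\<le>N. smult (c l * cnj (c l')) (?H l * ?H l'))"
    unfolding gp_integral_def eq[symmetric] by (rule integral_complex_of_real[symmetric])
  also have "\<dots> = (\<Sum>l\<le>N. \<Sum>l'\<le>N. c l * cnj (c l') * gp_integral (of_real r) (?H l * ?H l'))"
    using r0 by (simp add: gp_integral_sum gp_integral_smult)
  also have "\<dots> = (\<Sum>l\<le>N. \<Sum>l'\<le>N. if l = l' then 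
      c l * cnj (c l) * ((2 * of_real r) ^ l * fact l * gp_integral (of_real r) 1) else 0)"
    using r0 by (intro sum.cong refl) (simp add: gp_integral_herm_herm)
  also have "\<dots> = (\<Sum>l\<le>N. c l * cnj (c l) * ((2 * of_real r) ^ l * fact l * gp_integral (of_real r) 1))"
    by (intro sum.cong refl) simp
  also have "\<dots> = (\<Sum>l\<le>N. of_real ((cmod (c l))\<^sup>2) * ((2 * of_real r) ^ l * fact l * gp_integral (of_real r) 1))"
    by (simp only: complex_norm_square)
  also have "\<dots> = of_real (sqrt (pi / r) * (\<Sum>l\<le>N. (cmod (c l))\<^sup>2 * ((2 * r) ^ l * fact l)))"
    using r0 by (simp add: gp_integral_1_real sum_distrib_left mult_ac)
  finally show ?thesis by (simp only: of_real_eq_iff)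
qed

text \<open>The values divided by \<open>fact l\<close> are the Taylor coefficients of
  \<open>f z = exp (a z^2)\<close>; the recurrence encodes \<open>f' = 2 a z f\<close>.\<close>

fun even_moment :: "complex \<Rightarrow> nat \<Rightarrow> complex" where
  "even_moment a 0 = 1"
| "even_moment a (Suc 0) = 0"
| "even_moment a (Suc (Suc l)) = 2 * a * of_nat (Suc l) * even_moment a l"

lemma even_moment_eq:
  "even_moment a l = (if even l then fact l / fact (l div 2) * a ^ (l div 2) else 0)"
proof (induction a l rule: even_moment.induct)
  case (3 a l)
  show ?case
  proof (cases "even l")
    case True
    then obtain j where j: "l = 2 * j" by (elim evenE)
    have "fact (2 * Suc j) = (2 * of_nat (Suc j) * (of_nat (Suc (2 * j)) * fact (2 * j)) :: complex)"
      by simp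
    moreover have "fact (Suc j) = (of_nat (Suc j) * fact j :: complex)"
      by simp
    ultimately have "fact (2 * Suc j) / fact (Suc j) 
        = (2 * of_nat (Suc (2 * j)) * (fact (2 * j) / fact j) :: complex)"
      by (simp del: of_nat_Suc fact_Suc mult_Suc_right)
    moreover have "Suc (Suc l) = 2 * Suc j" by (simp add: j)
    ultimately show ?thesis using 3 unfolding even_moment.simps(3) by (simp add: j mult_ac del: fact_Suc of_nat_Suc mult_Suc_right)
  qed (use 3 in simp)
qed auto

text \<open>With \<open>b = g / r\<close>, the generating function
  \<open>exp (2 g x z - g z^2)\<close> is the product of
  \<open>exp (2 r x (b z) - r (b z)^2)\<close> and \<open>exp (- (1 - b) g z^2)\<close>. The
  right-hand side is the resulting Cauchy product; the induction on \<open>N\<close> carries out the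
  same computation with \<open>raise\<close>.\<close>

lemma herm_expansion:
  fixes g r :: complex
  assumes r: "r \<noteq> 0"
  shows "herm g N = (\<Sum>l\<le>N. smult (of_nat (N choose l) * even_moment (- (1 - g / r) * g) l * (g / r) ^ (N - l))
      (herm r (N - l)))"
proof -
  define b where "b = g / r"
  define a where "a = - (1 - b) * g"
  define w where "w = even_moment a"
  define K where "K n = smult (b ^ n) (herm r n)" for n
  \<comment> \<open>\<open>raise g\<close> is a combination of \<open>raise r\<close> and
    \<open>pderiv\<close>, so it moves the rescaled polynomials \<open>K n\<close> one step up and
    one step down. At \<open>n = 0\<close> the truncated index \<open>n - 1\<close> is harmless
    because its coefficient is zero.\<close>
  have raise: "raise g (K n) = K (Suc n) + smult (2 * a * of_nat n) (K (n - 1))" for n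
  proof -
    have "raise g P = smult b (raise r P) - smult (1 - b) (pderiv P)" for P
      using r by (simp add: raise_def b_def algebra_simps smult_diff_left smult_diff_right)
    moreover have "pderiv (K n) = smult (2 * g * of_nat n) (K (n - 1))"
    proof (cases n)
      case (Suc k)
      then show ?thesis
        using r by (simp add: K_def pderiv_smult pderiv_herm b_def del: herm.simps) (simp add: field_simps)
    qed (simp add: K_def)
    ultimately have "raise g (K n) = smult b (raise r (K n)) - smult ((1 - b) * (2 * g * of_nat n)) (K (n - 1))"
      by (simp only: smult_smult)
    also have "smult b (raise r (K n)) = K (Suc n)"
      by (simp add: K_def raise_smult)
    also have "(1 - b) * (2 * g * of_nat n) = - (2 * a * of_nat n)"
      by (simp add: a_def algebra_simps)
    finally show ?thesis by simp
  qed
  have w2: "w (Suc (Suc l)) = 2 * a * of_nat (Suc l) * w l" and w1: "w (Suc 0) = 0" "w 0 = 1" for l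
    by (simp_all add: w_def)
  have "herm g N = (\<Sum>l\<le>N. smult (of_nat (N choose l) * w l) (K (N - l)))"
  proof (induction N)
    case (Suc N)
    have raise_sum: "raise g (\<Sum>l\<in>A. P l) = (\<Sum>l\<in>A. raise g (P l))" for A :: "nat set" and P
      by (induction A rule: infinite_finite_induct) (simp_all add: raise_add raise_def[of _ 0])
    \<comment> \<open>The downward terms are shifted by one index: absorption exchanges
      \<open>(N choose l) * (N - l)\<close> for \<open>(N choose Suc l) * Suc l\<close>, and the
      recurrence supplies the next value of \<open>w\<close>. Pascal's rule later merges them with
      the upward terms.\<close>
    have S2: "(\<Sum>l\<le>N. smult (of_nat (N choose l) * w l * (2 * a * of_nat (N - l))) (K (N - l - 1)))
       = (\<Sum>l\<le>N. smult (of_nat (N choose l) * w (Suc l)) (K (N - l)))"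
    proof (cases N)
      case (Suc M)
      have coeff: "of_nat (Suc M choose l) * w l * (2 * a * of_nat (Suc M - l))
        = of_nat (Suc M choose Suc l) * w (Suc (Suc l))" for l
      proof -
        have "of_nat (Suc M choose l) * of_nat (Suc M - l) = (of_nat (Suc M choose Suc l) * of_nat (Suc l) :: complex)"
        proof -
          have "(Suc M choose l) * (Suc M - l) = (Suc M choose Suc l) * Suc l"
            using trans[OF binomial_absorb_comp[of "Suc M" l, unfolded diff_Suc_1]
                binomial_absorption[of l "Suc M", unfolded diff_Suc_1, symmetric]]
            by (simp only: mult.commute)
          then show ?thesis by (metis of_nat_mult)
        qed
        note eq = this
        have "of_nat (Suc M choose l) * w l * (2 * a * of_nat (Suc M - l))
          = (of_nat (Suc M choose l) * of_nat (Suc M - l)) * (2 * a * w l)"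
          by (simp only: mult_ac)
        also have "\<dots> = of_nat (Suc M choose Suc l) * w (Suc (Suc l))"
          unfolding eq w2 by (simp only: mult_ac)
        finally show ?thesis .
      qed
      have "(\<Sum>l\<le>Suc M. smult (of_nat (Suc M choose l) * w l * (2 * a * of_nat (Suc M - l))) (K (Suc M - l - 1)))
        = (\<Sum>l\<le>Suc M. smult (of_nat (Suc M choose Suc l) * w (Suc (Suc l))) (K (M - l)))"
        unfolding coeff by simp
      also have "\<dots> = (\<Sum>l\<le>M. smult (of_nat (Suc M choose Suc l) * w (Suc (Suc l))) (K (M - l)))"
        by (subst sum.atMost_Suc) (simp add: binomial_eq_0 del: binomial_Suc_Suc)
      also have "\<dots> = (\<Sum>l\<le>Suc M. smult (of_nat (Suc M choose l) * w (Suc l)) (K (Suc M - l)))"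
        by (subst sum.atMost_Suc_shift) (simp add: w1 del: binomial_Suc_Suc)
      finally show ?thesis unfolding Suc .
    qed (simp add: w1)
    have "herm g (Suc N) = (\<Sum>l\<le>N. smult (of_nat (N choose l) * w l) (K (Suc (N - l))))
       + (\<Sum>l\<le>N. smult (of_nat (N choose l) * w l * (2 * a * of_nat (N - l))) (K (N - l - 1)))"
      by (simp add: Suc raise_sum raise_smult raise smult_add_right sum.distrib)
    also have "(\<Sum>l\<le>N. smult (of_nat (N choose l) * w l) (K (Suc (N - l))))
       = (\<Sum>l\<le>Suc N. smult (of_nat (N choose l) * w l) (K (Suc N - l)))"
      by (simp add: Suc_diff_le)
    also have "\<dots> = K (Suc N) + (\<Sum>l\<le>N. smult (of_nat (N choose Suc l) * w (Suc l)) (K (N - l)))"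
      by (subst sum.atMost_Suc_shift) (simp add: w1)
    finally have "herm g (Suc N) = K (Suc N) + (\<Sum>l\<le>N. smult (of_nat (Suc N choose Suc l) * w (Suc l)) (K (N - l)))"
      unfolding S2 by (simp add: sum.distrib[symmetric] smult_add_left[symmetric] algebra_simps)
    then show ?case
      by (subst sum.atMost_Suc_shift) (simp add: w1)
  qed (simp add: K_def w1)
  then show ?thesis by (simp add: K_def w_def a_def b_def)
qed

text \<open>The mean of \<open>(1 + c cos \<theta>)\<^sup>N\<close> over the circle.\<close>

definition circle_mean :: "nat \<Rightarrow> real \<Rightarrow> real" where
  "circle_mean N c = (\<Sum>l\<le>N. real (N choose l) * c ^ l
     * (if even l then real (l choose (l div 2)) / 2 ^ l else 0))"

text \<open>In the squared coefficient of even index \<open>l = 2 * j\<close> the factorials combine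
  to \<open>fact N * (N choose l) * (l choose j)\<close>, and the moduli to
  \<open>(c / 2) ^ l\<close> times a factor independent of \<open>l\<close>. This is the origin of
  the central binomial coefficients in \<open>circle_mean\<close>.\<close>

lemma integral_gp_herm:
  assumes s: "Re s > 0" and g: "g \<noteq> 0" and r: "r = 2 * Re s"
  shows "(\<integral>x. (cmod (gp s (herm g N) x))\<^sup>2 \<partial>lborel)
    = sqrt (pi / r) * fact N * (2 * (cmod g)\<^sup>2 / r) ^ N * circle_mean N (cmod (of_real r - g) / cmod g)"
proof -
  have r0: "r > 0" using s r by simp
  define b where "b = g / of_real r"
  define a where "a = - (1 - b) * g"
  define c where "c = cmod (of_real r - g) / cmod g"
  \<comment> \<open>This product fixes the argument of \<open>circle_mean\<close>: since
    \<open>a * r = - (r - g) * g\<close>, the ratio \<open>c\<close> is the distance of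
    \<open>g\<close> from the real weight \<open>r\<close>, relative to the size of
    \<open>g\<close>.\<close>
  have a_c: "cmod a * r = c * (cmod g)\<^sup>2"
  proof -
    have "a * of_real r = - (of_real r - g) * g"
      using r0 by (simp add: a_def b_def field_simps)
    then have "cmod (a * of_real r) = cmod (- (of_real r - g) * g)" by simp
    then have "cmod a * r = cmod (of_real r - g) * cmod g"
      using r0 unfolding norm_mult norm_minus_cancel by simp
    then show ?thesis using g by (simp add: c_def power2_eq_square)
  qed
  let ?C = "\<lambda>l. of_nat (N choose l) * even_moment a l * b ^ (N - l)"
  have "herm g N = (\<Sum>l\<le>N. smult (?C l) (herm (of_real r) (N - l)))"
    using herm_expansion[of "of_real r" g N] r0 by (simp add: a_def b_def)
  also have "\<dots> = (\<Sum>l\<le>N. smult (?C (N - l)) (herm (of_real r) l))"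
    by (subst sum.nat_diff_reindex[symmetric, of _ "Suc N", unfolded lessThan_Suc_atMost]) simp
  finally have "(\<integral>x. (cmod (gp s (herm g N) x))\<^sup>2 \<partial>lborel)
      = sqrt (pi / r) * (\<Sum>l\<le>N. (cmod (?C (N - l)))\<^sup>2 * ((2 * r) ^ l * fact l))"
    by (rule integral_gp_sum_herm[OF s r])
  also have "(\<Sum>l\<le>N. (cmod (?C (N - l)))\<^sup>2 * ((2 * r) ^ l * fact l))
      = (\<Sum>l\<le>N. (cmod (?C l))\<^sup>2 * ((2 * r) ^ (N - l) * fact (N - l)))"
    by (subst sum.nat_diff_reindex[symmetric, of _ "Suc N", unfolded lessThan_Suc_atMost]) simp
  also have "\<dots> = (\<Sum>l\<le>N. fact N * (2 * (cmod g)\<^sup>2 / r) ^ N * (real (N choose l) * c ^ l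
     * (if even l then real (l choose (l div 2)) / 2 ^ l else 0)))"
  proof (intro sum.cong refl)
    fix l assume "l \<in> {..N}"
    then have l: "l \<le> N" by simp
    show "(cmod (?C l))\<^sup>2 * ((2 * r) ^ (N - l) * fact (N - l)) 
        = fact N * (2 * (cmod g)\<^sup>2 / r) ^ N * (real (N choose l) * c ^ l
         * (if even l then real (l choose (l div 2)) / 2 ^ l else 0))"
    proof (cases "even l")
      case True
      then obtain j where j: "l = 2 * j" by (elim evenE)
      have b2: "(cmod b)\<^sup>2 * (2 * r) = 2 * (cmod g)\<^sup>2 / r"
        using r0 by (simp add: b_def norm_divide power_divide power2_eq_square)
      have ml: "cmod (even_moment a l) = fact l / fact j * cmod a ^ j"
        by (simp add: even_moment_eq j norm_mult norm_divide norm_power)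
      have binl: "real (l choose j) * (fact j * fact j) = fact l"
        using arg_cong[OF binomial_fact_lemma[of j l], of real] by (simp add: j mult_ac)
      have binN: "real (N choose l) * (fact l * fact (N - l)) = fact N"
        using arg_cong[OF binomial_fact_lemma[OF l], of real] by (simp add: mult_ac)
      have al: "cmod a ^ l = (c * (cmod g)\<^sup>2 / r) ^ l"
        using a_c r0 by (metis nonzero_mult_div_cancel_right order_less_irrefl)
      have Nl: "N = (N - l) + l" using l by simp
      have "(cmod (?C l))\<^sup>2 * ((2 * r) ^ (N - l) * fact (N - l))
        = (real (N choose l))\<^sup>2 * (fact l / fact j * cmod a ^ j)\<^sup>2 * ((cmod b)\<^sup>2 * (2 * r)) ^ (N - l) * fact (N - l)"
      proof -
        have "cmod (?C l) = real (N choose l) * (fact l / fact j * cmod a ^ j) * cmod b ^ (N - l)"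
          by (simp add: norm_mult norm_power ml)
        then show ?thesis
          by (simp only: power_mult_distrib power_mult[symmetric] mult_ac)
      qed
      also have "\<dots> = real (N choose l) * (real (N choose l) * (fact l * fact (N - l))) * (fact l / (fact j * fact j)) * cmod a ^ l
          * (2 * (cmod g)\<^sup>2 / r) ^ (N - l)"
      proof -
        have "cmod a ^ l = cmod a ^ j * cmod a ^ j" by (simp add: j mult_2 power_add)
        moreover have "n\<^sup>2 * (F / J * A)\<^sup>2 * X * G = n * (n * (F * G)) * (F / (J * J)) * (A * A) * X"
          for n F J A X G :: real
          by (simp add: power2_eq_square)
        ultimately show ?thesis unfolding b2 by presburger
      qed
      also have "\<dots> = real (N choose l) * fact N * real (l choose j) * ((c * (cmod g)\<^sup>2 / r) ^ l
          * (2 * (cmod g)\<^sup>2 / r) ^ (N - l))"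
      proof -
        have "fact l / (fact j * fact j) = real (l choose j)"
          unfolding binl[symmetric] by simp
        then show ?thesis by (simp only: binN al mult.assoc)
      qed
      also have "(c * (cmod g)\<^sup>2 / r) ^ l * (2 * (cmod g)\<^sup>2 / r) ^ (N - l) 
          = (c ^ l / 2 ^ l) * (2 * (cmod g)\<^sup>2 / r) ^ N"
      proof -
        have "(c * (cmod g)\<^sup>2 / r) ^ l = (c ^ l / 2 ^ l) * (2 * (cmod g)\<^sup>2 / r) ^ l"
          by (simp add: power_mult_distrib power_divide)
        then show ?thesis by (subst (2) Nl) (simp add: power_add)
      qed
      finally show ?thesis using True by (simp add: j mult_ac) 
    qed (simp add: even_moment_eq)
  qed
  finally show ?thesis
    by (simp add: circle_mean_def c_def sum_distrib_left mult_ac)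
qed


section \<open>Lower bounds for the operator\<close>

lemma integrable_mult_L2:
  assumes f: "sq_integrable f" and g: "sq_integrable g"
  shows "integrable lborel (\<lambda>x. f x * g x)"
proof (rule Bochner_Integration.integrable_bound)
  show "integrable lborel (\<lambda>x. (cmod (f x))\<^sup>2 + (cmod (g x))\<^sup>2)"
    using f g by (auto simp: sq_integrable_def)
  show "(\<lambda>x. f x * g x) \<in> borel_measurable lborel"
    using f g by (auto simp: sq_integrable_def)
  show "AE x in lborel. norm (f x * g x) \<le> norm ((cmod (f x))\<^sup>2 + (cmod (g x))\<^sup>2)"
  proof (rule AE_I2)
    fix x
    have "cmod (f x) * cmod (g x) \<le> 2 * (cmod (f x) * cmod (g x))" by simp
    also have "\<dots> \<le> (cmod (f x))\<^sup>2 + (cmod (g x))\<^sup>2"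
      using sum_squares_bound[of "cmod (f x)" "cmod (g x)"] by (simp add: mult.assoc)
    finally show "norm (f x * g x) \<le> norm ((cmod (f x))\<^sup>2 + (cmod (g x))\<^sup>2)"
      by (simp add: norm_mult)
  qed
qed

lemma sq_integrable_cnj: "sq_integrable f \<Longrightarrow> sq_integrable (\<lambda>x. cnj (f x))"
  unfolding sq_integrable_def
  by (auto intro: measurable_compose[OF _ borel_measurable_continuous_onI] continuous_intros)

text \<open>Bilinear and not Hermitian, so that it exchanges an operator with its transpose. The
  usual inner product is recovered as the real part after conjugating one argument.\<close>

lift_definition pairing :: "L2 \<Rightarrow> L2 \<Rightarrow> complex" is "\<lambda>f g. \<integral>x. f x * g x \<partial>lborel"
proof -
  fix f f' g g' :: "real \<Rightarrow> complex"
  assume f: "sq_integrable f \<and> sq_integrable f' \<and> (AE x in lborel. f x = f' x)"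
    and g: "sq_integrable g \<and> sq_integrable g' \<and> (AE x in lborel. g x = g' x)"
  then have [measurable]: "f \<in> borel_measurable lborel" "f' \<in> borel_measurable lborel"
    "g \<in> borel_measurable lborel" "g' \<in> borel_measurable lborel" by auto
  have "AE x in lborel. f x * g x = f' x * g' x"
    using f g by (auto elim: eventually_elim2)
  then show "(\<integral>x. f x * g x \<partial>lborel) = (\<integral>x. f' x * g' x \<partial>lborel)"
    by (intro integral_cong_AE) auto
qed

lift_definition cnj_L2 :: "L2 \<Rightarrow> L2" is "\<lambda>f x. cnj (f x)"
  by (auto intro: sq_integrable_cnj)

lemma pairing_add: "pairing (u + v) w = pairing u w + pairing v w"
  by transfer (simp add: distrib_right integrable_mult_L2)

lemma pairing_scaleC: "pairing (c *\<^sub>C u) w = c * pairing u w"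
  by transfer (simp add: mult.assoc)

lemma pairing_commute: "pairing u v = pairing v u"
  by transfer (simp add: mult.commute)

lemma Re_pairing: "Re (pairing u v) = u \<bullet> cnj_L2 v"
proof transfer
  fix f g assume "sq_integrable f \<and> sq_integrable f \<and> (AE x in lborel. f x = f x)"
    "sq_integrable g \<and> sq_integrable g \<and> (AE x in lborel. g x = g x)"
  then have "integrable lborel (\<lambda>x. f x * g x)" by (intro integrable_mult_L2) auto
  then have "Re (\<integral>x. f x * g x \<partial>lborel) = (\<integral>x. Re (f x * g x) \<partial>lborel)"
    by (rule integral_Re[symmetric])
  then show "Re (\<integral>x. f x * g x \<partial>lborel) = (\<integral>x. f x \<bullet> cnj (g x) \<partial>lborel)"
    by (simp add: inner_complex_def)
qed

lemma norm_cnj_L2: "norm (cnj_L2 u) = norm u"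
proof -
  have "cnj_L2 u \<bullet> cnj_L2 u = u \<bullet> u"
    by transfer (simp add: inner_complex_def)
  then show ?thesis by (simp add: norm_L2_def)
qed

lemma cnj_L2_cnj_L2: "cnj_L2 (cnj_L2 u) = u"
  by transfer simp

text \<open>A unit factor \<open>c\<close> makes the pairing real and nonnegative, and then the
  Cauchy-Schwarz inequality of the real inner product applies.\<close>

lemma norm_pairing_le: "cmod (pairing u v) \<le> norm u * norm v"
proof (cases "pairing u v = 0")
  case False
  define c where "c = cnj (sgn (pairing u v))"
  have c: "cmod c = 1" using False by (simp add: c_def norm_sgn)
  have "cmod (pairing u v) = Re (c * pairing u v)"
  proof -
    have "c * pairing u v = of_real (cmod (pairing u v))"
      using False by (simp add: c_def sgn_eq complex_norm_square[symmetric] power2_eq_square mult.commute)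
    then show ?thesis by simp
  qed
  also have "\<dots> = (c *\<^sub>C u) \<bullet> cnj_L2 v"
    by (simp add: pairing_scaleC[symmetric] Re_pairing)
  also have "\<dots> \<le> norm (c *\<^sub>C u) * norm (cnj_L2 v)"
    by (rule norm_cauchy_schwarz)
  finally show ?thesis by (simp add: norm_scaleC norm_cnj_L2 c)
qed simp

lemma pairing_scaleR: "pairing (r *\<^sub>R u) w = of_real r * pairing u w"
  by transfer (simp add: scaleR_conv_of_real mult.assoc)

lemma bounded_linear_pairing: "bounded_linear (\<lambda>u. pairing u v)"
  by (rule bounded_linear_intro[where K = "norm v"])
    (simp_all add: pairing_add pairing_scaleR scaleR_conv_of_real norm_pairing_le)

definition gp_L2 :: "complex \<Rightarrow> complex poly \<Rightarrow> L2" where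
  "gp_L2 s P = abs_L2 (gp s P)"

lemma gp_L2_add:
  assumes "Re s > 0" shows "gp_L2 s (P + Q) = gp_L2 s P + gp_L2 s Q"
  using plus_L2.abs_eq[of "gp s P" "gp s Q"] sq_integrable_gp[OF assms]
  by (simp add: gp_L2_def gp_add[abs_def])

lemma gp_L2_diff:
  assumes "Re s > 0" shows "gp_L2 s (P - Q) = gp_L2 s P - gp_L2 s Q"
  using minus_L2.abs_eq[of "gp s P" "gp s Q"] sq_integrable_gp[OF assms]
  by (simp add: gp_L2_def gp_diff[abs_def])

lemma gp_L2_smult:
  assumes "Re s > 0" shows "gp_L2 s (smult c P) = c *\<^sub>C gp_L2 s P"
  using scaleC.abs_eq[of "gp s P" c] sq_integrable_gp[OF assms]
  by (simp add: gp_L2_def gp_smult[abs_def])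

lemma gp_L2_0: "gp_L2 s 0 = 0"
  by (simp add: gp_L2_def gp_0[abs_def] zero_L2_def)

lemma inner_gp_L2:
  assumes "Re s > 0" shows "gp_L2 s P \<bullet> gp_L2 s Q = (\<integral>x. gp s P x \<bullet> gp s Q x \<partial>lborel)"
  using sq_integrable_gp[OF assms] by (simp add: gp_L2_def inner_L2.abs_eq)

lemma pairing_gp_L2:
  assumes "Re s > 0" "Re t > 0" shows "pairing (gp_L2 s P) (gp_L2 t Q) = gp_integral (s + t) (P * Q)"
  using sq_integrable_gp[OF assms(1)] sq_integrable_gp[OF assms(2)]
  by (simp add: gp_L2_def pairing.abs_eq gp_mult gp_integral_def)

lemma norm_gp_L2:
  assumes "Re s > 0" shows "(norm (gp_L2 s P))\<^sup>2 = (\<integral>x. (cmod (gp s P x))\<^sup>2 \<partial>lborel)"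
  unfolding gp_L2_def by (rule norm_L2_abs[OF sq_integrable_gp[OF assms]])

section \<open>Coercivity and commutator estimates\<close>

lemma integral_gp_cnj_derivative:
  assumes s: "Re s > 0"
  shows "integrable lborel (\<lambda>x. gp s (gp_deriv s P) x * cnj (gp s Q x) + gp s P x * cnj (gp s (gp_deriv s Q) x))"
    and "(\<integral>x. gp s (gp_deriv s P) x * cnj (gp s Q x) + gp s P x * cnj (gp s (gp_deriv s Q) x) \<partial>lborel) = 0"
proof -
  have "integrable lborel (\<lambda>x. gp s A x * cnj (gp s B x))" for A B
    unfolding gp_cnj gp_mult using s by (intro integrable_gp) simp
  then show i: "integrable lborel (\<lambda>x. gp s (gp_deriv s P) x * cnj (gp s Q x) + gp s P x * cnj (gp s (gp_deriv s Q) x))"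
    by (intro Bochner_Integration.integrable_add)
  show "(\<integral>x. gp s (gp_deriv s P) x * cnj (gp s Q x) + gp s P x * cnj (gp s (gp_deriv s Q) x) \<partial>lborel) = 0"
  proof (rule integral_derivative_eq_0[OF _ _ i, where F = "\<lambda>x. gp s P x * cnj (gp s Q x)"])
    show "((\<lambda>x. gp s P x * cnj (gp s Q x)) has_vector_derivative
      gp s (gp_deriv s P) x * cnj (gp s Q x) + gp s P x * cnj (gp s (gp_deriv s Q) x)) (at x)" for x
      using has_vector_derivative_mult[OF gp_has_derivative has_vector_derivative_cnj[OF gp_has_derivative]]
      by (simp add: add.commute)
    show "((\<lambda>x. gp s P x * cnj (gp s Q x)) \<longlongrightarrow> 0) at_top" 
      "((\<lambda>x. gp s P x * cnj (gp s Q x)) \<longlongrightarrow> 0) at_bot"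
      using tendsto_mult[OF gp_tendsto_0(1)[OF s] tendsto_cnj[OF gp_tendsto_0(1)[OF s]], of P Q]
        tendsto_mult[OF gp_tendsto_0(2)[OF s] tendsto_cnj[OF gp_tendsto_0(2)[OF s]], of P Q] by simp_all
  qed (intro continuous_intros)
qed

text \<open>The mixed term is a free number \<open>w\<close> bounded by \<open>y * z\<close>,
  because in the application it is the imaginary part of a product of two complex numbers with
  moduli \<open>y\<close> and \<open>z\<close>.\<close>

lemma pos_def_form_lower_bound:
  fixes a b c :: real
  assumes "a > 0" "b\<^sup>2 < a * c"
  obtains e where "e > 0" "\<And>y z w. \<bar>w\<bar> \<le> y * z \<Longrightarrow> a * y\<^sup>2 - 2 * b * w + c * z\<^sup>2 \<ge> e * (y\<^sup>2 + z\<^sup>2)"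
proof -
  have "a * c > 0" using assms(2) zero_le_power2[of b] by linarith
  then have c: "c > 0" using assms(1) by (simp add: zero_less_mult_iff)
  \<comment> \<open>Determinant over trace, which lies below the smaller eigenvalue of the
    matrix.\<close>
  define e where "e = (a * c - b\<^sup>2) / (a + c)"
  have e: "e > 0" using assms c by (simp add: e_def)
  have e_tr: "e * (a + c) = a * c - b\<^sup>2" using assms(1) c by (simp add: e_def)
  have "(a - e) * (a + c) = a\<^sup>2 + b\<^sup>2" using e_tr by (simp add: algebra_simps power2_eq_square)
  then have ae: "a - e > 0" using assms(1) c
    by (smt (verit) zero_less_mult_pos2 zero_less_power2 zero_le_power2)
  have "a * y\<^sup>2 - 2 * b * w + c * z\<^sup>2 \<ge> e * (y\<^sup>2 + z\<^sup>2)" if w: "\<bar>w\<bar> \<le> y * z" for y z w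
  proof -
    \<comment> \<open>Completing the square; what is left is the determinant after subtracting
      \<open>e\<close> from the diagonal, and the choice of \<open>e\<close> makes it equal to
      \<open>e^2\<close>.\<close>
    have "(a - e) * ((a - e) * y\<^sup>2 - 2 * \<bar>b\<bar> * (y * z) + (c - e) * z\<^sup>2)
        = ((a - e) * y - \<bar>b\<bar> * z)\<^sup>2 + ((a * c - b\<^sup>2 - e * (a + c)) + e\<^sup>2) * z\<^sup>2"
      by (simp add: power2_eq_square algebra_simps flip: abs_mult)
    also have "\<dots> \<ge> 0" by (simp add: e_tr)
    finally have "(a - e) * y\<^sup>2 - 2 * \<bar>b\<bar> * (y * z) + (c - e) * z\<^sup>2 \<ge> 0"
      using ae by (simp add: zero_le_mult_iff)
    moreover have "b * w \<le> \<bar>b\<bar> * (y * z)"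
      using mult_left_mono[OF w abs_ge_zero[of b]] abs_ge_self[of "b * w"] by (simp add: abs_mult)
    ultimately show ?thesis by (simp add: algebra_simps)
  qed
  then show ?thesis using that e by blast
qed

text \<open>\<open>raise (\<sigma> + \<tau>)\<close> and \<open>pderiv\<close> are, up to sign, the operators \<open>d/dx - 2 \<tau> x\<close> and
  \<open>d/dx + 2 \<sigma> x\<close> acting on the polynomial factor of \<open>gp \<sigma> P\<close>. Their symmetrised product \<open>ham\<close> is
  the Weyl quantization of \<open>(\<xi> - 2 i \<sigma> x) (\<xi> + 2 i \<tau> x)\<close>.\<close>

definition ham :: "complex \<Rightarrow> complex poly \<Rightarrow> complex poly" where
  "ham g P = raise g (pderiv P) + smult g P"

locale gauss_pair =
  fixes \<sigma> \<tau> \<gamma> :: complex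
  assumes Re_\<sigma>: "Re \<sigma> > 0" and Re_\<tau>: "Re \<tau> > 0" and \<gamma>_def: "\<gamma> = \<sigma> + \<tau>"
begin

lemma Re_\<gamma>: "Re \<gamma> > 0" using Re_\<sigma> Re_\<tau> by (simp add: \<gamma>_def)

lemma \<gamma>_nz: "\<gamma> \<noteq> 0" using Re_\<gamma> by auto

abbreviation e :: "complex poly \<Rightarrow> L2" where "e \<equiv> gp_L2 \<sigma>"
abbreviation X :: "complex poly \<Rightarrow> complex poly" where "X P \<equiv> [:0, 1:] * P"

lemmas e_add = gp_L2_add[OF Re_\<sigma>] and e_diff = gp_L2_diff[OF Re_\<sigma>] and e_smult = gp_L2_smult[OF Re_\<sigma>]

text \<open>For the whole function \<open>f = gp \<sigma> P\<close> this reads \<open>- f'' - 2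
  (\<sigma> - \<tau>) x f' - (\<sigma> - \<tau>) f + 4 \<sigma> \<tau> x^2 f\<close>, the form in
  which integration by parts is possible.\<close>

lemma ham_eq: "ham \<gamma> P = - gp_deriv \<sigma> (gp_deriv \<sigma> P) - smult (2 * (\<sigma> - \<tau>)) (X (gp_deriv \<sigma> P))
    - smult (\<sigma> - \<tau>) P + smult (4 * \<sigma> * \<tau>) (X (X P))"
  unfolding poly_eq_poly_eq_iff[symmetric]
  by (rule ext) (simp add: ham_def gp_deriv_def raise_def pderiv_diff pderiv_mult pderiv_pCons
      pderiv_smult \<gamma>_def algebra_simps)

lemma raise_eq: "raise \<gamma> P = smult (2 * \<tau>) (X P) - gp_deriv \<sigma> P"
  unfolding poly_eq_poly_eq_iff[symmetric]
  by (rule ext) (simp add: gp_deriv_def raise_def \<gamma>_def algebra_simps)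

text \<open>The factor \<open>cnj \<gamma>\<close> rotates the eigenvalues
  \<open>\<gamma> (2 n + 1)\<close> onto the positive axis. After this rotation the discriminant can
  be computed exactly: the gap between the two sides is
  \<open>4 * Re \<sigma> * Re \<tau> * (cmod \<gamma>)^2\<close>.\<close>

lemma discriminant_neg: "(Im (cnj \<gamma> * (\<sigma> - \<tau>)))\<^sup>2 < Re \<gamma> * (4 * Re (cnj \<gamma> * \<sigma> * \<tau>))"
proof -
  obtain a b where s: "\<sigma> = Complex a b" by (cases \<sigma>)
  obtain c d where t: "\<tau> = Complex c d" by (cases \<tau>)
  have a: "a > 0" and c: "c > 0" using Re_\<sigma> Re_\<tau> s t by auto
  have "Re \<gamma> * (4 * Re (cnj \<gamma> * \<sigma> * \<tau>)) - (Im (cnj \<gamma> * (\<sigma> - \<tau>)))\<^sup>2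
      = 4 * (a * c * (a + c)\<^sup>2 + a * c * (b + d)\<^sup>2)"
    by (simp add: \<gamma>_def s t power2_eq_square algebra_simps)
  also have "\<dots> > 0"
  proof -
    have "a * c * (a + c)\<^sup>2 > 0" "a * c * (b + d)\<^sup>2 \<ge> 0" using a c by auto
    then show ?thesis by (simp add: add_pos_nonneg del: mult_nonneg_nonneg mult_pos_pos)
  qed
  finally show ?thesis by simp
qed

text \<open>The integrand of the inner product differs by a total derivative from a quadratic form
  in \<open>f'\<close> and \<open>x f\<close>, and this form is bounded below pointwise.\<close>

lemma coercive:
  obtains \<epsilon> where "\<epsilon> > 0"
    "\<And>P. e (smult (cnj \<gamma>) (ham \<gamma> P)) \<bullet> e P \<ge> \<epsilon> * ((norm (e (gp_deriv \<sigma> P)))\<^sup>2 + (norm (e (X P)))\<^sup>2)"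
proof -
  let ?b = "Im (cnj \<gamma> * (\<sigma> - \<tau>))" and ?c = "4 * Re (cnj \<gamma> * \<sigma> * \<tau>)"
  obtain \<epsilon> where \<epsilon>: "\<epsilon> > 0"
    "\<And>y z w. \<bar>w\<bar> \<le> y * z \<Longrightarrow> Re \<gamma> * y\<^sup>2 - 2 * ?b * w + ?c * z\<^sup>2 \<ge> \<epsilon> * (y\<^sup>2 + z\<^sup>2)"
    using pos_def_form_lower_bound[OF Re_\<gamma> discriminant_neg] by blast
  have "e (smult (cnj \<gamma>) (ham \<gamma> P)) \<bullet> e P \<ge> \<epsilon> * ((norm (e (gp_deriv \<sigma> P)))\<^sup>2 + (norm (e (X P)))\<^sup>2)" for P
  proof -
    define f where "f = gp \<sigma> P"
    define f1 where "f1 = gp \<sigma> (gp_deriv \<sigma> P)"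
    define f2 where "f2 = gp \<sigma> (gp_deriv \<sigma> (gp_deriv \<sigma> P))"
    \<comment> \<open>The derivative of
      \<open>f1 * cnj f + (\<sigma> - \<tau>) * x * f * cnj f\<close>. Its first part turns
      \<open>f''\<close> into the squared modulus of \<open>f'\<close>; its second part turns the
      mixed terms into a difference of conjugates, that is, into an imaginary part.\<close>
    define D where "D x = (f2 x * cnj (f x) + f1 x * cnj (f1 x))
      + (\<sigma> - \<tau>) * ((gp \<sigma> (gp_deriv \<sigma> (X P)) x) * cnj (f x) + gp \<sigma> (X P) x * cnj (f1 x))" for x
    have D: "integrable lborel D" "integral\<^sup>L lborel D = 0"
      using integral_gp_cnj_derivative[OF Re_\<sigma>, of "gp_deriv \<sigma> P" P] integral_gp_cnj_derivative[OF Re_\<sigma>, of "X P" P]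
      by (simp_all add: D_def[abs_def] f_def f1_def f2_def)
    have XP: "gp \<sigma> (X Q) x = of_real x * gp \<sigma> Q x" for Q x by (simp add: gp_def)
    have DXP: "gp \<sigma> (gp_deriv \<sigma> (X P)) x = f x + of_real x * f1 x" for x
      by (simp add: f_def f1_def gp_deriv_def gp_def pderiv_mult pderiv_pCons algebra_simps)
    have ham: "gp \<sigma> (ham \<gamma> P) x = - f2 x - 2 * (\<sigma> - \<tau>) * (of_real x * f1 x) - (\<sigma> - \<tau>) * f x
        + 4 * \<sigma> * \<tau> * (of_real x * (of_real x * f x))" for x
      unfolding ham_eq by (simp add: gp_def f_def f1_def f2_def algebra_simps)
    have pw: "gp \<sigma> (smult (cnj \<gamma>) (ham \<gamma> P)) x \<bullet> gp \<sigma> P x + Re (cnj \<gamma> * D x)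
        \<ge> \<epsilon> * ((cmod (gp \<sigma> (gp_deriv \<sigma> P) x))\<^sup>2 + (cmod (gp \<sigma> (X P) x))\<^sup>2)" for x
    proof -
      define w where "w = Im (of_real x * f x * cnj (f1 x))"
      have "cnj \<gamma> * gp \<sigma> (ham \<gamma> P) x * cnj (f x) + cnj \<gamma> * D x
          = cnj \<gamma> * (f1 x * cnj (f1 x)) + cnj \<gamma> * (\<sigma> - \<tau>) * (of_real x * f x * cnj (f1 x) - cnj (of_real x * f x * cnj (f1 x)))
            + 4 * (cnj \<gamma> * \<sigma> * \<tau>) * ((of_real x * f x) * cnj (of_real x * f x))"
        unfolding ham D_def DXP XP by (simp add: f_def[symmetric] algebra_simps)
      also have "f1 x * cnj (f1 x) = of_real ((cmod (f1 x))\<^sup>2)" by (rule complex_norm_square[symmetric])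
      also have "(of_real x * f x) * cnj (of_real x * f x) = of_real ((cmod (of_real x * f x))\<^sup>2)"
        by (rule complex_norm_square[symmetric])
      also have "of_real x * f x * cnj (f1 x) - cnj (of_real x * f x * cnj (f1 x)) = 2 * \<i> * of_real w"
        unfolding w_def by (simp add: complex_eq_iff)
      finally have "Re (cnj \<gamma> * gp \<sigma> (ham \<gamma> P) x * cnj (f x) + cnj \<gamma> * D x)
          = Re \<gamma> * (cmod (f1 x))\<^sup>2 - 2 * ?b * w + ?c * (cmod (of_real x * f x))\<^sup>2"
        by (simp del: of_real_power)
      moreover have "\<bar>w\<bar> \<le> cmod (f1 x) * cmod (of_real x * f x)"
        using abs_Im_le_cmod[of "of_real x * f x * cnj (f1 x)"] by (simp add: w_def norm_mult mult_ac)
      ultimately have "Re (cnj \<gamma> * gp \<sigma> (ham \<gamma> P) x * cnj (f x) + cnj \<gamma> * D x)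
          \<ge> \<epsilon> * ((cmod (f1 x))\<^sup>2 + (cmod (of_real x * f x))\<^sup>2)"
        using \<epsilon>(2) by simp
      moreover have "Re (u * cnj v) = u \<bullet> v" for u v by (simp add: inner_complex_def)
      ultimately show ?thesis by (simp only: plus_complex.sel gp_smult XP f_def[symmetric] f1_def[symmetric])
    qed
    have i1: "integrable lborel (\<lambda>x. gp \<sigma> (smult (cnj \<gamma>) (ham \<gamma> P)) x \<bullet> gp \<sigma> P x)"
      by (intro integrable_inner_L2 sq_integrable_gp Re_\<sigma>)
    have i2: "integrable lborel (\<lambda>x. Re (cnj \<gamma> * D x))" using D(1) by simp
    have i3: "integrable lborel (\<lambda>x. (cmod (gp \<sigma> Q x))\<^sup>2)" for Q
      using sq_integrable_gp[OF Re_\<sigma>] by blast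
    have "\<epsilon> * ((norm (e (gp_deriv \<sigma> P)))\<^sup>2 + (norm (e (X P)))\<^sup>2)
        = (\<integral>x. \<epsilon> * ((cmod (gp \<sigma> (gp_deriv \<sigma> P) x))\<^sup>2 + (cmod (gp \<sigma> (X P) x))\<^sup>2) \<partial>lborel)"
      using i3[of "gp_deriv \<sigma> P"] i3[of "X P"] by (simp add: norm_gp_L2[OF Re_\<sigma>])
    also have "\<dots> \<le> (\<integral>x. gp \<sigma> (smult (cnj \<gamma>) (ham \<gamma> P)) x \<bullet> gp \<sigma> P x + Re (cnj \<gamma> * D x) \<partial>lborel)"
      by (intro integral_mono pw Bochner_Integration.integrable_add i1 i2 integrable_mult_right i3)
    also have "\<dots> = e (smult (cnj \<gamma>) (ham \<gamma> P)) \<bullet> e P"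
      using i1 i2 D by (simp add: inner_gp_L2[OF Re_\<sigma>])
    finally show ?thesis .
  qed
  then show ?thesis using that \<epsilon>(1) by blast
qed

text \<open>On functions \<open>raise \<gamma>\<close> is \<open>B = 2 \<tau> x - d/dx\<close>, with
  formal adjoint \<open>B' = 2 (cnj \<tau>) x + d/dx\<close>. The commutator
  \<open>B' B - B B'\<close> is the constant \<open>4 * Re \<tau>\<close>, and the squared norm of
  \<open>B' f\<close> is dropped.\<close>

lemma norm_le_norm_raise: "4 * Re \<tau> * (norm (e P))\<^sup>2 \<le> (norm (e (raise \<gamma> P)))\<^sup>2"
proof -
  define f where "f = gp \<sigma> P"
  define f1 where "f1 = gp \<sigma> (gp_deriv \<sigma> P)"
  define D where "D x = gp \<sigma> (gp_deriv \<sigma> (X P)) x * cnj (gp \<sigma> P x) + gp \<sigma> (X P) x * cnj (gp \<sigma> (gp_deriv \<sigma> P) x)" for x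
  have D: "integrable lborel D" "integral\<^sup>L lborel D = 0"
    using integral_gp_cnj_derivative[OF Re_\<sigma>, of "X P" P] by (simp_all add: D_def[abs_def])
  have D_eq: "Re (D x) = (cmod (f x))\<^sup>2 + 2 * Re (of_real x * f x * cnj (f1 x))" for x
  proof -
    have "D x = (f x + of_real x * f1 x) * cnj (f x) + of_real x * f x * cnj (f1 x)"
      by (simp add: D_def f_def f1_def gp_deriv_def gp_def pderiv_mult pderiv_pCons algebra_simps)
    then show ?thesis by (simp add: cmod_power2) (simp add: power2_eq_square algebra_simps)
  qed
  have pw: "4 * Re \<tau> * (cmod (f x))\<^sup>2 - 4 * Re \<tau> * Re (D x) \<le> (cmod (gp \<sigma> (raise \<gamma> P) x))\<^sup>2" for x
  proof -
    have "gp \<sigma> (raise \<gamma> P) x = 2 * \<tau> * of_real x * f x - f1 x"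
      unfolding raise_eq by (simp add: gp_def f_def f1_def algebra_simps)
    then have "(cmod (gp \<sigma> (raise \<gamma> P) x))\<^sup>2 - (cmod (2 * cnj \<tau> * of_real x * f x + f1 x))\<^sup>2
        = (cmod (2 * \<tau> * of_real x * f x - f1 x))\<^sup>2 - (cmod (2 * cnj \<tau> * of_real x * f x + f1 x))\<^sup>2"
      by simp
    also have "\<dots> = - 8 * Re \<tau> * Re (of_real x * f x * cnj (f1 x))"
      unfolding cmod_power2 by (simp add: power2_eq_square algebra_simps)
    finally have "(cmod (gp \<sigma> (raise \<gamma> P) x))\<^sup>2 - (cmod (2 * cnj \<tau> * of_real x * f x + f1 x))\<^sup>2
        = - 8 * Re \<tau> * Re (of_real x * f x * cnj (f1 x))" .
    moreover have "0 \<le> (cmod (2 * cnj \<tau> * of_real x * f x + f1 x))\<^sup>2" by simp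
    moreover have "4 * Re \<tau> * y - 4 * Re \<tau> * (y + 2 * w) = - 8 * Re \<tau> * w" for y w
      by (simp add: algebra_simps)
    from this[of "(cmod (f x))\<^sup>2" "Re (of_real x * f x * cnj (f1 x))"]
    have "4 * Re \<tau> * (cmod (f x))\<^sup>2 - 4 * Re \<tau> * Re (D x) = - 8 * Re \<tau> * Re (of_real x * f x * cnj (f1 x))"
      by (simp only: D_eq)
    ultimately show ?thesis by linarith
  qed
  have i3: "integrable lborel (\<lambda>x. (cmod (gp \<sigma> Q x))\<^sup>2)" for Q
    using sq_integrable_gp[OF Re_\<sigma>] by blast
  have i4: "integrable lborel (\<lambda>x. Re (D x))" using D by simp
  have "(\<integral>x. 4 * Re \<tau> * (cmod (f x))\<^sup>2 - 4 * Re \<tau> * Re (D x) \<partial>lborel) \<le> (\<integral>x. (cmod (gp \<sigma> (raise \<gamma> P) x))\<^sup>2 \<partial>lborel)"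
    using i3[of P] i3[of "raise \<gamma> P"] i4 by (intro integral_mono pw) (auto simp: f_def)
  moreover have "(\<integral>x. 4 * Re \<tau> * (cmod (f x))\<^sup>2 - 4 * Re \<tau> * Re (D x) \<partial>lborel) = 4 * Re \<tau> * (\<integral>x. (cmod (f x))\<^sup>2 \<partial>lborel)"
    using i3[of P] i4 D by (simp add: f_def)
  ultimately show ?thesis by (simp add: norm_gp_L2[OF Re_\<sigma>] f_def)
qed

text \<open>\<open>raise\<close> is a combination of multiplication by \<open>x\<close> and
  differentiation, and coercivity bounds both by the graph norm of the operator.\<close>

lemma norm_raise_le:
  obtains C where "C \<ge> 0" "\<And>P. norm (e (raise \<gamma> P)) \<le> C * (norm (e (ham \<gamma> P)) + norm (e P))"
proof -
  obtain \<epsilon> where \<epsilon>: "\<epsilon> > 0"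
    "\<And>P. e (smult (cnj \<gamma>) (ham \<gamma> P)) \<bullet> e P \<ge> \<epsilon> * ((norm (e (gp_deriv \<sigma> P)))\<^sup>2 + (norm (e (X P)))\<^sup>2)"
    using coercive by blast
  define K where "K = sqrt (cmod \<gamma> / \<epsilon>)"
  have "norm (e (raise \<gamma> P)) \<le> (2 * cmod \<tau> + 1) * K * (norm (e (ham \<gamma> P)) + norm (e P))" for P
  proof -
    let ?S = "norm (e (ham \<gamma> P)) + norm (e P)"
    have "\<epsilon> * ((norm (e (gp_deriv \<sigma> P)))\<^sup>2 + (norm (e (X P)))\<^sup>2) \<le> norm (e (smult (cnj \<gamma>) (ham \<gamma> P))) * norm (e P)"
      using \<epsilon>(2)[of P] norm_cauchy_schwarz order_trans by blast
    also have "\<dots> \<le> cmod \<gamma> * ?S\<^sup>2"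
    proof -
      have "norm (e (ham \<gamma> P)) * norm (e P) \<le> ?S * ?S"
        by (intro mult_mono) auto
      then show ?thesis
        using mult_left_mono[of _ _ "cmod \<gamma>"] by (simp add: e_smult norm_scaleC mult.assoc power2_eq_square)
    qed
    finally have sq: "(norm (e (gp_deriv \<sigma> P)))\<^sup>2 + (norm (e (X P)))\<^sup>2 \<le> cmod \<gamma> / \<epsilon> * ?S\<^sup>2"
      using \<epsilon>(1) by (simp add: field_simps)
    have KS: "sqrt (cmod \<gamma> / \<epsilon> * ?S\<^sup>2) = K * ?S"
      by (simp only: K_def real_sqrt_mult real_sqrt_abs) simp
    have "(norm (e (gp_deriv \<sigma> P)))\<^sup>2 \<le> cmod \<gamma> / \<epsilon> * ?S\<^sup>2" "(norm (e (X P)))\<^sup>2 \<le> cmod \<gamma> / \<epsilon> * ?S\<^sup>2"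
      using sq zero_le_power2[of "norm (e (gp_deriv \<sigma> P))"] zero_le_power2[of "norm (e (X P))"] by linarith+
    then have 1: "norm (e (gp_deriv \<sigma> P)) \<le> K * ?S" and 2: "norm (e (X P)) \<le> K * ?S"
      unfolding KS[symmetric] by (auto intro: real_le_rsqrt)
    have "norm (e (raise \<gamma> P)) \<le> norm (e (smult (2 * \<tau>) (X P))) + norm (e (gp_deriv \<sigma> P))"
      unfolding raise_eq e_diff by (rule norm_triangle_ineq4)
    also have "\<dots> \<le> 2 * cmod \<tau> * (K * ?S) + K * ?S"
      using mult_left_mono[OF 2, of "2 * cmod \<tau>"] 1
      unfolding e_smult norm_scaleC by (simp add: norm_mult)
    finally show ?thesis by (simp add: algebra_simps)
  qed
  moreover have "(2 * cmod \<tau> + 1) * K \<ge> 0" using \<epsilon>(1) by (simp add: K_def)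
  ultimately show ?thesis using that by blast
qed

section \<open>The ladder and lower bounds off the eigenvalues\<close>

lemma raise_diff: "raise g (P - Q) = raise g P - raise g Q"
  unfolding poly_eq_poly_eq_iff[symmetric]
  by (rule ext) (simp add: raise_def pderiv_diff algebra_simps)

lemma ham_raise: "ham \<gamma> (raise \<gamma> P) = raise \<gamma> (ham \<gamma> P + smult (2 * \<gamma>) P)"
  by (simp add: ham_def pderiv_raise raise_add raise_smult smult_add_left[symmetric])

lemma ham_add: "ham \<gamma> (P + Q) = ham \<gamma> P + ham \<gamma> Q"
  by (simp add: ham_def pderiv_add raise_add smult_add_right)

lemma ham_const: "ham \<gamma> [:c:] = smult \<gamma> [:c:]"
  by (simp add: ham_def raise_def)

text \<open>Writing a polynomial as \<open>a + x Q\<close>, the part \<open>x Q\<close> equals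
  \<open>raise \<gamma> (Q / (2 \<gamma>)) + Q' / (2 \<gamma>)\<close>, and the last term has
  smaller degree. So the constants complement the range of \<open>raise \<gamma>\<close>.\<close>

lemma const_plus_raise: "\<exists>c Q. P = [:c:] + raise \<gamma> Q"
proof (induction "degree P" arbitrary: P rule: less_induct)
  case less
  obtain a Q where P: "P = pCons a Q" by (cases P)
  show ?case
  proof (cases "Q = 0")
    case True
    then show ?thesis by (intro exI[of _ a] exI[of _ 0]) (simp add: P raise_def)
  next
    case False
    define R where "R = smult (1 / (2 * \<gamma>)) (pderiv Q)"
    have "degree R < degree P"
      using False by (simp add: R_def P degree_pderiv) linarith
    from less[OF this] obtain c Q' where "R = [:c:] + raise \<gamma> Q'" by blast
    moreover have "P = [:a:] + raise \<gamma> (smult (1 / (2 * \<gamma>)) Q) + R"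
      using \<gamma>_nz by (simp add: P R_def raise_smult raise_def smult_diff_right pderiv_smult)
    ultimately have "P = [:a + c:] + raise \<gamma> (smult (1 / (2 * \<gamma>)) Q + Q')"
      by (simp add: raise_add)
    then show ?thesis by blast
  qed
qed

text \<open>The estimate is required on the core of polynomials times a Gaussian only, so that the
  ladder can be handled algebraically; closedness of the operator extends it afterwards.\<close>

definition bounded_below_at :: "complex \<Rightarrow> bool" where
  "bounded_below_at z \<longleftrightarrow> (\<exists>C\<ge>0. \<forall>P. norm (e P) \<le> C * norm (e (smult z P - ham \<gamma> P)))"

text \<open>In the inner product of \<open>cnj \<gamma> (z - ham) P\<close> with \<open>P\<close>,
  the contributions of \<open>z\<close> and of \<open>ham\<close> both have nonpositive real part,
  and that of \<open>z\<close> alone is \<open>- r\<close> times the squared norm of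
  \<open>P\<close>.\<close>

lemma bounded_below_at_half_plane:
  assumes "Re (cnj \<gamma> * z) < 0"
  shows "bounded_below_at z"
proof -
  obtain \<epsilon> where \<epsilon>: "\<epsilon> > 0"
    "\<And>P. e (smult (cnj \<gamma>) (ham \<gamma> P)) \<bullet> e P \<ge> \<epsilon> * ((norm (e (gp_deriv \<sigma> P)))\<^sup>2 + (norm (e (X P)))\<^sup>2)"
    using coercive by blast
  define r where "r = - Re (cnj \<gamma> * z)"
  have r: "r > 0" using assms by (simp add: r_def)
  have "norm (e P) \<le> cmod \<gamma> / r * norm (e (smult z P - ham \<gamma> P))" for P
  proof -
    have pos: "0 \<le> e (smult (cnj \<gamma>) (ham \<gamma> P)) \<bullet> e P"
      using \<epsilon>(1) by (intro order_trans[OF _ \<epsilon>(2)]) auto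
    have self: "(c *\<^sub>C u) \<bullet> u = Re c * (norm u)\<^sup>2" for c u
    proof -
      have "(c *\<^sub>C u) \<bullet> u = Re c * (u \<bullet> u)"
      proof transfer
        fix c and f :: "real \<Rightarrow> complex" 
        have "(\<lambda>x. (c * f x) \<bullet> f x) = (\<lambda>x. Re c * (f x \<bullet> f x))"
          by (auto simp: inner_complex_def algebra_simps)
        then show "(\<integral>x. (c * f x) \<bullet> f x \<partial>lborel) = Re c * (\<integral>x. f x \<bullet> f x \<partial>lborel)"
          by simp
      qed
      then show ?thesis by (simp add: power2_norm_eq_inner)
    qed
    have "smult (cnj \<gamma>) (smult z P - ham \<gamma> P) = smult (cnj \<gamma> * z) P - smult (cnj \<gamma>) (ham \<gamma> P)"
      by (simp add: smult_diff_right)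
    then have "e (smult (cnj \<gamma>) (smult z P - ham \<gamma> P)) = (cnj \<gamma> * z) *\<^sub>C e P - e (smult (cnj \<gamma>) (ham \<gamma> P))"
      by (simp only: e_diff e_smult)
    then have "r * (norm (e P))\<^sup>2 \<le> - (e (smult (cnj \<gamma>) (smult z P - ham \<gamma> P)) \<bullet> e P)"
      using pos by (simp only: inner_diff_left self r_def mult_minus_left)
    also have "\<dots> \<le> norm (e (smult (cnj \<gamma>) (smult z P - ham \<gamma> P))) * norm (e P)"
      using Cauchy_Schwarz_ineq2[of "e (smult (cnj \<gamma>) (smult z P - ham \<gamma> P))" "e P"] by linarith
    also have "\<dots> = cmod \<gamma> * norm (e (smult z P - ham \<gamma> P)) * norm (e P)"
      by (simp add: e_smult norm_scaleC)
    finally have "r * norm (e P) * norm (e P) \<le> cmod \<gamma> * norm (e (smult z P - ham \<gamma> P)) * norm (e P)"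
      by (simp add: power2_eq_square mult.assoc)
    then have "r * norm (e P) \<le> cmod \<gamma> * norm (e (smult z P - ham \<gamma> P))"
      by (cases "norm (e P) = 0") (auto dest: mult_right_le_imp_le)
    then show ?thesis using r by (simp add: field_simps)
  qed
  then show ?thesis unfolding bounded_below_at_def using r by (intro exI[of _ "cmod \<gamma> / r"]) auto
qed

lemma gp_integral_1_nz: "gp_integral \<gamma> 1 \<noteq> 0"
proof -
  have "cmod (gp_integral \<gamma> 1) > 0" using \<gamma>_nz by (simp add: cmod_gp_integral_1[OF Re_\<gamma>])
  then show ?thesis by auto
qed

text \<open>Splitting off the ground state, the estimate for \<open>z\<close> is transported to \<open>z + 2 \<gamma>\<close> by the
  intertwining relation \<open>ham_raise\<close>.\<close>

lemma bounded_below_at_step: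
  assumes z: "bounded_below_at z" "z + \<gamma> \<noteq> 0"
  shows "bounded_below_at (z + 2 * \<gamma>)"
proof -
  obtain C where C: "C \<ge> 0" "\<And>P. norm (e P) \<le> C * norm (e (smult z P - ham \<gamma> P))"
    using z(1) by (auto simp: bounded_below_at_def)
  obtain B where B: "B \<ge> 0" "\<And>P. norm (e (raise \<gamma> P)) \<le> B * (norm (e (ham \<gamma> P)) + norm (e P))"
    using norm_raise_le by blast
  define K1 where "K1 = norm (gp_L2 \<tau> 1) / (cmod (z + \<gamma>) * cmod (gp_integral \<gamma> 1))"
  define K2 where "K2 = 1 + cmod (z + \<gamma>) * K1 * norm (e 1)"
  define K3 where "K3 = K2 / sqrt (4 * Re \<tau>)"
  define K4 where "K4 = B * ((cmod z + 1) * (C * K3) + K3)"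
  have K: "K1 \<ge> 0" "K2 \<ge> 0" "K3 \<ge> 0" "K4 \<ge> 0"
    using Re_\<tau> B(1) C(1) by (auto simp: K1_def K2_def K3_def K4_def)
  have "norm (e h) \<le> (K1 * norm (e 1) + K4) * norm (e (smult (z + 2 * \<gamma>) h - ham \<gamma> h))" for h
  proof -
    obtain c w where h: "h = [:c:] + raise \<gamma> w" using const_plus_raise by blast
    define g where "g = smult z w - ham \<gamma> w"
    define f where "f = smult (z + 2 * \<gamma>) h - ham \<gamma> h"
    have f: "f = smult ((z + \<gamma>) * c) 1 + raise \<gamma> g"
      unfolding f_def h ham_add ham_const ham_raise g_def raise_diff raise_add raise_smult
        poly_eq_poly_eq_iff[symmetric]
      by (rule ext) (simp add: algebra_simps)
    have e1: "[:c:] = smult c 1" by (simp add: one_pCons)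
    \<comment> \<open>Pairing with the ground state of the transposed operator kills the range of
      \<open>raise \<gamma>\<close> and isolates \<open>c\<close>. The factor
      \<open>z + \<gamma>\<close> is the difference between \<open>z + 2 * \<gamma>\<close> and the
      lowest eigenvalue \<gamma>.\<close>
    have "pairing (e f) (gp_L2 \<tau> 1) = (z + \<gamma>) * c * gp_integral \<gamma> 1"
      unfolding pairing_gp_L2[OF Re_\<sigma> Re_\<tau>] \<gamma>_def[symmetric] f
      using gp_integral_raise_mult[OF Re_\<gamma>, of g 1] Re_\<gamma> 
      by (simp add: gp_integral_add gp_integral_smult gp_integral_def[of _ 0] gp_0 del: smult_one)
    then have "cmod (z + \<gamma>) * cmod c * cmod (gp_integral \<gamma> 1) \<le> norm (e f) * norm (gp_L2 \<tau> 1)"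
      using norm_pairing_le[of "e f" "gp_L2 \<tau> 1"] by (simp add: norm_mult)
    then have c: "cmod c \<le> K1 * norm (e f)"
      using z(2) gp_integral_1_nz by (simp add: K1_def field_simps)
    have "norm (e (raise \<gamma> g)) = norm (e (f - smult ((z + \<gamma>) * c) 1))" by (simp add: f)
    also have "\<dots> \<le> norm (e f) + norm (e (smult ((z + \<gamma>) * c) 1))"
      unfolding e_diff by (rule norm_triangle_ineq4)
    also have "\<dots> = norm (e f) + cmod (z + \<gamma>) * cmod c * norm (e 1)"
      by (simp only: e_smult norm_scaleC norm_mult)
    also have "\<dots> \<le> norm (e f) + cmod (z + \<gamma>) * (K1 * norm (e f)) * norm (e 1)"
      by (intro add_left_mono mult_right_mono mult_left_mono c) auto
    finally have rg: "norm (e (raise \<gamma> g)) \<le> K2 * norm (e f)"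
      by (simp add: K2_def algebra_simps)
    \<comment> \<open>The commutator bound strips \<open>raise\<close> from \<open>g\<close>; after
      that the hypothesis at \<open>z\<close> applies to \<open>w\<close>.\<close>
    have "(sqrt (4 * Re \<tau>) * norm (e g))\<^sup>2 \<le> (norm (e (raise \<gamma> g)))\<^sup>2"
      using norm_le_norm_raise[of g] Re_\<tau> by (simp add: power_mult_distrib)
    then have "sqrt (4 * Re \<tau>) * norm (e g) \<le> K2 * norm (e f)"
      using rg by (meson norm_ge_zero order_trans power2_le_imp_le)
    then have g: "norm (e g) \<le> K3 * norm (e f)"
      using Re_\<tau> by (simp add: K3_def field_simps)
    have w: "norm (e w) \<le> C * K3 * norm (e f)"
      using order_trans[OF C(2)[of w, folded g_def] mult_left_mono[OF g C(1)]]
      by (simp add: mult.assoc)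
    \<comment> \<open>The unbounded \<open>raise\<close> has to be put back in front of
      \<open>w\<close>. This costs control of \<open>ham \<gamma> w\<close>, which the equation for
      \<open>g\<close> supplies.\<close>
    have "ham \<gamma> w = smult z w - g" by (simp add: g_def)
    then have "norm (e (ham \<gamma> w)) \<le> cmod z * norm (e w) + norm (e g)"
      using norm_triangle_ineq4[of "e (smult z w)" "e g"] by (simp add: e_diff e_smult norm_scaleC)
    also have "\<dots> \<le> cmod z * (C * K3 * norm (e f)) + K3 * norm (e f)"
      by (intro add_mono mult_left_mono w g) auto
    finally have "norm (e (ham \<gamma> w)) + norm (e w) \<le> ((cmod z + 1) * (C * K3) + K3) * norm (e f)"
      using w by (simp add: algebra_simps)
    then have rw: "norm (e (raise \<gamma> w)) \<le> K4 * norm (e f)"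
      using order_trans[OF B(2)[of w] mult_left_mono[OF _ B(1)]] by (simp add: K4_def mult.assoc)
    have "norm (e h) \<le> cmod c * norm (e 1) + norm (e (raise \<gamma> w))"
      using norm_triangle_ineq[of "e [:c:]" "e (raise \<gamma> w)"]
      by (simp only: h e_add e1 e_smult norm_scaleC)
    also have "\<dots> \<le> K1 * norm (e f) * norm (e 1) + K4 * norm (e f)"
      by (intro add_mono mult_right_mono c rw) auto
    finally show ?thesis unfolding f_def by (simp add: algebra_simps)
  qed
  then show ?thesis unfolding bounded_below_at_def using K by (intro exI[of _ "K1 * norm (e 1) + K4"]) auto
qed

text \<open>Each descent \<open>z \<mapsto> z - 2 * \<gamma>\<close> lowers
  \<open>Re (cnj \<gamma> * z)\<close> by \<open>2 * (cmod \<gamma>)^2\<close>, so the half plane is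
  reached after finitely many steps. None of them is blocked, because \<open>z\<close> avoids all
  odd multiples of \<gamma>.\<close>

theorem bounded_below_at_off_spectrum:
  assumes "\<And>k. z \<noteq> \<gamma> * of_nat (2 * k + 1)"
  shows "bounded_below_at z"
proof -
  have "bounded_below_at z" if "Re (cnj \<gamma> * z) < 2 * (cmod \<gamma>)\<^sup>2 * real n" "\<And>k. z \<noteq> \<gamma> * of_nat (2 * k + 1)" for n z
    using that
  proof (induction n arbitrary: z)
    case 0
    then show ?case by (intro bounded_below_at_half_plane) simp
  next
    case (Suc n)
    have "Re (cnj \<gamma> * \<gamma>) = (cmod \<gamma>)\<^sup>2"
      by (simp add: cmod_power2) (simp add: power2_eq_square)
    then have "Re (cnj \<gamma> * (z - 2 * \<gamma>)) < 2 * (cmod \<gamma>)\<^sup>2 * real n"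
      using Suc.prems(1) by (simp add: algebra_simps)
    moreover have "z - 2 * \<gamma> \<noteq> \<gamma> * of_nat (2 * k + 1)" for k
      using Suc.prems(2)[of "Suc k"] by (auto simp: algebra_simps)
    ultimately have "bounded_below_at (z - 2 * \<gamma>)" by (rule Suc.IH)
    moreover have "z - 2 * \<gamma> + \<gamma> \<noteq> 0" using Suc.prems(2)[of 0] by auto
    ultimately show ?case using bounded_below_at_step[of "z - 2 * \<gamma>"] by simp
  qed
  moreover obtain n where "Re (cnj \<gamma> * z) / (2 * (cmod \<gamma>)\<^sup>2) < real n"
    using reals_Archimedean2 by blast
  then have "Re (cnj \<gamma> * z) < 2 * (cmod \<gamma>)\<^sup>2 * real n"
    using \<gamma>_nz by (simp add: field_simps)
  ultimately show ?thesis using assms by blast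
qed

end


section \<open>Density of polynomials times Gaussians\<close>

text \<open>The classical projection argument: a minimising sequence for the distance from
  \<open>x\<close> is Cauchy, and the residual at its limit is orthogonal to the subspace.\<close>

lemma closed_subspace_orthogonal:
  fixes V :: "'a :: {real_inner, complete_space} set"
  assumes V: "subspace V" "closed V" and x: "x \<notin> V"
  obtains u where "u \<noteq> 0" "\<And>v. v \<in> V \<Longrightarrow> u \<bullet> v = 0"
proof -
  have ne: "V \<noteq> {}" using subspace_0[OF V(1)] by auto
  define d where "d = infdist x V"
  have d: "d \<ge> 0" by (simp add: d_def infdist_nonneg)
  have d_le: "d \<le> norm (x - v)" if "v \<in> V" for v
    using infdist_le[OF that, of x] by (simp add: d_def dist_norm)
  have "\<exists>v\<in>V. norm (x - v) < d + 1 / real (Suc n)" for n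
  proof (rule ccontr)
    assume "\<not> ?thesis"
    then have "d + 1 / real (Suc n) \<le> d"
      unfolding d_def infdist_notempty[OF ne] using ne
      by (intro cINF_greatest) (auto simp: dist_norm not_less)
    then show False by simp
  qed
  then obtain v where v: "\<And>n. v n \<in> V" "\<And>n. norm (x - v n) < d + 1 / real (Suc n)"
    by metis
  \<comment> \<open>Parallelogram law; the midpoint lies in \<open>V\<close>, so its distance from
    \<open>x\<close> is at least \<open>d\<close>.\<close>
  have par: "(norm (v n - v m))\<^sup>2 \<le> 2 * (norm (x - v n))\<^sup>2 + 2 * (norm (x - v m))\<^sup>2 - 4 * d\<^sup>2" for n m
  proof -
    have "(1/2) *\<^sub>R (v n + v m) \<in> V"
      using V(1) v(1) by (simp add: subspace_add subspace_mul)
    then have "d\<^sup>2 \<le> (norm (x - (1/2) *\<^sub>R (v n + v m)))\<^sup>2"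
      using d_le d by (intro power_mono) auto
    moreover have "(norm (v n - v m))\<^sup>2 + 4 * (norm (x - (1/2) *\<^sub>R (v n + v m)))\<^sup>2
        = 2 * (norm (x - v n))\<^sup>2 + 2 * (norm (x - v m))\<^sup>2"
      unfolding power2_norm_eq_inner
      by (simp add: inner_diff_left inner_diff_right inner_add_left inner_add_right inner_commute algebra_simps)
    ultimately show ?thesis by linarith
  qed
  have "Cauchy v"
  proof (rule metric_CauchyI)
    fix e :: real assume e: "e > 0"
    have "(\<lambda>n. 8 * d * (1 / real (Suc n)) + 4 * (1 / real (Suc n))\<^sup>2) \<longlonglongrightarrow> 8 * d * 0 + 4 * 0\<^sup>2"
      by (intro tendsto_intros LIMSEQ_Suc[OF lim_1_over_n])
    then have "\<forall>\<^sub>F n in sequentially. 8 * d * (1 / real (Suc n)) + 4 * (1 / real (Suc n))\<^sup>2 < e\<^sup>2"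
      using e by (intro order_tendstoD) auto
    then obtain N where N: "8 * d * (1 / real (Suc N)) + 4 * (1 / real (Suc N))\<^sup>2 < e\<^sup>2"
      by (auto simp: eventually_sequentially)
    define r where "r = 1 / real (Suc N)"
    have "dist (v m) (v n) < e" if "m \<ge> N" "n \<ge> N" for m n
    proof -
      have le: "norm (x - v k) \<le> d + r" if "k \<ge> N" for k
        using v(2)[of k] that frac_le[of 1 1 "real (Suc N)" "real (Suc k)"] by (simp add: r_def)
      have "(norm (x - v k))\<^sup>2 \<le> (d + r)\<^sup>2" if "k \<ge> N" for k
        using le[OF that] by (intro power_mono) auto
      then have "(norm (v m - v n))\<^sup>2 \<le> 2 * (d + r)\<^sup>2 + 2 * (d + r)\<^sup>2 - 4 * d\<^sup>2"
        using par[of m n] \<open>m \<ge> N\<close> \<open>n \<ge> N\<close> by (smt (verit))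
      also have "\<dots> = 8 * d * r + 4 * r\<^sup>2"
        by (simp add: power2_eq_square algebra_simps)
      also have "\<dots> < e\<^sup>2" using N by (simp add: r_def)
      finally show ?thesis
        using e by (simp add: dist_norm power_less_imp_less_base)
    qed
    then show "\<exists>M. \<forall>m\<ge>M. \<forall>n\<ge>M. dist (v m) (v n) < e" by blast
  qed
  then obtain w where w: "v \<longlonglongrightarrow> w" using Cauchy_convergent convergent_def by blast
  have wV: "w \<in> V" using closed_sequentially[OF V(2)] v(1) w by blast
  have "norm (x - w) \<le> d"
  proof (rule LIMSEQ_le)
    show "(\<lambda>n. norm (x - v n)) \<longlonglongrightarrow> norm (x - w)" by (intro tendsto_intros w)
    show "(\<lambda>n. d + 1 / real (Suc n)) \<longlonglongrightarrow> d"
      using tendsto_add[OF tendsto_const LIMSEQ_Suc[OF lim_1_over_n], of d] by simp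
    show "\<exists>N. \<forall>n\<ge>N. norm (x - v n) \<le> d + 1 / real (Suc n)"
      using v(2) less_imp_le by blast
  qed
  then have min: "norm (x - w) \<le> norm (x - y)" if "y \<in> V" for y
    using d_le[OF that] by simp
  have "(x - w) \<bullet> y = 0" if y: "y \<in> V" for y
  proof -
    \<comment> \<open>Minimality along the line \<open>w + t *\<^sub>R y\<close>; the vanishing of
      the linear term is orthogonality.\<close>
    have "0 \<le> (- 2 * ((x - w) \<bullet> y)) * t + (y \<bullet> y) * t\<^sup>2" for t
    proof -
      have "w + t *\<^sub>R y \<in> V" using V(1) wV y by (simp add: subspace_add subspace_mul)
      then have "(norm (x - w))\<^sup>2 \<le> (norm (x - (w + t *\<^sub>R y)))\<^sup>2"
        using min by (intro power_mono) auto
      then show ?thesis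
        unfolding power2_norm_eq_inner
        by (simp add: inner_diff_left inner_diff_right inner_add_left inner_add_right inner_commute
            power2_eq_square algebra_simps)
    qed
    from nonneg_linear_plus_quadratic[OF this] show ?thesis by simp
  qed
  moreover have "x - w \<noteq> 0" using wV x by auto
  ultimately show ?thesis using that by blast
qed

lemma subspace_closure:
  fixes S :: "'a :: real_normed_vector set"
  assumes "subspace S"
  shows "subspace (closure S)"
  unfolding subspace_def
proof (intro conjI ballI allI)
  show "0 \<in> closure S" using subspace_0[OF assms] closure_subset by blast
next
  fix x y assume "x \<in> closure S" "y \<in> closure S"
  then obtain f g where "\<And>n. f n \<in> S" "f \<longlonglongrightarrow> x" "\<And>n. g n \<in> S" "g \<longlonglongrightarrow> y"
    by (metis closure_sequential)
  then have "\<And>n. f n + g n \<in> S" "(\<lambda>n. f n + g n) \<longlonglongrightarrow> x + y"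
    by (auto intro: tendsto_add subspace_add[OF assms])
  then show "x + y \<in> closure S" unfolding closure_sequential by (intro exI[of _ "\<lambda>n. f n + g n"]) auto
next
  fix c x assume "x \<in> closure S"
  then obtain f where "\<And>n. f n \<in> S" "f \<longlonglongrightarrow> x" by (metis closure_sequential)
  then have "\<And>n. c *\<^sub>R f n \<in> S" "(\<lambda>n. c *\<^sub>R f n) \<longlonglongrightarrow> c *\<^sub>R x"
    by (auto intro: tendsto_scaleR subspace_mul[OF assms])
  then show "c *\<^sub>R x \<in> closure S" unfolding closure_sequential by (intro exI[of _ "\<lambda>n. c *\<^sub>R f n"]) auto
qed

text \<open>The positive and the negative part of \<open>g\<close> have the same Fourier transform,
  hence at \<open>t = 0\<close> the same mass \<open>c\<close>. Divided by \<open>c\<close>, they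
  are densities of probability measures with equal characteristic functions, which coincide by
  Levy's uniqueness theorem.\<close>

lemma fourier_zero_real:
  fixes g :: "real \<Rightarrow> real"
  assumes g: "integrable lborel g" and 0: "\<And>t. (\<integral>x. g x *\<^sub>R iexp (t * x) \<partial>lborel) = 0"
  shows "AE x in lborel. g x = 0"
proof -
  define p where "p x = max (g x) 0" for x
  define n where "n x = max (- g x) 0" for x
  have gpn: "g x = p x - n x" for x by (simp add: p_def n_def max_def)
  have nn: "p x \<ge> 0" "n x \<ge> 0" for x by (simp_all add: p_def n_def)
  have ip: "integrable lborel p" and "in": "integrable lborel n"
    using g unfolding p_def n_def by (auto intro: integrable_max)
  have ii: "integrable lborel (\<lambda>x. f x *\<^sub>R iexp (t * x))" if "integrable lborel f" for f :: "real \<Rightarrow> real" and t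
    by (rule Bochner_Integration.integrable_bound[OF that]) (use that in auto)
  have eq: "(\<integral>x. p x *\<^sub>R iexp (t * x) \<partial>lborel) = (\<integral>x. n x *\<^sub>R iexp (t * x) \<partial>lborel)" for t
    using 0[of t] ii[OF ip, of t] ii[OF "in", of t] by (simp add: gpn scaleR_diff_left)
  define c where "c = (\<integral>x. p x \<partial>lborel)"
  have cn: "(\<integral>x. n x \<partial>lborel) = c"
    using eq[of 0] by (simp add: c_def scaleR_conv_of_real)
  have c0: "c \<ge> 0" using nn by (simp add: c_def)
  show ?thesis
  proof (cases "c = 0")
    case True
    have "AE x in lborel. p x = 0"
      using integral_nonneg_eq_0_iff_AE[OF ip] nn True by (simp add: c_def)
    moreover have "AE x in lborel. n x = 0"
      using integral_nonneg_eq_0_iff_AE[OF "in"] nn True cn by simp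
    ultimately show ?thesis by eventually_elim (simp add: gpn)
  next
    case False
    then have c: "c > 0" using c0 by simp
    define M where "M f = density lborel (\<lambda>x. ennreal (f x / c))" for f :: "real \<Rightarrow> real"
    have meas: "(\<lambda>x. ennreal (f x / c)) \<in> borel_measurable lborel" if "integrable lborel f" for f
      using borel_measurable_integrable[OF that] by measurable
    have rd: "real_distribution (M f)"
      if f: "integrable lborel f" "\<And>x. f x \<ge> 0" "(\<integral>x. f x \<partial>lborel) = c" for f
    proof -
      have "prob_space (M f)"
      proof
        have "emeasure (M f) (space (M f)) = (\<integral>\<^sup>+x. ennreal (f x / c) \<partial>lborel)"
          unfolding M_def using meas[OF f(1)] by (simp add: emeasure_density)
        also have "\<dots> = ennreal (\<integral>x. f x / c \<partial>lborel)"
          using f c by (intro nn_integral_eq_integral) auto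
        also have "\<dots> = 1" using f(3) c by simp
        finally show "emeasure (M f) (space (M f)) = 1" .
      qed
      then show ?thesis by (simp add: real_distribution_def real_distribution_axioms_def M_def)
    qed
    have char: "char (M f) t = (\<integral>x. f x *\<^sub>R iexp (t * x) \<partial>lborel) / of_real c"
      if f: "integrable lborel f" "\<And>x. f x \<ge> 0" for f t
    proof -
      have [measurable]: "f \<in> borel_measurable borel" using f(1) by simp
      have "char (M f) t = (\<integral>x. (f x / c) *\<^sub>R iexp (t * x) \<partial>lborel)"
        unfolding char_def M_def using f c by (subst integral_density) auto
      also have "\<dots> = (\<integral>x. (f x *\<^sub>R iexp (t * x)) / of_real c \<partial>lborel)"
        by (simp add: scaleR_conv_of_real)
      finally show ?thesis by simp
    qed
    have "M p = M n"
      by (rule Levy_uniqueness[OF rd[OF ip nn(1) c_def[symmetric]] rd[OF "in" nn(2) cn]], rule ext)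
        (simp only: char[OF ip nn(1)] char[OF "in" nn(2)] eq)
    then have "AE x in lborel. ennreal (p x / c) = ennreal (n x / c)"
      unfolding M_def by (rule sigma_finite_measure.density_unique[OF sigma_finite_lborel meas[OF ip] meas[OF "in"]])
    then show ?thesis
    proof eventually_elim
      case (elim x)
      then have "p x / c = n x / c" using nn c by (simp add: ennreal_inj)
      then show ?case using c by (simp add: gpn)
    qed
  qed
qed

text \<open>Conjugation of \<open>h\<close> reverses the frequency, so the transforms of the real
  and the imaginary part vanish as well.\<close>

lemma fourier_zero:
  fixes h :: "real \<Rightarrow> complex"
  assumes h: "integrable lborel h" and 0: "\<And>t. (\<integral>x. h x * iexp (t * x) \<partial>lborel) = 0"
  shows "AE x in lborel. h x = 0"
proof -
  have i1: "integrable lborel (\<lambda>x. h x * iexp (t * x))" for t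
    by (rule Bochner_Integration.integrable_bound[OF h]) (use h in \<open>auto simp: norm_mult\<close>)
  have c0: "(\<integral>x. cnj (h x) * iexp (t * x) \<partial>lborel) = 0" for t
  proof -
    have "(\<integral>x. cnj (h x) * iexp (t * x) \<partial>lborel) = (\<integral>x. cnj (h x * iexp (- t * x)) \<partial>lborel)"
      by (intro Bochner_Integration.integral_cong refl) (simp add: exp_cnj)
    also have "\<dots> = cnj (\<integral>x. h x * iexp (- t * x) \<partial>lborel)" by (rule Bochner_Integration.integral_cnj)
    finally show ?thesis using 0[of "- t"] by simp
  qed
  have i2: "integrable lborel (\<lambda>x. cnj (h x) * iexp (t * x))" for t
  proof -
    have "(\<lambda>x. cnj (h x) * iexp (t * x)) = (\<lambda>x. cnj (h x * iexp (- t * x)))"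
      by (simp add: exp_cnj)
    then show ?thesis using i1[of "- t"] by (simp only: Bochner_Integration.integrable_cnj)
  qed
  have "AE x in lborel. Re (h x) = 0"
  proof (rule fourier_zero_real)
    have "Re (h x) *\<^sub>R iexp (t * x) = (h x * iexp (t * x) + cnj (h x) * iexp (t * x)) / 2" for t x
      by (simp add: scaleR_conv_of_real distrib_right[symmetric] complex_add_cnj)
    note eq = this
    show "(\<integral>x. Re (h x) *\<^sub>R iexp (t * x) \<partial>lborel) = 0" for t
      unfolding eq using i1[of t] i2[of t] 0[of t] c0[of t] by simp
  qed (use h in auto)
  moreover have "AE x in lborel. Im (h x) = 0"
  proof (rule fourier_zero_real)
    have "Im (h x) *\<^sub>R iexp (t * x) = (h x * iexp (t * x) - cnj (h x) * iexp (t * x)) / (2 * \<i>)" for t x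
    proof -
      have "of_real (Im (h x)) = (h x - cnj (h x)) / (2 * \<i>)"
        by (simp add: complex_eq_iff Re_divide Im_divide)
      then have "Im (h x) *\<^sub>R iexp (t * x) = (h x - cnj (h x)) / (2 * \<i>) * iexp (t * x)"
        by (simp only: scaleR_conv_of_real)
      then show ?thesis by (simp only: times_divide_eq_left left_diff_distrib)
    qed
    note eq = this
    show "(\<integral>x. Im (h x) *\<^sub>R iexp (t * x) \<partial>lborel) = 0" for t
      unfolding eq using i1[of t] i2[of t] 0[of t] c0[of t] by simp
  qed (use h in auto)
  ultimately show ?thesis by eventually_elim (simp add: complex_eq_iff)
qed

lemma sq_integrable_exp_abs: "sq_integrable (\<lambda>x. of_real (exp (- \<bar>x\<bar>)))"
proof -
  have "integrable lborel (\<lambda>x::real. (exp (- \<bar>x\<bar>))\<^sup>2)"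
    by (rule Bochner_Integration.integrable_bound[OF integrable_exp_abs])
      (auto simp: power2_eq_square mult_le_cancel_left1)
  then show ?thesis by (simp add: sq_integrable_def)
qed

text \<open>Vanishing against all polynomials gives vanishing against the Taylor polynomials of
  \<open>exp (\<i> t x)\<close>, and by dominated convergence the Fourier transform of
  \<open>u\<close> times the Gaussian is zero.\<close>

lemma gp_moments_zero:
  assumes u: "sq_integrable u" and s: "Re s > 0" and 0: "\<And>P. (\<integral>x. u x * gp s P x \<partial>lborel) = 0"
  shows "AE x in lborel. u x = 0"
proof -
  define h where "h x = u x * gp s 1 x" for x
  have h: "integrable lborel h"
    unfolding h_def by (intro integrable_mult_L2 u sq_integrable_gp s)
  have "(\<integral>x. h x * iexp (t * x) \<partial>lborel) = 0" for t
  proof -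
    define p where "p n = (\<Sum>k<n. monom ((\<i> * of_real t) ^ k / fact k) k)" for n
    have pp: "poly (p n) (of_real x) = (\<Sum>k<n. (\<i> * of_real (t * x)) ^ k / fact k)" for n x
      by (simp add: p_def poly_sum poly_monom power_mult_distrib mult.assoc)
    \<comment> \<open>The Taylor polynomials are bounded by \<open>exp \<bar>t * x\<bar>\<close>.
      The rate \<open>\<bar>t\<bar> + 1\<close> absorbs this and leaves
      \<open>exp (- \<bar>x\<bar>)\<close>, which is square integrable and so can be multiplied by
      \<open>u\<close>.\<close>
    obtain K where K: "K \<ge> 0" "\<And>x. cmod (gp s 1 x) \<le> K * exp (- (\<bar>t\<bar> + 1) * \<bar>x\<bar>)"
      using gp_exp_bound[OF s] by blast
    have "(\<lambda>n. \<integral>x. h x * poly (p n) (of_real x) \<partial>lborel) \<longlonglongrightarrow> (\<integral>x. h x * iexp (t * x) \<partial>lborel)"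
    proof (rule integral_dominated_convergence[where w = "\<lambda>x. K * cmod (u x * of_real (exp (- \<bar>x\<bar>)))"])
      show "integrable lborel (\<lambda>x. K * cmod (u x * of_real (exp (- \<bar>x\<bar>))))"
        by (intro integrable_mult_right integrable_norm integrable_mult_L2 u sq_integrable_exp_abs)
      show "AE x in lborel. (\<lambda>n. h x * poly (p n) (of_real x)) \<longlonglongrightarrow> h x * iexp (t * x)"
      proof (rule AE_I2)
        fix x
        have "(\<lambda>n. (\<i> * of_real (t * x)) ^ n /\<^sub>R fact n) sums iexp (t * x)"
          by (rule exp_converges)
        then have "(\<lambda>n. poly (p n) (of_real x)) \<longlonglongrightarrow> iexp (t * x)"
          by (simp add: pp sums_def scaleR_conv_of_real divide_inverse mult.commute)
        then show "(\<lambda>n. h x * poly (p n) (of_real x)) \<longlonglongrightarrow> h x * iexp (t * x)"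
          by (rule tendsto_mult_left)
      qed
      show "AE x in lborel. norm (h x * poly (p n) (of_real x)) \<le> K * cmod (u x * of_real (exp (- \<bar>x\<bar>)))" for n
      proof (rule AE_I2)
        fix x
        have "cmod (poly (p n) (of_real x)) \<le> (\<Sum>k<n. \<bar>t * x\<bar> ^ k /\<^sub>R fact k)"
          unfolding pp by (rule sum_norm_le)
            (simp add: norm_divide norm_mult norm_power norm_inverse divide_inverse mult.commute abs_mult)
        also have "\<dots> \<le> exp \<bar>t * x\<bar>"
          unfolding exp_def by (rule sum_le_suminf[OF summable_exp_generic]) auto
        finally have "cmod (h x * poly (p n) (of_real x)) \<le> cmod (u x) * (K * exp (- (\<bar>t\<bar> + 1) * \<bar>x\<bar>)) * exp \<bar>t * x\<bar>"
          unfolding h_def norm_mult by (intro mult_mono K) (use K(1) in \<open>auto intro!: mult_nonneg_nonneg\<close>)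
        also have "exp (- (\<bar>t\<bar> + 1) * \<bar>x\<bar>) = exp (- \<bar>x\<bar>) * exp (- \<bar>t * x\<bar>)"
          by (simp add: exp_add[symmetric] abs_mult algebra_simps)
        also have "cmod (u x) * (K * (exp (- \<bar>x\<bar>) * exp (- \<bar>t * x\<bar>))) * exp \<bar>t * x\<bar>
          = K * cmod (u x * of_real (exp (- \<bar>x\<bar>)))"
        proof -
          have "exp (- \<bar>t * x\<bar>) * exp \<bar>t * x\<bar> = 1" by (simp add: exp_add[symmetric])
          then have "cmod (u x) * (K * (exp (- \<bar>x\<bar>) * exp (- \<bar>t * x\<bar>))) * exp \<bar>t * x\<bar>
            = K * (cmod (u x) * exp (- \<bar>x\<bar>))" by (simp add: mult_ac)
          then show ?thesis by (simp only: norm_mult norm_of_real abs_exp_cancel)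
        qed
        finally show "norm (h x * poly (p n) (of_real x)) \<le> K * cmod (u x * of_real (exp (- \<bar>x\<bar>)))" .
      qed
      have [measurable]: "h \<in> borel_measurable borel" using h by simp
      show "(\<lambda>x. h x * iexp (t * x)) \<in> borel_measurable lborel" by measurable
      show "(\<lambda>x. h x * poly (p n) (of_real x)) \<in> borel_measurable lborel" for n
        unfolding pp by measurable
    qed
    moreover have "h x * poly (p n) (of_real x) = u x * gp s (p n) x" for n x
      by (simp add: h_def gp_def)
    ultimately have "(\<lambda>n. 0) \<longlonglongrightarrow> (\<integral>x. h x * iexp (t * x) \<partial>lborel)"
      by (simp add: 0)
    then show ?thesis by (simp add: LIMSEQ_const_iff)
  qed
  then have "AE x in lborel. h x = 0" by (rule fourier_zero[OF h])
  then show ?thesis by eventually_elim (simp add: h_def gp_def)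
qed

lemma pairing_gp_L2_zero:
  assumes s: "Re s > 0" and 0: "\<And>P. pairing u (gp_L2 s P) = 0"
  shows "u = 0"
proof -
  define f where "f = rep_L2 u"
  have f: "sq_integrable f" "abs_L2 f = u" by (simp_all add: f_def sq_integrable_rep abs_rep_L2)
  have "pairing (abs_L2 f) (abs_L2 (gp s P)) = (\<integral>x. f x * gp s P x \<partial>lborel)" for P
    using f(1) sq_integrable_gp[OF s] by (intro pairing.abs_eq) auto
  then have "(\<integral>x. f x * gp s P x \<partial>lborel) = 0" for P
    using 0[of P] by (simp add: gp_L2_def f(2))
  then have "AE x in lborel. f x = 0" by (rule gp_moments_zero[OF f(1) s])
  then have "(\<integral>x. (cmod (f x))\<^sup>2 \<partial>lborel) = 0"
    by (intro integral_eq_zero_AE) auto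
  then show ?thesis using norm_L2_abs[OF f(1)] by (simp add: f(2))
qed

lemma scaleC_of_real: "of_real r *\<^sub>C u = r *\<^sub>R u"
proof -
  define f where "f = rep_L2 u"
  have f: "sq_integrable f" "abs_L2 f = u" by (simp_all add: f_def sq_integrable_rep abs_rep_L2)
  have "of_real r *\<^sub>C abs_L2 f = abs_L2 (\<lambda>x. of_real r * f x)"
    using f(1) by (intro scaleC.abs_eq) auto
  moreover have "r *\<^sub>R abs_L2 f = abs_L2 (\<lambda>x. r *\<^sub>R f x)"
    using f(1) by (intro scaleR_L2.abs_eq) auto
  ultimately show ?thesis by (simp add: f(2) scaleR_conv_of_real)
qed

lemma closure_range_gp_L2:
  assumes s: "Re s > 0"
  shows "closure (range (gp_L2 s)) = UNIV"
proof (rule ccontr)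
  assume "\<not> ?thesis"
  then obtain x where x: "x \<notin> closure (range (gp_L2 s))" by blast
  have "subspace (range (gp_L2 s))"
    unfolding subspace_def
  proof (intro conjI ballI allI)
    show "0 \<in> range (gp_L2 s)" using gp_L2_0[symmetric] by (rule range_eqI)
    show "u + v \<in> range (gp_L2 s)" if "u \<in> range (gp_L2 s)" "v \<in> range (gp_L2 s)" for u v
      using that by (auto simp: gp_L2_add[OF s, symmetric])
    show "c *\<^sub>R u \<in> range (gp_L2 s)" if "u \<in> range (gp_L2 s)" for c u
      using that by (auto simp: gp_L2_smult[OF s, symmetric] scaleC_of_real[symmetric])
  qed
  then obtain u where u: "u \<noteq> 0" "\<And>v. v \<in> closure (range (gp_L2 s)) \<Longrightarrow> u \<bullet> v = 0"
    using closed_subspace_orthogonal[OF subspace_closure closed_closure x] by blast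
  have Re0: "Re (pairing (gp_L2 s P) (cnj_L2 u)) = 0" for P
    using u(2)[of "gp_L2 s P"] closure_subset[of "range (gp_L2 s)"] 
    by (simp add: Re_pairing cnj_L2_cnj_L2 inner_commute subset_iff)
  \<comment> \<open>Orthogonality is real here and yields real parts only; inserting
    \<open>smult \<i> P\<close> yields the imaginary parts.\<close>
  have "pairing (cnj_L2 u) (gp_L2 s P) = 0" for P
    using Re0[of P] Re0[of "smult \<i> P"]
    by (simp add: gp_L2_smult[OF s] pairing_scaleC pairing_commute[of "cnj_L2 u"] complex_eq_iff)
  then have "cnj_L2 u = 0" by (rule pairing_gp_L2_zero[OF s])
  then have "norm u = 0" using norm_cnj_L2[of u] by simp
  then show False using u(1) by simp
qed


section \<open>The weak formulation\<close>

text \<open>Differentiability of finite order, stated with derivatives as witnesses. Sums, products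
  and affine substitutions are then handled by induction, without computing iterated
  \<open>vector_derivative\<close>s as in \<open>test_function\<close>.\<close>

primrec diff_times :: "nat \<Rightarrow> (real \<Rightarrow> complex) \<Rightarrow> bool" where
  "diff_times 0 f \<longleftrightarrow> True"
| "diff_times (Suc n) f \<longleftrightarrow> (\<exists>f'. (\<forall>x. (f has_vector_derivative f' x) (at x)) \<and> diff_times n f')"

lemma diff_times_SucI:
  "(\<And>x. (f has_vector_derivative f' x) (at x)) \<Longrightarrow> diff_times n f' \<Longrightarrow> diff_times (Suc n) f"
  by auto

lemma diff_times_SucD: "diff_times (Suc n) f \<Longrightarrow> diff_times n f"
proof (induction n arbitrary: f)
  case (Suc n)
  then obtain f' where f': "\<forall>x. (f has_vector_derivative f' x) (at x)" "diff_times (Suc n) f'"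
    by (auto simp del: diff_times.simps(2) simp: diff_times.simps(2)[of "Suc n"])
  then show ?case using Suc.IH[OF f'(2)] by auto
qed simp

lemma diff_times_add: "diff_times n f \<Longrightarrow> diff_times n g \<Longrightarrow> diff_times n (\<lambda>x. f x + g x)"
proof (induction n arbitrary: f g)
  case (Suc n)
  then obtain f' g' where "\<forall>x. (f has_vector_derivative f' x) (at x)" "diff_times n f'"
    "\<forall>x. (g has_vector_derivative g' x) (at x)" "diff_times n g'" by auto
  then show ?case using Suc.IH[of f' g']
    by (intro diff_times_SucI[where f' = "\<lambda>x. f' x + g' x"]) (auto intro!: derivative_intros)
qed simp

lemma diff_times_mult: "diff_times n f \<Longrightarrow> diff_times n g \<Longrightarrow> diff_times n (\<lambda>x. f x * g x)"
proof (induction n arbitrary: f g)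
  case (Suc n)
  then obtain f' g' where fg: "\<forall>x. (f has_vector_derivative f' x) (at x)" "diff_times n f'"
    "\<forall>x. (g has_vector_derivative g' x) (at x)" "diff_times n g'" by auto
  have "diff_times n (\<lambda>x. f x * g' x + f' x * g x)"
    using Suc.IH[OF _ fg(4)] Suc.IH[OF fg(2)] Suc.prems[THEN diff_times_SucD] by (intro diff_times_add)
  then show ?case using fg
    by (intro diff_times_SucI[where f' = "\<lambda>x. f x * g' x + f' x * g x"]) (auto intro: has_vector_derivative_mult)
qed simp

lemma diff_times_affine: "diff_times n f \<Longrightarrow> diff_times n (\<lambda>x. f (a + b * x))"
proof (induction n arbitrary: f)
  case (Suc n)
  then obtain f' where f': "\<forall>x. (f has_vector_derivative f' x) (at x)" "diff_times n f'" by auto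
  have const: "diff_times k (\<lambda>x. c)" for k c
    by (induction k arbitrary: c) (auto intro!: exI[of _ "\<lambda>x. 0"] derivative_intros)
  have "((\<lambda>x. f (a + b * x)) has_vector_derivative of_real b * f' (a + b * x)) (at x)" for x
  proof -
    have "((\<lambda>x. a + b * x) has_vector_derivative b) (at x)"
      by (auto intro!: derivative_eq_intros)
    from vector_diff_chain_at[OF this, of f "f' (a + b * x)"] f'(1)
    show ?thesis by (simp add: o_def scaleR_conv_of_real)
  qed
  moreover have "diff_times n (\<lambda>x. of_real b * f' (a + b * x))"
    by (intro diff_times_mult const Suc.IH f')
  ultimately show ?case by (rule diff_times_SucI)
qed simp

lemma diff_times_gp: "diff_times n (gp s P)"
proof (induction n arbitrary: P)
  case (Suc n)
  show ?case by (rule diff_times_SucI[OF gp_has_derivative Suc])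
qed simp

lemma differentiable_iterates:
  assumes "\<And>n. diff_times n f"
  shows "((\<lambda>f y. vector_derivative f (at y)) ^^ k) f differentiable (at x)"
  using assms
proof (induction k arbitrary: f)
  case 0
  obtain f' where "\<forall>x. (f has_vector_derivative f' x) (at x)" using 0[of "Suc 0"] by auto
  then show ?case by (auto intro: differentiableI_vector)
next
  case (Suc k)
  have "diff_times n (\<lambda>y. vector_derivative f (at y))" for n
  proof -
    obtain f' where f': "\<forall>x. (f has_vector_derivative f' x) (at x)" "diff_times n f'"
      using Suc.prems[of "Suc n"] by auto
    then have "(\<lambda>y. vector_derivative f (at y)) = f'"
      using vector_derivative_at by blast
    then show ?thesis using f'(2) by simp
  qed
  then show ?case using Suc.IH by (simp add: funpow_Suc_right del: funpow.simps)
qed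

text \<open>The standard flat function \<open>exp (- 1 / x)\<close>, with a polynomial in
  \<open>1 / x\<close> as extra factor so that the family is closed under differentiation.\<close>

definition flat_fun :: "real poly \<Rightarrow> real \<Rightarrow> real" where
  "flat_fun Q x = (if x > 0 then poly Q (1 / x) * exp (- (1 / x)) else 0)"

lemma flat_fun_tendsto_0: "(flat_fun Q \<longlongrightarrow> 0) (at 0)"
proof -
  have "((\<lambda>y. \<Sum>i\<le>degree Q. coeff Q i * (y ^ i / exp y)) \<longlongrightarrow> (\<Sum>i\<le>degree Q. coeff Q i * 0)) at_top"
    by (intro tendsto_intros tendsto_power_div_exp_0)
  moreover have "(\<Sum>i\<le>degree Q. coeff Q i * (y ^ i / exp y)) = poly Q y * exp (- y)" for y :: real
    by (simp add: poly_altdef sum_distrib_right exp_minus divide_inverse mult.assoc)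
  ultimately have "((\<lambda>y. poly Q y * exp (- y)) \<longlongrightarrow> 0) at_top" by simp
  then have "((\<lambda>x. poly Q (inverse x) * exp (- inverse x)) \<longlongrightarrow> 0) (at_right 0)"
    by (rule filterlim_compose[OF _ filterlim_inverse_at_top_right])
  then have "(flat_fun Q \<longlongrightarrow> 0) (at_right 0)"
    by (rule Lim_transform_eventually)
      (auto simp: flat_fun_def inverse_eq_divide eventually_at_filter)
  moreover have "(flat_fun Q \<longlongrightarrow> 0) (at_left 0)"
    by (rule Lim_transform_eventually[OF tendsto_const]) (auto simp: flat_fun_def eventually_at_filter)
  ultimately show ?thesis by (simp add: filterlim_at_split)
qed

lemma flat_fun_has_derivative:
  "(flat_fun Q has_real_derivative flat_fun ([:0, 0, 1:] * (Q - pderiv Q)) x) (at x)"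
proof -
  consider "x > 0" | "x < 0" | "x = 0" by linarith
  then show ?thesis
  proof cases
    case 1
    have "((\<lambda>x. poly Q (1 / x) * exp (- (1 / x))) has_real_derivative
        flat_fun ([:0, 0, 1:] * (Q - pderiv Q)) x) (at x)"
      using 1 by (auto intro!: derivative_eq_intros DERIV_chain2[OF poly_DERIV] simp: flat_fun_def field_simps power2_eq_square)
    then show ?thesis
      by (rule has_field_derivative_transform_within_open[of _ _ _ "{0<..}"]) (use 1 in \<open>auto simp: flat_fun_def\<close>)
  next
    case 2
    have "((\<lambda>x. 0) has_real_derivative 0) (at x)" by simp
    then have "(flat_fun Q has_real_derivative 0) (at x)"
      by (rule has_field_derivative_transform_within_open[of _ _ _ "{..<0}"]) (use 2 in \<open>auto simp: flat_fun_def\<close>)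
    then show ?thesis using 2 by (simp add: flat_fun_def)
  next
    case 3
    \<comment> \<open>At the origin the difference quotient is itself a flat function, for the
      polynomial multiplied by its variable.\<close>
    have "((\<lambda>h. (flat_fun Q (0 + h) - flat_fun Q 0) / h) \<longlongrightarrow> 0) (at 0)"
      by (rule Lim_transform_eventually[OF flat_fun_tendsto_0[of "[:0, 1:] * Q"]])
        (auto simp: flat_fun_def eventually_at_filter)
    then show ?thesis using 3 by (simp add: DERIV_def flat_fun_def)
  qed
qed

definition bump :: "real \<Rightarrow> complex" where
  "bump x = of_real (flat_fun 1 (1 + x)) * of_real (flat_fun 1 (1 - x))"

lemma diff_times_bump: "diff_times n bump"
proof -
  have flat_fun: "diff_times n (\<lambda>x. of_real (flat_fun Q x))" for Q
  proof (induction n arbitrary: Q)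
    case (Suc n)
    show ?case
      by (rule diff_times_SucI[OF _ Suc[of "[:0, 0, 1:] * (Q - pderiv Q)"]])
        (rule has_vector_derivative_of_real, rule flat_fun_has_derivative)
  qed simp
  have "diff_times n (\<lambda>x. of_real (flat_fun 1 (1 + 1 * x)) * of_real (flat_fun 1 (1 + (-1) * x)))"
    by (intro diff_times_mult diff_times_affine[of n "\<lambda>x. of_real (flat_fun 1 x)"] flat_fun)
  then show ?thesis by (simp add: bump_def[abs_def])
qed

lemma bump_support: "\<bar>x\<bar> > 1 \<Longrightarrow> bump x = 0"
  by (auto simp: bump_def flat_fun_def)

lemma bump_0: "bump 0 \<noteq> 0"
  by (simp add: bump_def flat_fun_def)

section \<open>Test functions and the transposed operator\<close>

lemma test_functionI:
  assumes "\<And>n. diff_times n f" "\<And>x. R < \<bar>x\<bar> \<Longrightarrow> f x = 0"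
  shows "test_function f"
  using assms differentiable_iterates unfolding test_function_def by blast

lemma test_functionE:
  assumes "test_function \<phi>"
  obtains \<phi>1 \<phi>2 R where "\<And>x. (\<phi> has_vector_derivative \<phi>1 x) (at x)" "\<And>x. (\<phi>1 has_vector_derivative \<phi>2 x) (at x)"
    "continuous_on UNIV \<phi>" "continuous_on UNIV \<phi>1" "continuous_on UNIV \<phi>2"
    "\<And>x. R < \<bar>x\<bar> \<Longrightarrow> \<phi> x = 0 \<and> \<phi>1 x = 0 \<and> \<phi>2 x = 0"
proof -
  let ?D = "\<lambda>f y. vector_derivative f (at y)"
  define \<phi>1 where "\<phi>1 = ?D \<phi>"
  define \<phi>2 where "\<phi>2 = ?D \<phi>1"
  have d: "(?D ^^ k) \<phi> differentiable at x" for k x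
    using assms by (simp add: test_function_def)
  have d0: "\<phi> differentiable at x" for x using d[of 0 x] by simp
  have d1: "\<phi>1 differentiable at x" for x using d[of 1 x] by (simp add: \<phi>1_def)
  have d2: "\<phi>2 differentiable at x" for x using d[of 2 x] by (simp add: \<phi>1_def \<phi>2_def numeral_2_eq_2)
  obtain R where R: "\<And>x. R < \<bar>x\<bar> \<Longrightarrow> \<phi> x = 0"
    using assms by (auto simp: test_function_def)
  have loc: "f' x = 0" if "\<And>x. (f has_vector_derivative f' x) (at x)" "\<And>x. R < \<bar>x\<bar> \<Longrightarrow> f x = 0" "R < \<bar>x\<bar>"
    for f f' :: "real \<Rightarrow> complex" and x
  proof -
    have "open {x::real. R < \<bar>x\<bar>}" by (intro open_Collect_less continuous_intros)
    then have "((\<lambda>x. 0) has_vector_derivative f' x) (at x)"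
      using has_vector_derivative_transform_within_open[OF that(1), of "{x. R < \<bar>x\<bar>}" x "\<lambda>x. 0"] that(2,3) by auto
    then show ?thesis using vector_derivative_unique_at has_vector_derivative_const by blast
  qed
  have h1: "(\<phi> has_vector_derivative \<phi>1 x) (at x)" for x
    using d0[of x] by (simp add: \<phi>1_def vector_derivative_works)
  have h2: "(\<phi>1 has_vector_derivative \<phi>2 x) (at x)" for x
    using d1[of x] by (simp add: \<phi>2_def vector_derivative_works)
  show ?thesis
  proof (rule that[OF h1 h2])
    show "continuous_on UNIV \<phi>" "continuous_on UNIV \<phi>1" "continuous_on UNIV \<phi>2"
      using d0 d1 d2 by (auto intro: differentiable_imp_continuous_on simp: differentiable_on_def)
    show "\<phi> x = 0 \<and> \<phi>1 x = 0 \<and> \<phi>2 x = 0" if "R < \<bar>x\<bar>" for x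
      using R loc[OF h1 R] loc[OF h2 loc[OF h1 R]] that by blast
  qed
qed

lemma compact_support_integrable:
  fixes f :: "real \<Rightarrow> complex"
  assumes "continuous_on UNIV f" "\<And>x. R < \<bar>x\<bar> \<Longrightarrow> f x = 0"
  shows "integrable lborel f" "sq_integrable f" "(f \<longlongrightarrow> 0) at_top" "(f \<longlongrightarrow> 0) at_bot"
proof -
  have int: "integrable lborel g" if "continuous_on UNIV g" "\<And>x. R < \<bar>x\<bar> \<Longrightarrow> g x = 0"
    for g :: "real \<Rightarrow> 'a :: {banach, second_countable_topology}"
  proof -
    have "integrable lborel (\<lambda>x. indicator {- R..R} x *\<^sub>R g x)"
      by (rule borel_integrable_compact[OF compact_Icc continuous_on_subset[OF that(1)]]) simp
    also have "(\<lambda>x. indicator {- R..R} x *\<^sub>R g x) = g"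
      using that(2) by (fastforce simp: indicator_def)
    finally show ?thesis .
  qed
  show "integrable lborel f" using assms by (rule int)
  have "integrable lborel (\<lambda>x. (cmod (f x))\<^sup>2)"
    using assms by (intro int continuous_intros) auto
  then show "sq_integrable f"
    using borel_measurable_continuous_onI[OF assms(1)] by (simp add: sq_integrable_def)
  have "\<forall>\<^sub>F x in at_top. 0 = f x"
    using assms(2) unfolding eventually_at_top_dense by (intro exI[of _ "\<bar>R\<bar>"]) auto
  moreover have "\<forall>\<^sub>F x in at_bot. 0 = f x"
    using assms(2) unfolding eventually_at_bot_dense by (intro exI[of _ "- \<bar>R\<bar>"]) auto
  ultimately show "(f \<longlongrightarrow> 0) at_top" "(f \<longlongrightarrow> 0) at_bot"
    by (auto intro: Lim_transform_eventually[OF tendsto_const])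
qed

lemma of_L2_eq_pairing:
  assumes "sq_integrable f" shows "of_L2 u f = pairing u (abs_L2 f)"
proof -
  have "pairing (abs_L2 (rep_L2 u)) (abs_L2 f) = (\<integral>x. rep_L2 u x * f x \<partial>lborel)"
    using sq_integrable_rep assms by (intro pairing.abs_eq) auto
  then show ?thesis by (simp add: of_L2_def abs_rep_L2)
qed

text \<open>The roots are chosen so that \<open>\<xi> - 2 \<i> s x\<close>, quantized, annihilates
  \<open>exp (- s x^2)\<close>, while the transpose of the other factor annihilates
  \<open>exp (- t x^2)\<close>.\<close>

definition gauss_form :: "complex \<Rightarrow> complex \<Rightarrow> complex \<Rightarrow> quadratic_form" where
  "gauss_form k s t = factored_form k (2 * \<i> * s) (- 2 * \<i> * t)"

text \<open>\<open>dual_ham s t f f' f''\<close> is the transpose of the operator with symbol \<open>gauss_form 1 s t\<close>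
  applied to \<open>f\<close>.\<close>

definition dual_ham :: "complex \<Rightarrow> complex \<Rightarrow> (real \<Rightarrow> complex) \<Rightarrow> (real \<Rightarrow> complex)
    \<Rightarrow> (real \<Rightarrow> complex) \<Rightarrow> real \<Rightarrow> complex" where
  "dual_ham s t f f1 f2 x = - f2 x + (s - t) * (f x + 2 * of_real x * f1 x) + 4 * s * t * (of_real x)\<^sup>2 * f x"

lemma weyl_dist_gauss_form:
  assumes d: "\<And>x. (\<phi> has_vector_derivative \<phi>1 x) (at x)" "\<And>x. (\<phi>1 has_vector_derivative \<phi>2 x) (at x)"
    and c: "continuous_on UNIV \<phi>" "continuous_on UNIV \<phi>1" "continuous_on UNIV \<phi>2"
    and R: "\<And>x. R < \<bar>x\<bar> \<Longrightarrow> \<phi> x = 0 \<and> \<phi>1 x = 0 \<and> \<phi>2 x = 0"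
  shows "weyl_dist (gauss_form k s t) (of_L2 u) \<phi> = k * of_L2 u (dual_ham s t \<phi> \<phi>1 \<phi>2)"
proof -
  note [continuous_intros] = c
  have i: "integrable lborel (\<lambda>x. rep_L2 u x * f x)" if "continuous_on UNIV f" "\<And>x. R < \<bar>x\<bar> \<Longrightarrow> f x = 0" for f
    using compact_support_integrable(2)[OF that] by (intro integrable_mult_L2 sq_integrable_rep)
  have v1: "(\<lambda>x. - \<i> * vector_derivative \<phi> (at x)) = (\<lambda>x. - \<i> * \<phi>1 x)"
    by (auto simp: vector_derivative_at[OF d(1)])
  have v2: "(\<lambda>x. - \<i> * vector_derivative (\<lambda>x. of_real x * \<phi> x) (at x)) = (\<lambda>x. - \<i> * (\<phi> x + of_real x * \<phi>1 x))"
  proof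
    fix x
    have "((\<lambda>x. of_real x * \<phi> x) has_vector_derivative (of_real x * \<phi>1 x + 1 * \<phi> x)) (at x)"
      by (intro has_vector_derivative_mult d)
        (use has_vector_derivative_of_real[OF DERIV_ident] in simp)
    then show "- \<i> * vector_derivative (\<lambda>x. of_real x * \<phi> x) (at x) = - \<i> * (\<phi> x + of_real x * \<phi>1 x)"
      by (simp add: vector_derivative_at add.commute)
  qed
  have v3: "(\<lambda>x. - \<i> * vector_derivative (\<lambda>x. - \<i> * \<phi>1 x) (at x)) = (\<lambda>x. - \<phi>2 x)"
  proof
    fix x
    have "((\<lambda>x. - \<i> * \<phi>1 x) has_vector_derivative - \<i> * \<phi>2 x) (at x)"
      by (intro derivative_intros d)
    from vector_derivative_at[OF this] show "- \<i> * vector_derivative (\<lambda>x. - \<i> * \<phi>1 x) (at x) = - \<phi>2 x"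
      by simp
  qed
  let ?T = "of_L2 u"
  have lin: "?T (\<lambda>x. a * f x) = a * ?T f" for a f
    by (simp add: of_L2_def mult.left_commute)
  have add: "?T f + ?T g = ?T (\<lambda>x. f x + g x)"
    if "continuous_on UNIV f" "\<And>x. R < \<bar>x\<bar> \<Longrightarrow> f x = 0" "continuous_on UNIV g" "\<And>x. R < \<bar>x\<bar> \<Longrightarrow> g x = 0" for f g
    using i[OF that(1,2)] i[OF that(3,4)] by (simp add: of_L2_def distrib_left)
  \<comment> \<open>Operators acting on a distribution reach the test function in reverse order:
    \<open>B\<close> belongs to \<open>x D_x\<close> and \<open>C\<close> to
    \<open>D_x x\<close>.\<close>
  define A B C D where "A x = of_real x * (of_real x * \<phi> x)" and "B x = \<phi> x + of_real x * \<phi>1 x"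
    and "C x = of_real x * \<phi>1 x" and "D x = - \<phi>2 x" for x
  have "weyl_dist (gauss_form k s t) ?T \<phi> = k * (2 * \<i> * s) * (- 2 * \<i> * t) * ?T A
      + (- k * (2 * \<i> * s + - 2 * \<i> * t)) / 2 * (\<i> * ?T B + \<i> * ?T C) + k * ?T D"
  proof -
    have "mult_x (D_x ?T) \<phi> = \<i> * ?T B"
      unfolding mult_x_def D_x_def v2 using lin[of "- \<i>" B] by (simp add: B_def)
    moreover have "D_x (mult_x ?T) \<phi> = \<i> * ?T C"
      unfolding mult_x_def D_x_def vector_derivative_at[OF d(1)]
      using lin[of "- \<i>" C] by (simp add: C_def mult.left_commute)
    moreover have "D_x (D_x ?T) \<phi> = ?T D"
      unfolding D_x_def v1 v3 D_def by simp
    moreover have "mult_x (mult_x ?T) \<phi> = ?T A"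
      by (simp add: mult_x_def A_def[abs_def])
    ultimately show ?thesis
      by (simp only: weyl_dist_def gauss_form_def factored_form_def quadratic_form.sel)
  qed
  also have "\<dots> = ?T (\<lambda>x. (4 * s * t * k) * A x) + (?T (\<lambda>x. ((s - t) * k) * B x) + (?T (\<lambda>x. ((s - t) * k) * C x) + ?T (\<lambda>x. k * D x)))"
  proof -
    have "(- k * (2 * \<i> * s + - 2 * \<i> * t)) / 2 = - (\<i> * ((s - t) * k))"
      by (simp add: field_simps)
    note eq = this
    show ?thesis unfolding lin eq by (simp add: algebra_simps)
  qed
  also have "\<dots> = ?T (\<lambda>x. 4 * s * t * k * A x + ((s - t) * k * B x + ((s - t) * k * C x + k * D x)))"
    unfolding A_def B_def C_def D_def
    by (subst add, (auto intro!: continuous_intros simp: R)[4])+ (rule refl)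
  also have "\<dots> = ?T (\<lambda>x. k * dual_ham s t \<phi> \<phi>1 \<phi>2 x)"
    by (rule arg_cong[where f = ?T], rule ext)
      (simp add: A_def B_def C_def D_def dual_ham_def power2_eq_square algebra_simps)
  finally show ?thesis by (simp only: lin)
qed

lemma dual_ham_compact_support:
  assumes c: "continuous_on UNIV \<phi>" "continuous_on UNIV \<phi>1" "continuous_on UNIV \<phi>2"
    and R: "\<And>x. R < \<bar>x\<bar> \<Longrightarrow> \<phi> x = 0 \<and> \<phi>1 x = 0 \<and> \<phi>2 x = 0"
  shows "sq_integrable (dual_ham s t \<phi> \<phi>1 \<phi>2)"
proof (rule compact_support_integrable)
  show "continuous_on UNIV (dual_ham s t \<phi> \<phi>1 \<phi>2)"
    unfolding dual_ham_def by (intro continuous_intros c)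
  show "dual_ham s t \<phi> \<phi>1 \<phi>2 x = 0" if "R < \<bar>x\<bar>" for x
    using R[OF that] by (simp add: dual_ham_def)
qed

text \<open>For each fixed test function, membership in the graph equates two pairings that are
  continuous in the two components, so it passes to limits.\<close>

lemma weyl_gauss_form_closed:
  assumes uv: "\<And>n. (u n, v n) \<in> weyl (gauss_form k s t)" and lim: "u \<longlonglongrightarrow> u0" "v \<longlonglongrightarrow> v0"
  shows "(u0, v0) \<in> weyl (gauss_form k s t)"
  unfolding weyl_def
proof (safe)
  fix \<phi> assume t: "test_function \<phi>"
  then obtain \<phi>1 \<phi>2 R where \<phi>: "\<And>x. (\<phi> has_vector_derivative \<phi>1 x) (at x)" "\<And>x. (\<phi>1 has_vector_derivative \<phi>2 x) (at x)"
    "continuous_on UNIV \<phi>" "continuous_on UNIV \<phi>1" "continuous_on UNIV \<phi>2"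
    "\<And>x. R < \<bar>x\<bar> \<Longrightarrow> \<phi> x = 0 \<and> \<phi>1 x = 0 \<and> \<phi>2 x = 0"
    by (rule test_functionE) blast
  have sq: "sq_integrable \<phi>" "sq_integrable (dual_ham s t \<phi> \<phi>1 \<phi>2)"
    using compact_support_integrable(2)[OF \<phi>(3)] \<phi>(6) dual_ham_compact_support[OF \<phi>(3-6)] by blast+
  note W = weyl_dist_gauss_form[OF \<phi>, where k = k and s = s and t = t]
  note lin = bounded_linear.tendsto[OF bounded_linear_pairing]
  have "k * pairing (u n) (abs_L2 (dual_ham s t \<phi> \<phi>1 \<phi>2)) = pairing (v n) (abs_L2 \<phi>)" for n
    using uv[of n] t W[where u = "u n"] by (simp add: weyl_def of_L2_eq_pairing sq)
  moreover have "(\<lambda>n. k * pairing (u n) (abs_L2 (dual_ham s t \<phi> \<phi>1 \<phi>2)))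
      \<longlonglongrightarrow> k * pairing u0 (abs_L2 (dual_ham s t \<phi> \<phi>1 \<phi>2))"
    by (intro tendsto_mult_left lin lim)
  moreover have "(\<lambda>n. pairing (v n) (abs_L2 \<phi>)) \<longlonglongrightarrow> pairing v0 (abs_L2 \<phi>)"
    by (intro lin lim)
  ultimately have "k * pairing u0 (abs_L2 (dual_ham s t \<phi> \<phi>1 \<phi>2)) = pairing v0 (abs_L2 \<phi>)"
    by (simp add: LIMSEQ_unique)
  then show "weyl_dist (gauss_form k s t) (of_L2 u0) \<phi> = of_L2 v0 \<phi>"
    by (simp add: W of_L2_eq_pairing sq)
qed

text \<open>Transposition exchanges \<open>s\<close> and \<open>t\<close>, and \<open>ham\<close>
  depends on their sum only; hence the same polynomial operator describes both sides.\<close>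

lemma dual_ham_gp:
  "dual_ham s t (gp t Q) (gp t (gp_deriv t Q)) (gp t (gp_deriv t (gp_deriv t Q))) = gp t (ham (s + t) Q)"
proof (rule ext)
  fix x
  have "ham (s + t) Q = - gp_deriv t (gp_deriv t Q) + smult (2 * (s - t)) ([:0, 1:] * gp_deriv t Q)
      + smult (s - t) Q + smult (4 * s * t) ([:0, 1:] * ([:0, 1:] * Q))"
    unfolding poly_eq_poly_eq_iff[symmetric]
    by (rule ext) (simp add: ham_def gp_deriv_def raise_def pderiv_diff pderiv_mult pderiv_pCons
        pderiv_smult algebra_simps)
  note ham = this
  show "dual_ham s t (gp t Q) (gp t (gp_deriv t Q)) (gp t (gp_deriv t (gp_deriv t Q))) x = gp t (ham (s + t) Q) x"
    unfolding ham by (simp add: dual_ham_def gp_def power2_eq_square algebra_simps)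
qed

text \<open>Green's identity: the two sides of the weak equation differ by the integral of a
  derivative of a compactly supported function.\<close>

lemma gp_L2_in_weyl:
  assumes s: "Re s > 0"
  shows "(gp_L2 s P, k *\<^sub>C gp_L2 s (ham (s + t) P)) \<in> weyl (gauss_form k s t)"
  unfolding weyl_def
proof (safe)
  fix \<phi> assume tst: "test_function \<phi>"
  then obtain \<phi>1 \<phi>2 R where \<phi>: "\<And>x. (\<phi> has_vector_derivative \<phi>1 x) (at x)" "\<And>x. (\<phi>1 has_vector_derivative \<phi>2 x) (at x)"
    "continuous_on UNIV \<phi>" "continuous_on UNIV \<phi>1" "continuous_on UNIV \<phi>2"
    "\<And>x. R < \<bar>x\<bar> \<Longrightarrow> \<phi> x = 0 \<and> \<phi>1 x = 0 \<and> \<phi>2 x = 0"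
    by (rule test_functionE) blast
  note [continuous_intros] = \<phi>(3-5)
  have sq: "sq_integrable \<phi>" "sq_integrable (dual_ham s t \<phi> \<phi>1 \<phi>2)"
    using compact_support_integrable(2)[OF \<phi>(3)] \<phi>(6) dual_ham_compact_support[OF \<phi>(3-6)] by blast+
  define f f1 f2 where "f = gp s P" and "f1 = gp s (gp_deriv s P)" and "f2 = gp s (gp_deriv s (gp_deriv s P))"
  have df: "(f has_vector_derivative f1 x) (at x)" "(f1 has_vector_derivative f2 x) (at x)" for x
    by (auto simp: f_def f1_def f2_def intro: gp_has_derivative)
  have cf: "continuous_on A f" "continuous_on A f1" "continuous_on A f2" for A
    by (auto simp: f_def f1_def f2_def intro: gp_continuous)
  note [continuous_intros] = cf
  have ham: "gp s (ham (s + t) P) x = - f2 x - 2 * (s - t) * (of_real x * f1 x) - (s - t) * f x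
        + 4 * s * t * (of_real x)\<^sup>2 * f x" for x
    using fun_cong[OF dual_ham_gp[of t s P], of x]
    by (simp add: dual_ham_def f_def f1_def f2_def algebra_simps)
  \<comment> \<open>The boundary term of two integrations by parts, namely the Wronskian plus the
    contribution of the first-order part.\<close>
  define G where "G x = f1 x * \<phi> x - f x * \<phi>1 x + 2 * (s - t) * (of_real x * (f x * \<phi> x))" for x
  have D: "f x * dual_ham s t \<phi> \<phi>1 \<phi>2 x - gp s (ham (s + t) P) x * \<phi> x
      = f2 x * \<phi> x - f x * \<phi>2 x + 2 * (s - t) * (f x * \<phi> x + of_real x * (f1 x * \<phi> x + f x * \<phi>1 x))" for x
    unfolding ham dual_ham_def by (simp add: algebra_simps)
  have "(\<integral>x. f x * dual_ham s t \<phi> \<phi>1 \<phi>2 x - gp s (ham (s + t) P) x * \<phi> x \<partial>lborel) = 0"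
  proof (rule integral_derivative_eq_0[where F = G])
    show "(G has_vector_derivative f x * dual_ham s t \<phi> \<phi>1 \<phi>2 x - gp s (ham (s + t) P) x * \<phi> x) (at x)" for x
    proof -
      have r: "((\<lambda>x. of_real x) has_vector_derivative (1::complex)) (at x)"
        using has_vector_derivative_of_real[OF DERIV_ident, of "at x"] by simp
      have "(G has_vector_derivative (f1 x * \<phi>1 x + f2 x * \<phi> x) - (f x * \<phi>2 x + f1 x * \<phi>1 x)
          + 2 * (s - t) * (of_real x * (f x * \<phi>1 x + f1 x * \<phi> x) + 1 * (f x * \<phi> x))) (at x)"
        unfolding G_def
        by (intro has_vector_derivative_add has_vector_derivative_diff has_vector_derivative_mult
            has_vector_derivative_mult_right df \<phi> r)
      then show ?thesis unfolding D by (simp add: algebra_simps)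
    qed
    show "continuous_on UNIV (\<lambda>x. f x * dual_ham s t \<phi> \<phi>1 \<phi>2 x - gp s (ham (s + t) P) x * \<phi> x)"
      unfolding D by (intro continuous_intros)
    then show "integrable lborel (\<lambda>x. f x * dual_ham s t \<phi> \<phi>1 \<phi>2 x - gp s (ham (s + t) P) x * \<phi> x)"
      by (rule compact_support_integrable(1)[of _ R]) (use \<phi>(6) in \<open>simp add: dual_ham_def\<close>)
    have "continuous_on UNIV G" unfolding G_def by (intro continuous_intros)
    moreover have "G x = 0" if "R < \<bar>x\<bar>" for x using \<phi>(6)[OF that] by (simp add: G_def)
    ultimately show "(G \<longlongrightarrow> 0) at_top" "(G \<longlongrightarrow> 0) at_bot"
      using compact_support_integrable(3,4)[of G R] by blast+
  qed
  then have "(\<integral>x. f x * dual_ham s t \<phi> \<phi>1 \<phi>2 x \<partial>lborel) = (\<integral>x. gp s (ham (s + t) P) x * \<phi> x \<partial>lborel)"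
    unfolding f_def by (simp add: integrable_mult_L2 sq sq_integrable_gp[OF s])
  moreover have "pairing (gp_L2 s P) (abs_L2 (dual_ham s t \<phi> \<phi>1 \<phi>2)) = (\<integral>x. f x * dual_ham s t \<phi> \<phi>1 \<phi>2 x \<partial>lborel)"
    unfolding gp_L2_def f_def using sq sq_integrable_gp[OF s] by (intro pairing.abs_eq) auto
  moreover have "pairing (gp_L2 s (ham (s + t) P)) (abs_L2 \<phi>) = (\<integral>x. gp s (ham (s + t) P) x * \<phi> x \<partial>lborel)"
    unfolding gp_L2_def using sq sq_integrable_gp[OF s] by (intro pairing.abs_eq) auto
  ultimately show "weyl_dist (gauss_form k s t) (of_L2 (gp_L2 s P)) \<phi> = of_L2 (k *\<^sub>C gp_L2 s (ham (s + t) P)) \<phi>"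
    by (simp add: weyl_dist_gauss_form[OF \<phi>] of_L2_eq_pairing sq pairing_scaleC)
qed

text \<open>Testing with \<open>bump (x / n) * gp t Q x\<close> and letting \<open>n\<close> tend to infinity extends the weak
  formulation to the test functions \<open>gp t Q\<close>.\<close>

lemma weyl_pairing_gp_L2:
  assumes uv: "(u, v) \<in> weyl (gauss_form k s t)" and t: "Re t > 0"
  shows "pairing v (gp_L2 t Q) = k * pairing u (gp_L2 t (ham (s + t) Q))"
proof -
  obtain b1 b2 R where b: "\<And>x. (bump has_vector_derivative b1 x) (at x)" "\<And>x. (b1 has_vector_derivative b2 x) (at x)"
    "continuous_on UNIV bump" "continuous_on UNIV b1" "continuous_on UNIV b2"
    "\<And>x. R < \<bar>x\<bar> \<Longrightarrow> bump x = 0 \<and> b1 x = 0 \<and> b2 x = 0"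
    using test_functionE[OF test_functionI[OF diff_times_bump bump_support]] by blast
  have bounded: "\<exists>M\<ge>0. \<forall>x. cmod (f x) \<le> M" if "continuous_on UNIV f" "\<And>x. R < \<bar>x\<bar> \<Longrightarrow> f x = 0" for f :: "real \<Rightarrow> complex"
  proof -
    have "compact (f ` {- R..R})"
      by (intro compact_continuous_image continuous_on_subset[OF that(1)]) auto
    then obtain M where M: "\<And>x. x \<in> {- R..R} \<Longrightarrow> cmod (f x) \<le> M"
      by (meson bounded_iff compact_imp_bounded image_eqI)
    have "cmod (f x) \<le> \<bar>M\<bar>" for x
      using M[of x] that(2)[of x] by (cases "\<bar>x\<bar> \<le> R") (auto simp: abs_le_iff)
    then show ?thesis by (intro exI[of _ "\<bar>M\<bar>"]) auto
  qed
  have "\<exists>M0\<ge>0. \<forall>x. cmod (bump x) \<le> M0" "\<exists>M1\<ge>0. \<forall>x. cmod (b1 x) \<le> M1" "\<exists>M2\<ge>0. \<forall>x. cmod (b2 x) \<le> M2"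
    using b(3-6) by (auto intro!: bounded)
  then obtain M where M: "M \<ge> 0" "\<And>x. cmod (bump x) \<le> M" "\<And>x. cmod (b1 x) \<le> M" "\<And>x. cmod (b2 x) \<le> M"
    by (metis (no_types) linorder_linear order_trans)
  define g g1 g2 where "g = gp t Q" and "g1 = gp t (gp_deriv t Q)" and "g2 = gp t (gp_deriv t (gp_deriv t Q))"
  define xg where "xg = gp t ([:0, 1:] * Q)"
  have dg: "(g has_vector_derivative g1 x) (at x)" "(g1 has_vector_derivative g2 x) (at x)" for x
    by (auto simp: g_def g1_def g2_def intro: gp_has_derivative)
  have cg: "continuous_on A g" "continuous_on A g1" "continuous_on A g2" for A
    by (auto simp: g_def g1_def g2_def intro: gp_continuous)
  have sqg: "sq_integrable g" "sq_integrable g1" "sq_integrable (gp t P)" "sq_integrable xg" for P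
    using t by (auto simp: g_def g1_def xg_def intro: sq_integrable_gp)
  \<comment> \<open>Scales in the interval from 0 to 1: the bound \<open>r n \<le> 1\<close> lets
    one integrable function dominate the error terms for all \<open>n\<close>.\<close>
  define r where "r n = inverse (real (Suc n))" for n
  have r: "r n > 0" "r n \<le> 1" for n by (auto simp: r_def inverse_eq_divide)
  have rlim: "r \<longlonglongrightarrow> 0" unfolding r_def[abs_def] by (rule LIMSEQ_inverse_real_of_nat)
  define \<phi> where "\<phi> n x = bump (r n * x) * g x" for n x
  define \<phi>1 where "\<phi>1 n x = bump (r n * x) * g1 x + of_real (r n) * b1 (r n * x) * g x" for n x
  define \<phi>2 where "\<phi>2 n x = bump (r n * x) * g2 x + 2 * (of_real (r n) * b1 (r n * x) * g1 x)
    + of_real (r n) * of_real (r n) * b2 (r n * x) * g x" for n x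
  have scale: "((\<lambda>x. f (r n * x)) has_vector_derivative of_real (r n) * f' (r n * x)) (at x)"
    if "\<And>x. (f has_vector_derivative f' x) (at x)" for f f' n x
  proof -
    have "((\<lambda>x. r n * x) has_vector_derivative r n) (at x)"
      by (auto intro!: derivative_eq_intros)
    from vector_diff_chain_at[OF this, of f "f' (r n * x)"] that
    show ?thesis by (simp add: o_def scaleR_conv_of_real)
  qed
  have d\<phi>: "(\<phi> n has_vector_derivative \<phi>1 n x) (at x)" for n x
    unfolding \<phi>_def \<phi>1_def
    by (intro has_vector_derivative_mult scale b dg)
  have d\<phi>1: "(\<phi>1 n has_vector_derivative \<phi>2 n x) (at x)" for n x
  proof -
    have "(\<phi>1 n has_vector_derivative (bump (r n * x) * g2 x + of_real (r n) * b1 (r n * x) * g1 x)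
       + (of_real (r n) * b1 (r n * x) * g1 x + (of_real (r n) * (of_real (r n) * b2 (r n * x))) * g x)) (at x)"
      unfolding \<phi>1_def
      by (intro has_vector_derivative_add has_vector_derivative_mult has_vector_derivative_mult_right scale b dg)
    then show ?thesis by (simp add: \<phi>2_def algebra_simps)
  qed
  have cb: "continuous_on UNIV (\<lambda>x. f (r n * x))" if "continuous_on UNIV f" for f :: "real \<Rightarrow> complex" and n
    by (rule continuous_on_compose2[OF that]) (auto intro!: continuous_intros)
  have c\<phi>: "continuous_on UNIV (\<phi> n)" "continuous_on UNIV (\<phi>1 n)" "continuous_on UNIV (\<phi>2 n)" for n
    unfolding \<phi>_def \<phi>1_def \<phi>2_def by (intro continuous_intros cb b cg)+
  have supp: "\<phi> n x = 0 \<and> \<phi>1 n x = 0 \<and> \<phi>2 n x = 0" if "\<bar>R\<bar> / r n < \<bar>x\<bar>" for n x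
  proof -
    have "R < \<bar>r n * x\<bar>" using that r(1)[of n] by (simp add: abs_mult field_simps)
    then show ?thesis using b(6) by (simp add: \<phi>_def \<phi>1_def \<phi>2_def)
  qed
  have test: "test_function (\<phi> n)" for n
  proof (rule test_functionI)
    show "diff_times m (\<phi> n)" for m
      unfolding \<phi>_def g_def using diff_times_affine[OF diff_times_bump, of m 0 "r n"]
      by (intro diff_times_mult diff_times_gp) simp
    show "\<phi> n x = 0" if "\<bar>R\<bar> / r n < \<bar>x\<bar>" for x using supp[OF that] by simp
  qed
  define L where "L n = dual_ham s t (\<phi> n) (\<phi>1 n) (\<phi>2 n)" for n
  have main: "k * of_L2 u (L n) = of_L2 v (\<phi> n)" for n
  proof -
    have "weyl_dist (gauss_form k s t) (of_L2 u) (\<phi> n) = k * of_L2 u (L n)"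
      unfolding L_def by (rule weyl_dist_gauss_form[OF d\<phi> d\<phi>1 c\<phi> supp])
    then show ?thesis using uv test[of n] by (simp add: weyl_def)
  qed
  \<comment> \<open>By the Leibniz rule every term besides the main one has a derivative on the
    cutoff, hence a factor \<open>r n\<close>, and disappears in the limit.\<close>
  have L_eq: "L n x = bump (r n * x) * gp t (ham (s + t) Q) x
     + of_real (r n) * (2 * (s - t) * (b1 (r n * x) * xg x) - 2 * (b1 (r n * x) * g1 x) - of_real (r n) * (b2 (r n * x) * g x))" for n x
  proof -
    have xg: "xg x = of_real x * g x" by (simp add: xg_def g_def gp_def)
    have h: "gp t (ham (s + t) Q) x = - g2 x + (s - t) * (g x + 2 * of_real x * g1 x) + 4 * s * t * (of_real x)\<^sup>2 * g x"
      unfolding dual_ham_gp[symmetric] dual_ham_def g_def g1_def g2_def ..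
    show ?thesis
      unfolding L_def dual_ham_def \<phi>_def \<phi>1_def \<phi>2_def xg h
      by (simp add: algebra_simps)
  qed
  have rx: "(\<lambda>n. r n * x) \<longlonglongrightarrow> 0" for x
    using tendsto_mult_right[OF rlim, of x] by (simp add: mult.commute)
  have bump_lim: "(\<lambda>n. bump (r n * x)) \<longlonglongrightarrow> bump 0" for x
    using b(3) by (intro isCont_tendsto_compose[OF _ rx]) (simp add: continuous_on_eq_continuous_at)
  have meas: "(\<lambda>x. rep_L2 w x * f x) \<in> borel_measurable lborel" if "sq_integrable f" for w f
    using borel_measurable_times[OF sq_integrableD(1)[OF sq_integrable_rep] sq_integrableD(1)[OF that]] .
  have sqL: "sq_integrable (L n)" and sq\<phi>: "sq_integrable (\<phi> n)" for n
    using dual_ham_compact_support[OF c\<phi> supp] compact_support_integrable(2)[OF c\<phi>(1)] supp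
    unfolding L_def by blast+
  have "(\<lambda>n. of_L2 v (\<phi> n)) \<longlonglongrightarrow> (\<integral>x. rep_L2 v x * (bump 0 * g x) \<partial>lborel)"
    unfolding of_L2_def
  proof (rule integral_dominated_convergence[where w = "\<lambda>x. M * cmod (rep_L2 v x * g x)"])
    show "AE x in lborel. (\<lambda>n. rep_L2 v x * \<phi> n x) \<longlonglongrightarrow> rep_L2 v x * (bump 0 * g x)"
      unfolding \<phi>_def by (intro AE_I2 tendsto_intros bump_lim)
    show "AE x in lborel. norm (rep_L2 v x * \<phi> n x) \<le> M * cmod (rep_L2 v x * g x)" for n
    proof (rule AE_I2)
      fix x
      have "cmod (bump (r n * x)) * cmod (rep_L2 v x * g x) \<le> M * cmod (rep_L2 v x * g x)"
        by (intro mult_right_mono M) auto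
      then show "norm (rep_L2 v x * \<phi> n x) \<le> M * cmod (rep_L2 v x * g x)"
        by (simp add: \<phi>_def norm_mult mult_ac)
    qed
    show "integrable lborel (\<lambda>x. M * cmod (rep_L2 v x * g x))"
      by (intro integrable_mult_right integrable_norm integrable_mult_L2 sq_integrable_rep sqg)
  qed (use meas sqg sq\<phi> sq_integrable_mult in auto)
  moreover have "(\<lambda>n. of_L2 u (L n)) \<longlonglongrightarrow> (\<integral>x. rep_L2 u x * (bump 0 * gp t (ham (s + t) Q) x) \<partial>lborel)"
    unfolding of_L2_def
  proof (rule integral_dominated_convergence[where w = "\<lambda>x. M * cmod (rep_L2 u x * gp t (ham (s + t) Q) x)
      + (2 * cmod (s - t) * M * cmod (rep_L2 u x * xg x) + 2 * M * cmod (rep_L2 u x * g1 x) + M * cmod (rep_L2 u x * g x))"])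
    show "AE x in lborel. (\<lambda>n. rep_L2 u x * L n x) \<longlonglongrightarrow> rep_L2 u x * (bump 0 * gp t (ham (s + t) Q) x)"
    proof (rule AE_I2)
      fix x
      have cr: "(\<lambda>n. of_real (r n)) \<longlonglongrightarrow> (0::complex)"
        using tendsto_of_real[OF rlim, where 'a = complex] by simp
      have bl: "(\<lambda>n. f (r n * x)) \<longlonglongrightarrow> f 0" if "continuous_on UNIV f" for f :: "real \<Rightarrow> complex"
        using that by (intro isCont_tendsto_compose[OF _ rx]) (simp add: continuous_on_eq_continuous_at)
      have "(\<lambda>n. L n x) \<longlonglongrightarrow> bump 0 * gp t (ham (s + t) Q) x
          + 0 * (2 * (s - t) * (b1 0 * xg x) - 2 * (b1 0 * g1 x) - 0 * (b2 0 * g x))"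
        unfolding L_eq by (intro tendsto_intros bl b cr)
      then show "(\<lambda>n. rep_L2 u x * L n x) \<longlonglongrightarrow> rep_L2 u x * (bump 0 * gp t (ham (s + t) Q) x)"
        by (intro tendsto_mult_left) simp
    qed
    show "AE x in lborel. norm (rep_L2 u x * L n x) \<le> M * cmod (rep_L2 u x * gp t (ham (s + t) Q) x)
      + (2 * cmod (s - t) * M * cmod (rep_L2 u x * xg x) + 2 * M * cmod (rep_L2 u x * g1 x) + M * cmod (rep_L2 u x * g x))" for n
    proof (rule AE_I2)
      fix x
      let ?Y = "2 * (s - t) * (b1 (r n * x) * xg x) - 2 * (b1 (r n * x) * g1 x) - of_real (r n) * (b2 (r n * x) * g x)"
      have m: "cmod (c * y) \<le> M * cmod y" if "cmod c \<le> M" for c y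
        unfolding norm_mult using that by (intro mult_right_mono) auto
      have "cmod (of_real (r n) * (b2 (r n * x) * g x)) \<le> 1 * (M * cmod (g x))"
        unfolding norm_mult[of "of_real (r n)"] using r[of n] by (intro mult_mono m M) auto
      moreover have "cmod (2 * (s - t) * (b1 (r n * x) * xg x)) \<le> cmod (2 * (s - t)) * (M * cmod (xg x))"
        unfolding norm_mult[of "2 * (s - t)"] by (intro mult_left_mono m M) auto
      moreover have "cmod (2 * (b1 (r n * x) * g1 x)) \<le> cmod 2 * (M * cmod (g1 x))"
        unfolding norm_mult[of 2] by (intro mult_left_mono m M) auto
      ultimately have Y: "cmod ?Y \<le> 2 * cmod (s - t) * (M * cmod (xg x)) + 2 * (M * cmod (g1 x)) + M * cmod (g x)"
        using norm_triangle_ineq4[of "2 * (s - t) * (b1 (r n * x) * xg x) - 2 * (b1 (r n * x) * g1 x)" "of_real (r n) * (b2 (r n * x) * g x)"]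
          norm_triangle_ineq4[of "2 * (s - t) * (b1 (r n * x) * xg x)" "2 * (b1 (r n * x) * g1 x)"]
        unfolding norm_mult[of 2 "s - t"] norm_numeral by linarith
      have "cmod (of_real (r n) * ?Y) \<le> 1 * cmod ?Y"
        unfolding norm_mult[of "of_real (r n)"] using r[of n] by (intro mult_right_mono) auto
      then have "cmod (L n x) \<le> M * cmod (gp t (ham (s + t) Q) x)
          + (2 * cmod (s - t) * (M * cmod (xg x)) + 2 * (M * cmod (g1 x)) + M * cmod (g x))"
        unfolding L_eq using norm_triangle_ineq[of "bump (r n * x) * gp t (ham (s + t) Q) x" "of_real (r n) * ?Y"]
          m[OF M(2), of "r n * x" "gp t (ham (s + t) Q) x"] Y by linarith
      from mult_left_mono[OF this, of "cmod (rep_L2 u x)"]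
      show "norm (rep_L2 u x * L n x) \<le> M * cmod (rep_L2 u x * gp t (ham (s + t) Q) x)
      + (2 * cmod (s - t) * M * cmod (rep_L2 u x * xg x) + 2 * M * cmod (rep_L2 u x * g1 x) + M * cmod (rep_L2 u x * g x))"
        by (simp add: norm_mult distrib_left mult_ac)
    qed
    show "integrable lborel (\<lambda>x. M * cmod (rep_L2 u x * gp t (ham (s + t) Q) x)
      + (2 * cmod (s - t) * M * cmod (rep_L2 u x * xg x) + 2 * M * cmod (rep_L2 u x * g1 x) + M * cmod (rep_L2 u x * g x)))"
      by (intro Bochner_Integration.integrable_add integrable_mult_right integrable_norm integrable_mult_L2 sq_integrable_rep sqg)
  qed (use meas sqg sqL sq_integrable_mult in auto)
  then have "(\<lambda>n. k * of_L2 u (L n)) \<longlonglongrightarrow> k * (\<integral>x. rep_L2 u x * (bump 0 * gp t (ham (s + t) Q) x) \<partial>lborel)"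
    by (rule tendsto_mult_left)
  ultimately have "k * (\<integral>x. rep_L2 u x * (bump 0 * gp t (ham (s + t) Q) x) \<partial>lborel) = (\<integral>x. rep_L2 v x * (bump 0 * g x) \<partial>lborel)"
    unfolding main using LIMSEQ_unique by blast
  then have "bump 0 * (k * of_L2 u (gp t (ham (s + t) Q))) = bump 0 * of_L2 v g"
    by (simp add: of_L2_def mult.left_commute)
  then have "k * of_L2 u (gp t (ham (s + t) Q)) = of_L2 v g"
    using bump_0 by simp
  then show ?thesis
    by (simp add: gp_L2_def of_L2_eq_pairing[OF sqg(3)] g_def)
qed


section \<open>Resolvent and spectral projections\<close>

text \<open>Multiplication by \<open>x\<close> acts on Hermite polynomials by the three-term recurrence, so it suffices
  to show \<open>S (P * herm g n)\<close> by induction on the coefficients of \<open>P\<close>.\<close>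

lemma herm_span_induct:
  assumes g: "g \<noteq> 0" and herm: "\<And>c n. S (smult c (herm g n))"
    and add: "\<And>P Q. S P \<Longrightarrow> S Q \<Longrightarrow> S (P + Q)" and smult: "\<And>c P. S P \<Longrightarrow> S (smult c P)"
  shows "S P"
proof -
  have X: "[:0, 1:] * herm g n = smult (1 / (2 * g)) (herm g (Suc n)) + smult (of_nat n) (herm g (n - 1))" for n
  proof (cases n)
    case 0
    then show ?thesis using g by (simp add: raise_def one_pCons)
  next
    case (Suc m)
    have "smult (1 / (2 * g)) (herm g (Suc (Suc m)))
        = smult (1 / (2 * g)) ([:0, 2 * g:] * herm g (Suc m)) - smult (of_nat (Suc m)) (herm g m)"
      unfolding herm_rec smult_diff_right using g by simp
    moreover have "smult (1 / (2 * g)) ([:0, 2 * g:] * herm g (Suc m)) = [:0, 1:] * herm g (Suc m)"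
      using g by simp
    ultimately show ?thesis by (simp add: Suc del: herm.simps)
  qed
  have "S (P * herm g n)" for n
  proof (induction P arbitrary: n)
    case 0
    show ?case using herm[of 0 n] by simp
  next
    case (pCons a P)
    have "pCons a P * herm g n = smult a (herm g n) + P * ([:0, 1:] * herm g n)"
      by simp
    also have "P * ([:0, 1:] * herm g n) = smult (1 / (2 * g)) (P * herm g (Suc n)) + smult (of_nat n) (P * herm g (n - 1))"
      unfolding X by (simp add: distrib_left del: herm.simps)
    finally show ?case using add smult herm pCons.IH by metis
  qed
  from this[of 0] show ?thesis by simp
qed

lemma ham_herm: "ham g (herm g n) = smult (g * of_nat (2 * n + 1)) (herm g n)"
proof (cases n)
  case (Suc m)
  have "ham g (herm g (Suc m)) = smult (2 * g * of_nat (Suc m)) (herm g (Suc m)) + smult g (herm g (Suc m))"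
    unfolding ham_def pderiv_herm raise_smult by simp
  also have "\<dots> = smult (g * of_nat (2 * Suc m + 1)) (herm g (Suc m))"
    unfolding smult_add_left[symmetric] by (simp add: algebra_simps del: herm.simps)
  finally show ?thesis by (simp only: Suc)
qed (simp add: ham_def raise_def)

section \<open>Complex scalars, resolvents and circle integrals\<close>

lemma scaleC_add_left: "(c + d) *\<^sub>C u = c *\<^sub>C u + d *\<^sub>C u"
proof -
  define f where "f = rep_L2 u"
  have f: "sq_integrable f" "abs_L2 f = u" by (simp_all add: f_def sq_integrable_rep abs_rep_L2)
  have s: "b *\<^sub>C abs_L2 f = abs_L2 (\<lambda>x. b * f x)" for b
    using f(1) by (intro scaleC.abs_eq) auto
  have "abs_L2 (\<lambda>x. c * f x) + abs_L2 (\<lambda>x. d * f x) = abs_L2 (\<lambda>x. c * f x + d * f x)"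
    using f(1) sq_integrable_mult by (intro plus_L2.abs_eq) auto
  then show ?thesis by (simp add: f(2)[symmetric] s distrib_right)
qed

lemma scaleC_scaleC: "c *\<^sub>C d *\<^sub>C u = (c * d) *\<^sub>C u"
proof -
  define f where "f = rep_L2 u"
  have f: "sq_integrable f" "abs_L2 f = u" by (simp_all add: f_def sq_integrable_rep abs_rep_L2)
  have s: "b *\<^sub>C abs_L2 g = abs_L2 (\<lambda>x. b * g x)" if "sq_integrable g" for b g
    using that by (intro scaleC.abs_eq) auto
  show ?thesis using f(1) by (simp add: f(2)[symmetric] s sq_integrable_mult mult.assoc)
qed

lemma scaleC_zero: "0 *\<^sub>C u = 0"
  using scaleC_of_real[of 0 u] by simp

lemmas scaleC_linear_simps = linear_simps[OF bounded_linear_scaleC]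

lemma scaleC_scaleR: "(r *\<^sub>R c) *\<^sub>C u = r *\<^sub>R (c *\<^sub>C u)"
  using scaleC_scaleC[of "of_real r" c u] by (simp add: scaleC_of_real scaleR_conv_of_real)

lemma bounded_linear_scaleC_left: "bounded_linear (\<lambda>c. c *\<^sub>C u)"
  by (rule bounded_linear_intro[where K = "norm u"])
    (simp_all add: scaleC_add_left scaleC_scaleR norm_scaleC)

lemma bounded_bilinear_scaleC_op: "bounded_bilinear scaleC_op"
proof
  fix a a' :: complex and b b' :: "L2 \<Rightarrow>\<^sub>L L2" and r :: real
  show "scaleC_op (a + a') b = scaleC_op a b + scaleC_op a' b"
    by (rule blinfun_eqI) (simp add: scaleC_add_left blinfun.add_left)
  show "scaleC_op a (b + b') = scaleC_op a b + scaleC_op a b'"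
    by (rule blinfun_eqI) (simp add: blinfun.add_left scaleC_linear_simps)
  show "scaleC_op (r *\<^sub>R a) b = r *\<^sub>R scaleC_op a b"
    by (rule blinfun_eqI) (simp add: blinfun.scaleR_left scaleC_scaleR)
  show "scaleC_op a (r *\<^sub>R b) = r *\<^sub>R scaleC_op a b"
    by (rule blinfun_eqI) (simp add: blinfun.scaleR_left scaleC_linear_simps)
  show "\<exists>K. \<forall>a b. norm (scaleC_op a b) \<le> norm a * norm b * K"
  proof (intro exI allI)
    fix a b show "norm (scaleC_op a b) \<le> norm a * norm b * 1"
      by (rule norm_blinfun_bound)
        (auto simp: norm_scaleC mult.assoc intro!: mult_left_mono norm_blinfun)
  qed
qed

lemma is_resolvent_unique:
  assumes "is_resolvent A \<zeta> R" shows "resolvent A \<zeta> = R"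
  unfolding resolvent_def
proof (rule the_equality)
  fix R' assume "is_resolvent A \<zeta> R'"
  then show "R' = R" using assms unfolding is_resolvent_def by (metis blinfun_eqI)
qed (rule assms)

lemma is_resolvent_resolvent: "\<zeta> \<notin> spectrum A \<Longrightarrow> is_resolvent A \<zeta> (resolvent A \<zeta>)"
  using is_resolvent_unique by (fastforce simp: spectrum_def)

lemma resolvent_identity:
  assumes "is_resolvent A \<zeta> R" "is_resolvent A \<zeta>' R'"
  shows "blinfun_apply R f - blinfun_apply R' f = blinfun_apply R' ((\<zeta>' - \<zeta>) *\<^sub>C blinfun_apply R f)"
proof -
  define u where "u = blinfun_apply R f"
  have "(u, \<zeta> *\<^sub>C u - f) \<in> A" using assms(1) by (simp add: is_resolvent_def u_def)
  moreover have "\<zeta> *\<^sub>C u - f = \<zeta>' *\<^sub>C u - (f + (\<zeta>' - \<zeta>) *\<^sub>C u)"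
    using scaleC_add_left[of \<zeta> "\<zeta>' - \<zeta>" u] by simp
  ultimately have "u = blinfun_apply R' (f + (\<zeta>' - \<zeta>) *\<^sub>C u)"
    using assms(2) by (simp add: is_resolvent_def)
  then have "u = blinfun_apply R' f + blinfun_apply R' ((\<zeta>' - \<zeta>) *\<^sub>C u)"
    by (simp only: blinfun.add_right)
  then show ?thesis unfolding u_def by (metis add_diff_cancel_left')
qed

text \<open>The resolvent identity bounds the difference by \<open>norm (R z)\<close>, which is not
  yet known to be bounded near \<zeta>. For \<open>z\<close> close to \<zeta> the same inequality
  gives \<open>norm (R z) \<le> 2 * M\<close>, and inserting this gives a Lipschitz bound.\<close>

lemma resolvent_continuous:
  assumes \<zeta>: "\<zeta> \<notin> spectrum A" and S: "S \<inter> spectrum A = {}" "\<zeta> \<in> S"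
  shows "continuous (at \<zeta> within S) (resolvent A)"
proof -
  define R where "R = resolvent A"
  define M where "M = norm (R \<zeta>)"
  have res: "is_resolvent A z (R z)" if "z \<in> S" for z
    using S(1) that by (auto simp: R_def intro!: is_resolvent_resolvent)
  have diff: "norm (R z - R \<zeta>) \<le> M * norm (R z) * cmod (z - \<zeta>)" if "z \<in> S" for z
  proof (rule norm_blinfun_bound)
    show "0 \<le> M * norm (R z) * cmod (z - \<zeta>)" by (simp add: M_def)
    fix f
    have "norm (blinfun_apply (R z - R \<zeta>) f) = norm (blinfun_apply (R \<zeta>) ((\<zeta> - z) *\<^sub>C blinfun_apply (R z) f))"
      using resolvent_identity[OF res[OF that] res[OF S(2)], of f] by (simp add: blinfun.diff_left)
    also have "\<dots> \<le> M * norm ((\<zeta> - z) *\<^sub>C blinfun_apply (R z) f)"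
      unfolding M_def by (rule norm_blinfun)
    also have "\<dots> \<le> M * (cmod (\<zeta> - z) * (norm (R z) * norm f))"
      unfolding norm_scaleC by (intro mult_left_mono norm_blinfun) (auto simp: M_def)
    finally show "norm (blinfun_apply (R z - R \<zeta>) f) \<le> M * norm (R z) * cmod (z - \<zeta>) * norm f"
      by (simp add: mult_ac norm_minus_commute)
  qed
  have ev: "\<forall>\<^sub>F z in at \<zeta> within S. norm (R z - R \<zeta>) \<le> 2 * M\<^sup>2 * cmod (z - \<zeta>)"
    unfolding eventually_at
  proof (intro exI conjI ballI impI)
    \<comment> \<open>With \<open>M + 1\<close> in place of \<open>M\<close> the radius is
      meaningful whatever the value of \<open>M\<close>.\<close>
    show "0 < 1 / (2 * (M + 1))" by (simp add: M_def add_nonneg_pos)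
    fix z assume z: "z \<in> S" "z \<noteq> \<zeta> \<and> dist z \<zeta> < 1 / (2 * (M + 1))"
    have M0: "M \<ge> 0" by (simp add: M_def)
    have "M * cmod (z - \<zeta>) \<le> (M + 1) * (1 / (2 * (M + 1)))"
      using z(2) M0 by (intro mult_mono) (auto simp: dist_norm)
    also have "(M + 1) * (1 / (2 * (M + 1))) = 1 / 2"
      using M0 by (simp only: times_divide_eq_right mult_1_right) (simp add: divide_simps)
    finally have half: "M * cmod (z - \<zeta>) \<le> 1 / 2" .
    have "norm (R z) \<le> norm (R z - R \<zeta>) + M"
      using norm_triangle_ineq[of "R z - R \<zeta>" "R \<zeta>"] by (simp add: M_def)
    also have "norm (R z - R \<zeta>) \<le> (M * cmod (z - \<zeta>)) * norm (R z)"
      using diff[OF z(1)] by (simp add: mult_ac)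
    also have "\<dots> \<le> 1 / 2 * norm (R z)" by (intro mult_right_mono half) auto
    finally have "norm (R z) \<le> 2 * M" by simp
    then have "M * norm (R z) * cmod (z - \<zeta>) \<le> M * (2 * M) * cmod (z - \<zeta>)"
      using M0 by (intro mult_right_mono mult_left_mono) auto
    then show "norm (R z - R \<zeta>) \<le> 2 * M\<^sup>2 * cmod (z - \<zeta>)"
      using diff[OF z(1)] by (simp add: power2_eq_square)
  qed
  have "((\<lambda>z. 2 * M\<^sup>2 * cmod (z - \<zeta>)) \<longlongrightarrow> 2 * M\<^sup>2 * cmod (\<zeta> - \<zeta>)) (at \<zeta> within S)"
    by (intro tendsto_intros)
  then have "((\<lambda>z. R z - R \<zeta>) \<longlongrightarrow> 0) (at \<zeta> within S)"
    using Lim_null_comparison[OF ev] by simp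
  then have "(R \<longlongrightarrow> R \<zeta>) (at \<zeta> within S)" by (simp add: LIM_zero_iff)
  then show ?thesis by (simp add: continuous_within R_def)
qed

text \<open>For a pole outside the circle, \<open>Ln (1 + w * cis t)\<close> with
  \<open>cmod w < 1\<close> stays off the branch cut and is a periodic primitive of the
  integrand.\<close>

lemma integral_circle_rational:
  assumes r: "r > 0" and d: "cmod d > r"
  shows "((\<lambda>t. of_real r * \<i> * cis t / (d + of_real r * cis t)) has_integral 0) {0..2 * pi}"
proof -
  define w where "w = of_real r / d"
  have d0: "d \<noteq> 0" using r d by auto
  have w: "cmod w < 1"
    using r by (simp add: w_def norm_divide pos_divide_less_eq[OF order.strict_trans[OF r d]] d)
  have nonneg: "1 + w * cis t \<notin> \<real>\<^sub>\<le>\<^sub>0" for t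
  proof -
    have "\<bar>Re (w * cis t)\<bar> \<le> cmod (w * cis t)" by (rule abs_Re_le_cmod)
    also have "\<dots> < 1" using w by (simp add: norm_mult)
    finally have "Re (1 + w * cis t) > 0" by simp
    then show ?thesis using complex_nonpos_Reals_iff by force
  qed
  have "((\<lambda>t. of_real r * \<i> * cis t / (d + of_real r * cis t)) has_integral Ln (1 + w * cis (2 * pi)) - Ln (1 + w * cis 0)) {0..2 * pi}"
  proof (rule fundamental_theorem_of_calculus)
    fix t :: real
    have cis: "(cis has_vector_derivative \<i> * cis t) (at t)"
    proof -
      have "((\<lambda>z. exp (\<i> * z)) has_field_derivative \<i> * exp (\<i> * of_real t)) (at (of_real t))"
        by (auto intro!: derivative_eq_intros)
      from has_vector_derivative_real_field[OF this] show ?thesis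
        by (simp add: cis_conv_exp[abs_def])
    qed
    have "((\<lambda>t. 1 + w * cis t) has_vector_derivative w * (\<i> * cis t)) (at t)"
      by (auto intro!: derivative_eq_intros cis)
    moreover have "(Ln has_field_derivative inverse (1 + w * cis t)) (at (1 + w * cis t))"
      by (rule has_field_derivative_Ln[OF nonneg])
    ultimately have "((\<lambda>t. Ln (1 + w * cis t)) has_vector_derivative w * (\<i> * cis t) * inverse (1 + w * cis t)) (at t)"
      using field_vector_diff_chain_at[of "\<lambda>t. 1 + w * cis t" _ t Ln] by (simp add: o_def)
    moreover have "w * (\<i> * cis t) * inverse (1 + w * cis t) = of_real r * \<i> * cis t / (d + of_real r * cis t)"
    proof -
      have "1 + w * cis t = (d + of_real r * cis t) / d" using d0 by (simp add: w_def field_simps)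
      then show ?thesis using d0 by (simp add: w_def)
    qed
    ultimately show "((\<lambda>t. Ln (1 + w * cis t)) has_vector_derivative of_real r * \<i> * cis t / (d + of_real r * cis t)) (at t within {0..2 * pi})"
      by (simp add: has_vector_derivative_at_within)
  qed simp
  then show ?thesis by simp
qed

section \<open>Spectrum and spectral projections of the quadratic operator\<close>

locale gauss_weyl = gauss_pair +
  fixes k :: complex
  assumes k: "k \<noteq> 0"
begin

abbreviation A :: unbounded_op where "A \<equiv> weyl (gauss_form k \<sigma> \<tau>)"

definition level :: "nat \<Rightarrow> complex" where "level n = k * \<gamma> * of_nat (2 * n + 1)"

definition shift :: "complex \<Rightarrow> complex poly \<Rightarrow> complex poly" where
  "shift \<zeta> P = smult \<zeta> P - smult k (ham \<gamma> P)"

lemma shift_add: "shift \<zeta> (P + Q) = shift \<zeta> P + shift \<zeta> Q"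
  by (simp add: shift_def ham_add smult_add_right)

lemma ham_smult: "ham \<gamma> (smult c P) = smult c (ham \<gamma> P)"
  by (simp add: ham_def pderiv_smult raise_smult smult_add_right mult.commute)

lemma shift_smult: "shift \<zeta> (smult c P) = smult c (shift \<zeta> P)"
  by (simp add: shift_def ham_smult smult_diff_right mult.commute)

lemma shift_herm: "shift \<zeta> (herm \<gamma> n) = smult (\<zeta> - level n) (herm \<gamma> n)"
  by (simp add: shift_def ham_herm level_def smult_diff_left mult.assoc)

text \<open>\<open>shift \<zeta>\<close> is diagonal in the Hermite polynomials, with entries
  \<open>\<zeta> - level n\<close>, and these polynomials span.\<close>

lemma shift_surj:
  assumes "\<And>n. \<zeta> \<noteq> level n"
  shows "\<exists>P. shift \<zeta> P = Q"
proof (induction Q rule: herm_span_induct[OF \<gamma>_nz])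
  case (1 c n)
  have "shift \<zeta> (smult (c / (\<zeta> - level n)) (herm \<gamma> n)) = smult c (herm \<gamma> n)"
    using assms[of n] by (simp add: shift_smult shift_herm)
  then show ?case by blast
next
  case (2 P Q)
  then show ?case using shift_add by metis
next
  case (3 c P)
  then show ?case using shift_smult by metis
qed

lemma shift_bounded_below:
  assumes "\<And>n. \<zeta> \<noteq> level n"
  obtains C where "C \<ge> 0" "\<And>P. norm (e P) \<le> C * norm (e (shift \<zeta> P))"
proof -
  have "bounded_below_at (\<zeta> / k)"
    using assms k by (intro bounded_below_at_off_spectrum) (auto simp: level_def field_simps)
  then obtain C where C: "C \<ge> 0" "\<And>P. norm (e P) \<le> C * norm (e (smult (\<zeta> / k) P - ham \<gamma> P))"
    by (auto simp: bounded_below_at_def)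
  have "norm (e P) \<le> (C / cmod k) * norm (e (shift \<zeta> P))" for P
  proof -
    have "shift \<zeta> P = smult k (smult (\<zeta> / k) P - ham \<gamma> P)"
      using k by (simp add: shift_def smult_diff_right)
    then have "norm (e (shift \<zeta> P)) = cmod k * norm (e (smult (\<zeta> / k) P - ham \<gamma> P))"
      by (simp only: e_smult norm_scaleC)
    then show ?thesis using C(2)[of P] k by simp
  qed
  then show ?thesis using that C(1) by (metis divide_nonneg_nonneg norm_ge_zero)
qed

lemma gp_L2_shift_in_weyl: "(e P, \<zeta> *\<^sub>C e P - e (shift \<zeta> P)) \<in> A"
proof -
  have "\<zeta> *\<^sub>C e P - e (shift \<zeta> P) = k *\<^sub>C e (ham \<gamma> P)"
    by (simp add: shift_def e_diff e_smult)
  then show ?thesis using gp_L2_in_weyl[OF Re_\<sigma>, of P k \<tau>] by (simp add: \<gamma>_def)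
qed

text \<open>Valid for every element of the maximal domain. As \<open>shift \<zeta>\<close> is onto
  away from the levels, it prescribes all moments of \<open>u\<close> against the transposed
  Gaussian and so determines \<open>u\<close>.\<close>

lemma weyl_pairing_shift:
  assumes "(u, \<zeta> *\<^sub>C u - f) \<in> A"
  shows "pairing u (gp_L2 \<tau> (shift \<zeta> Q)) = pairing f (gp_L2 \<tau> Q)"
proof -
  have "pairing (\<zeta> *\<^sub>C u - f) (gp_L2 \<tau> Q) = k * pairing u (gp_L2 \<tau> (ham \<gamma> Q))"
    using weyl_pairing_gp_L2[OF assms Re_\<tau>] by (simp add: \<gamma>_def)
  then have "\<zeta> * pairing u (gp_L2 \<tau> Q) - k * pairing u (gp_L2 \<tau> (ham \<gamma> Q)) = pairing f (gp_L2 \<tau> Q)"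
    by (simp add: linear_simps[OF bounded_linear_pairing] pairing_scaleC algebra_simps)
  then show ?thesis
    by (simp add: shift_def gp_L2_diff[OF Re_\<tau>] gp_L2_smult[OF Re_\<tau>] pairing_commute[of u]
        linear_simps[OF bounded_linear_pairing] pairing_scaleC)
qed

text \<open>Existence: right-hand sides in the core are solved algebraically, and the lower bound
  with closedness of the graph carries the solutions to the closure, which is all of
  \<open_placeholder>.\<close>

lemma resolvent_exists:
  assumes \<zeta>: "\<And>n. \<zeta> \<noteq> level n"
  shows "\<exists>R. is_resolvent A \<zeta> R"
proof -
  obtain C where C: "C \<ge> 0" "\<And>P. norm (e P) \<le> C * norm (e (shift \<zeta> P))"
    using shift_bounded_below[OF \<zeta>] by blast
  \<comment> \<open>The weak equation tested on the transposed core. It is additive and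
    real-homogeneous in \<open>(u, f)\<close> and has at most one solution \<open>u\<close>, so
    linearity of the solution operator follows from uniqueness and not from its
    construction.\<close>
  define G where "G u f \<longleftrightarrow> (\<forall>Q. pairing u (gp_L2 \<tau> (shift \<zeta> Q)) = pairing f (gp_L2 \<tau> Q))" for u f
  have unique: "u = u'" if "G u f" "G u' f" for u u' f
  proof -
    have "pairing (u - u') (gp_L2 \<tau> Q) = 0" for Q
    proof -
      obtain P where "shift \<zeta> P = Q" using shift_surj[OF \<zeta>] by blast
      then show ?thesis using that by (auto simp: G_def linear_simps[OF bounded_linear_pairing])
    qed
    then have "u - u' = 0" by (rule pairing_gp_L2_zero[OF Re_\<tau>])
    then show ?thesis by simp
  qed
  have ex: "\<exists>u. (u, \<zeta> *\<^sub>C u - f) \<in> A \<and> norm u \<le> C * norm f" for f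
  proof -
    have "f \<in> closure (range e)" using closure_range_gp_L2[OF Re_\<sigma>] by simp
    then obtain Q' where Q': "\<And>n::nat. Q' n \<in> range e" "Q' \<longlonglongrightarrow> f"
      by (metis closure_sequential)
    then have "\<forall>n. \<exists>P. Q' n = e (shift \<zeta> P)" using shift_surj[OF \<zeta>] by (metis imageE)
    then obtain P where P: "\<And>n. Q' n = e (shift \<zeta> (P n))" by metis
    have "norm (e (P n) - e (P m)) \<le> C * norm (Q' n - Q' m)" for n m
    proof -
      have sh: "shift \<zeta> (P n - P m) = shift \<zeta> (P n) - shift \<zeta> (P m)"
        using shift_add[of \<zeta> "P n - P m" "P m"] by (simp add: algebra_simps)
      show ?thesis using C(2)[of "P n - P m"] by (simp only: sh e_diff P)
    qed
    note bnd = this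
    have "Cauchy (\<lambda>n. e (P n))"
    proof (rule metric_CauchyI)
      fix \<epsilon> :: real assume "\<epsilon> > 0"
      then have "\<epsilon> / (C + 1) > 0" using C(1) by simp
      moreover have "Cauchy Q'" using Q'(2) by (rule LIMSEQ_imp_Cauchy)
      ultimately obtain M where M: "\<And>m n. m \<ge> M \<Longrightarrow> n \<ge> M \<Longrightarrow> dist (Q' m) (Q' n) < \<epsilon> / (C + 1)"
        by (metis Cauchy_def)
      have "dist (e (P m)) (e (P n)) < \<epsilon>" if "m \<ge> M" "n \<ge> M" for m n
      proof -
        have "dist (e (P m)) (e (P n)) \<le> (C + 1) * dist (Q' m) (Q' n)"
          using bnd[of m n] by (simp add: dist_norm distrib_right add_increasing2)
        also have "\<dots> < (C + 1) * (\<epsilon> / (C + 1))"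
          using M[OF that] C(1) by (intro mult_strict_left_mono) auto
        finally show ?thesis using C(1) by simp
      qed
      then show "\<exists>M. \<forall>m\<ge>M. \<forall>n\<ge>M. dist (e (P m)) (e (P n)) < \<epsilon>" by blast
    qed
    then obtain u where u: "(\<lambda>n. e (P n)) \<longlonglongrightarrow> u" using Cauchy_convergent convergent_def by blast
    have "(u, \<zeta> *\<^sub>C u - f) \<in> A"
    proof (rule weyl_gauss_form_closed[OF _ u])
      show "(e (P n), \<zeta> *\<^sub>C e (P n) - Q' n) \<in> A" for n unfolding P by (rule gp_L2_shift_in_weyl)
      show "(\<lambda>n. \<zeta> *\<^sub>C e (P n) - Q' n) \<longlonglongrightarrow> \<zeta> *\<^sub>C u - f"
        by (intro tendsto_diff bounded_linear.tendsto[OF bounded_linear_scaleC] u Q')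
    qed
    moreover have "norm u \<le> C * norm f"
    proof (rule LIMSEQ_le)
      show "(\<lambda>n. norm (e (P n))) \<longlonglongrightarrow> norm u" by (intro tendsto_norm u)
      show "(\<lambda>n. C * norm (Q' n)) \<longlonglongrightarrow> C * norm f" by (intro tendsto_intros Q')
      show "\<exists>N. \<forall>n\<ge>N. norm (e (P n)) \<le> C * norm (Q' n)" using C(2) P by auto
    qed
    ultimately show ?thesis by blast
  qed
  \<comment> \<open>The solutions are picked by choice; no continuity or linearity is built in at
    this point.\<close>
  then obtain R where R: "\<And>f. (R f, \<zeta> *\<^sub>C R f - f) \<in> A" "\<And>f. norm (R f) \<le> C * norm f" by metis
  have G_R: "G (R f) f" for f unfolding G_def using weyl_pairing_shift[OF R(1)] by blast
  have "bounded_linear R"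
  proof (rule bounded_linear_intro[where K = C])
    show "R (f + g) = R f + R g" for f g
      by (rule unique[OF G_R]) (use G_R[of f] G_R[of g] in \<open>simp add: G_def pairing_add\<close>)
    show "R (r *\<^sub>R f) = r *\<^sub>R R f" for r f
      by (rule unique[OF G_R]) (use G_R[of f] in \<open>simp add: G_def pairing_scaleR\<close>)
    show "norm (R f) \<le> norm f * C" for f using R(2)[of f] by (simp add: mult.commute)
  qed
  moreover have "(u, \<zeta> *\<^sub>C u - f) \<in> A \<longleftrightarrow> u = R f" for u f
  proof
    assume "(u, \<zeta> *\<^sub>C u - f) \<in> A"
    then have "G u f" unfolding G_def using weyl_pairing_shift by blast
    then show "u = R f" by (rule unique[OF _ G_R])
  qed (use R(1) in simp)
  ultimately have "is_resolvent A \<zeta> (Blinfun R)"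
    by (simp add: is_resolvent_def bounded_linear_Blinfun_apply)
  then show ?thesis by blast
qed

lemma gp_L2_herm_nz: "pairing (e (herm \<gamma> n)) (gp_L2 \<tau> (herm \<gamma> n)) \<noteq> 0" 
  using gp_integral_1_nz \<gamma>_nz
  by (simp add: pairing_gp_L2[OF Re_\<sigma> Re_\<tau>] \<gamma>_def[symmetric] gp_integral_herm_herm[OF Re_\<gamma>] del: herm.simps)

lemma spectrum_eq: "spectrum A = range level"
proof
  show "spectrum A \<subseteq> range level"
    using resolvent_exists by (fastforce simp: spectrum_def)
  show "range level \<subseteq> spectrum A"
  proof safe
    fix n
    show "level n \<in> spectrum A"
      unfolding spectrum_def
    proof safe
      fix R assume R: "is_resolvent A (level n) R"
      have "(e (herm \<gamma> n), level n *\<^sub>C e (herm \<gamma> n) - 0) \<in> A"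
        using gp_L2_shift_in_weyl[of "herm \<gamma> n" "level n"] by (simp add: shift_herm gp_L2_0)
      then have "e (herm \<gamma> n) = 0" using R by (simp only: is_resolvent_def blinfun.zero_right)
      then show False using gp_L2_herm_nz[of n] linear_simps(3)[OF bounded_linear_pairing] by metis
    qed
  qed
qed

lemma resolvent_herm:
  assumes "\<zeta> \<notin> spectrum A"
  shows "blinfun_apply (resolvent A \<zeta>) (e (smult c (herm \<gamma> n))) = (c / (\<zeta> - level n)) *\<^sub>C e (herm \<gamma> n)"
proof -
  have nz: "\<zeta> - level n \<noteq> 0" using assms by (auto simp: spectrum_eq)
  define P where "P = smult (c / (\<zeta> - level n)) (herm \<gamma> n)"
  have "shift \<zeta> P = smult c (herm \<gamma> n)"
    using nz by (simp add: P_def shift_smult shift_herm)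
  then have "(e P, \<zeta> *\<^sub>C e P - e (smult c (herm \<gamma> n))) \<in> A"
    using gp_L2_shift_in_weyl[of P \<zeta>] by simp
  then have "e P = blinfun_apply (resolvent A \<zeta>) (e (smult c (herm \<gamma> n)))"
    using is_resolvent_resolvent[OF assms] by (simp add: is_resolvent_def)
  then show ?thesis by (simp add: P_def e_smult)
qed

text \<open>The radius is an unspecified choice, so only these three properties are available later.
  Neighbouring levels are \<open>2 * cmod (k * \<gamma>)\<close> apart, and half of this is a
  witness that such a radius exists.\<close>

lemma isolating_radius:
  shows "isolating_radius A (level N) > 0" "\<And>n. n \<noteq> N \<Longrightarrow> cmod (level n - level N) > isolating_radius A (level N)"
    "\<And>t. level N + of_real (isolating_radius A (level N)) * cis t \<notin> spectrum A"
proof -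
  have dist: "cmod (level n - level N) = 2 * cmod (k * \<gamma>) * \<bar>real n - real N\<bar>" for n
  proof -
    have "level n - level N = 2 * (k * \<gamma>) * of_real (real n - real N)"
      by (simp add: level_def algebra_simps)
    then show ?thesis by (simp only: norm_mult norm_of_real) simp
  qed
  have kg: "cmod (k * \<gamma>) > 0" using k \<gamma>_nz by simp
  have "\<exists>r. r > 0 \<and> spectrum A \<inter> cball (level N) r \<subseteq> {level N}"
  proof (intro exI conjI subsetI)
    show "cmod (k * \<gamma>) > 0" by (rule kg)
    fix z assume "z \<in> spectrum A \<inter> cball (level N) (cmod (k * \<gamma>))"
    then obtain n where n: "z = level n" "cmod (level n - level N) \<le> cmod (k * \<gamma>)"
      by (auto simp: spectrum_eq dist_norm norm_minus_commute)
    have "n = N"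
    proof (rule ccontr)
      assume "n \<noteq> N"
      then have "\<bar>real n - real N\<bar> \<ge> 1" by linarith
      then have "2 * cmod (k * \<gamma>) * 1 \<le> 2 * cmod (k * \<gamma>) * \<bar>real n - real N\<bar>"
        by (intro mult_left_mono) auto
      then show False using n(2) kg unfolding dist by linarith
    qed
    then show "z \<in> {level N}" using n by simp
  qed
  from someI_ex[OF this] have r: "isolating_radius A (level N) > 0"
    "spectrum A \<inter> cball (level N) (isolating_radius A (level N)) \<subseteq> {level N}"
    unfolding isolating_radius_def by blast+
  show "isolating_radius A (level N) > 0" by fact
  show "cmod (level n - level N) > isolating_radius A (level N)" if "n \<noteq> N" for n
  proof (rule ccontr)
    assume "\<not> ?thesis"
    then have "level n \<in> spectrum A \<inter> cball (level N) (isolating_radius A (level N))"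
      by (simp add: spectrum_eq dist_norm norm_minus_commute)
    then have "level n = level N" using r(2) by blast
    then show False using dist[of n] kg that by simp
  qed
  show "level N + of_real (isolating_radius A (level N)) * cis t \<notin> spectrum A" for t
  proof
    assume *: "level N + of_real (isolating_radius A (level N)) * cis t \<in> spectrum A"
    moreover have "level N + of_real (isolating_radius A (level N)) * cis t \<in> cball (level N) (isolating_radius A (level N))"
      using r(1) by (simp add: dist_norm norm_mult)
    ultimately have "level N + of_real (isolating_radius A (level N)) * cis t = level N" using r(2) by blast
    then show False using r(1) by simp
  qed
qed

text \<open>On an eigenvector the resolvent is the scalar \<open>1 / (\<zeta> - level n)\<close>,
  which reduces the operator-valued contour integral to a scalar one. Continuity of the integrand is
  needed for evaluation at a vector to commute with the integral.\<close>

lemma spectral_projection_herm: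
  "blinfun_apply (spectral_projection A (level N)) (e (smult c (herm \<gamma> n)))
    = (if n = N then c else 0) *\<^sub>C e (herm \<gamma> n)"
proof -
  define r where "r = isolating_radius A (level N)"
  note r = isolating_radius[where N = N, folded r_def]
  define F where "F t = scaleC_op (of_real r * \<i> * cis t) (resolvent A (level N + of_real r * cis t))" for t
  have "continuous_on {0..2 * pi} F"
  proof -
    define S where "S = (\<lambda>t. level N + of_real r * cis t) ` {0..2 * pi}"
    have "continuous_on S (resolvent A)"
      unfolding continuous_on_eq_continuous_within S_def
      by (intro ballI resolvent_continuous) (use r(3) in auto)
    then have "continuous_on {0..2 * pi} (\<lambda>t. resolvent A (level N + of_real r * cis t))"
      by (rule continuous_on_compose2) (auto simp: S_def intro!: continuous_intros)
    then show ?thesis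
      unfolding F_def by (intro bounded_bilinear.continuous_on[OF bounded_bilinear_scaleC_op] continuous_intros)
  qed
  then have F: "F integrable_on {0..2 * pi}" by (rule integrable_continuous_interval)
  define \<phi> where "\<phi> t = of_real r * \<i> * cis t * (c / (level N + of_real r * cis t - level n))" for t
  have \<phi>: "(\<phi> has_integral (if n = N then 2 * of_real pi * \<i> * c else 0)) {0..2 * pi}"
  proof (cases "n = N")
    case True
    have "\<phi> = (\<lambda>t. \<i> * c)" using True r(1) by (auto simp: \<phi>_def)
    moreover have "((\<lambda>t. \<i> * c) has_integral (2 * pi - 0) *\<^sub>R (\<i> * c)) {0..2 * pi}"
      using has_integral_const_real[of "\<i> * c" 0 "2 * pi"] by simp
    ultimately show ?thesis using True by (simp add: scaleR_conv_of_real mult_ac)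
  next
    case False
    have "((\<lambda>t. of_real r * \<i> * cis t / ((level N - level n) + of_real r * cis t) * c) has_integral 0 * c) {0..2 * pi}"
      using r(1) r(2)[OF False] by (intro has_integral_mult_left integral_circle_rational) (auto simp: norm_minus_commute)
    moreover have "of_real r * \<i> * cis t / ((level N - level n) + of_real r * cis t) * c = \<phi> t" for t
      by (simp add: \<phi>_def algebra_simps)
    ultimately show ?thesis using False by simp
  qed
  let ?w = "e (smult c (herm \<gamma> n))"
  have "blinfun_apply (integral {0..2 * pi} F) ?w = integral {0..2 * pi} (\<lambda>t. blinfun_apply (F t) ?w)"
    using integral_linear[OF F blinfun.bounded_linear_left, of ?w] by (simp add: o_def)
  also have "(\<lambda>t. blinfun_apply (F t) ?w) = (\<lambda>t. \<phi> t *\<^sub>C e (herm \<gamma> n))"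
    by (simp add: F_def resolvent_herm[OF r(3)] scaleC_scaleC \<phi>_def)
  also have "integral {0..2 * pi} (\<lambda>t. \<phi> t *\<^sub>C e (herm \<gamma> n)) = (integral {0..2 * pi} \<phi>) *\<^sub>C e (herm \<gamma> n)"
    using integral_linear[OF has_integral_integrable[OF \<phi>] bounded_linear_scaleC_left, of "e (herm \<gamma> n)"] by (simp add: o_def)
  also have "integral {0..2 * pi} \<phi> = (if n = N then 2 * of_real pi * \<i> * c else 0)"
    using \<phi> by (rule integral_unique)
  finally have *: "blinfun_apply (integral {0..2 * pi} F) ?w = (if n = N then 2 * of_real pi * \<i> * c else 0) *\<^sub>C e (herm \<gamma> n)" .
  have "spectral_projection A (level N) = scaleC_op (1 / (2 * of_real pi * \<i>)) (integral {0..2 * pi} F)"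
    by (simp add: spectral_projection_def Let_def r_def F_def[abs_def])
  then show ?thesis using * by (simp add: scaleC_scaleC)
qed

lemma spectral_projection_apply:
  "blinfun_apply (spectral_projection A (level N)) u
    = (pairing u (gp_L2 \<tau> (herm \<gamma> N)) / pairing (e (herm \<gamma> N)) (gp_L2 \<tau> (herm \<gamma> N))) *\<^sub>C e (herm \<gamma> N)"
proof -
  let ?v = "gp_L2 \<tau> (herm \<gamma> N)" and ?e = "e (herm \<gamma> N)"
  let ?\<Pi> = "blinfun_apply (spectral_projection A (level N))"
  define T where "T u = (pairing u ?v / pairing ?e ?v) *\<^sub>C ?e" for u
  have T: "bounded_linear T"
  proof -
    have "bounded_linear (\<lambda>u. pairing u ?v / pairing ?e ?v)"
      using bounded_linear_compose[OF bounded_linear_divide bounded_linear_pairing] .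
    from bounded_linear_compose[OF bounded_linear_scaleC_left this] show ?thesis by (simp add: T_def[abs_def])
  qed
  have "?\<Pi> (e P) = T (e P)" for P
  proof -
    \<comment> \<open>Bounded operators are only real-linear as a type, so complex multiples have to
      be carried through the induction.\<close>
    have "\<forall>c. ?\<Pi> (e (smult c P)) = T (e (smult c P))"
    proof (induction P rule: herm_span_induct[OF \<gamma>_nz])
      case (1 c n)
      have "pairing (e (smult d (herm \<gamma> n))) ?v / pairing ?e ?v = (if n = N then d else 0)" for d
        using gp_L2_herm_nz[of N]
        by (simp add: pairing_gp_L2[OF Re_\<sigma> Re_\<tau>] \<gamma>_def[symmetric] gp_integral_herm_herm[OF Re_\<gamma>] gp_integral_smult del: herm.simps)
      then show ?case by (simp add: spectral_projection_herm T_def scaleC_zero del: herm.simps)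
    next
      case (2 P Q)
      then show ?case
        by (simp add: smult_add_right e_add blinfun.add_right linear_simps(1)[OF T])
    next
      case (3 c P)
      then show ?case by simp
    qed
    from spec[OF this, of 1] show ?thesis by simp
  qed
  then have "closure (range e) \<subseteq> {u. ?\<Pi> u = T u}"
    by (intro closure_minimal closed_Collect_eq linear_continuous_on[OF T]
        linear_continuous_on[OF blinfun.bounded_linear_right]) auto
  then show ?thesis using closure_range_gp_L2[OF Re_\<sigma>] by (auto simp: T_def)
qed

text \<open>The projection has rank one. Its norm is attained at the conjugate of the transposed
  eigenfunction, where the bilinear pairing becomes the squared norm.\<close>

lemma norm_spectral_projection:
  "norm (spectral_projection A (level N))
    = norm (e (herm \<gamma> N)) * norm (gp_L2 \<tau> (herm \<gamma> N)) / cmod (pairing (e (herm \<gamma> N)) (gp_L2 \<tau> (herm \<gamma> N)))"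
proof -
  let ?v = "gp_L2 \<tau> (herm \<gamma> N)" and ?e = "e (herm \<gamma> N)"
  let ?p = "cmod (pairing ?e ?v)"
  have p: "?p > 0" using gp_L2_herm_nz[of N] by simp
  have v: "norm ?v > 0"
    using norm_pairing_le[of ?e ?v] p by (metis linorder_not_le mult_zero_right norm_le_zero_iff norm_zero)
  have ap: "norm (blinfun_apply (spectral_projection A (level N)) u) = cmod (pairing u ?v) / ?p * norm ?e" for u
    by (simp only: spectral_projection_apply norm_scaleC norm_divide)
  show ?thesis
  proof (rule antisym)
    show "norm (spectral_projection A (level N)) \<le> norm ?e * norm ?v / ?p"
    proof (rule norm_blinfun_bound)
      fix u
      have "cmod (pairing u ?v) / ?p * norm ?e \<le> (norm u * norm ?v) / ?p * norm ?e"
        using p by (intro mult_right_mono divide_right_mono norm_pairing_le) auto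
      then show "norm (blinfun_apply (spectral_projection A (level N)) u) \<le> norm ?e * norm ?v / ?p * norm u"
        unfolding ap by (simp add: mult_ac)
    qed simp
    have "(norm ?v)\<^sup>2 = Re (pairing (cnj_L2 ?v) ?v)"
      by (simp add: Re_pairing power2_norm_eq_inner[symmetric] norm_cnj_L2)
    also have "\<dots> \<le> cmod (pairing (cnj_L2 ?v) ?v)" by (rule complex_Re_le_cmod)
    finally have "(norm ?v)\<^sup>2 / ?p * norm ?e \<le> norm (blinfun_apply (spectral_projection A (level N)) (cnj_L2 ?v))"
      unfolding ap using p by (intro mult_right_mono divide_right_mono) auto
    also have "\<dots> \<le> norm (spectral_projection A (level N)) * norm ?v"
      using norm_blinfun[of _ "cnj_L2 ?v"] by (simp add: norm_cnj_L2)
    finally have "(norm ?e * norm ?v / ?p) * norm ?v \<le> norm (spectral_projection A (level N)) * norm ?v"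
      by (simp add: power2_eq_square mult_ac)
    then show "norm ?e * norm ?v / ?p \<le> norm (spectral_projection A (level N))"
      using v by (rule mult_right_le_imp_le)
  qed
qed

end


section \<open>Laplace asymptotics\<close>

text \<open>The power series converges absolutely at radius \<open>a\<close>, since \<open>a\<close>
  lies strictly inside the disc; after removing \<open>z ^ m\<close> the tail is dominated by its
  value there, uniformly for \<open>norm z \<le> a\<close>.\<close>

lemma holomorphic_taylor_bound:
  fixes f :: "complex \<Rightarrow> complex"
  assumes f: "f holomorphic_on ball 0 \<rho>" and a: "0 < a" "a < \<rho>"
  obtains \<alpha> where "\<alpha> 0 = f 0"
    "\<And>m. \<exists>K. \<forall>z. norm z \<le> a \<longrightarrow> norm (f z - (\<Sum>n<m. \<alpha> n * z ^ n)) \<le> K * norm z ^ m"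
proof -
  define \<alpha> where "\<alpha> n = (deriv ^^ n) f 0 / fact n" for n
  have sums: "(\<lambda>n. \<alpha> n * z ^ n) sums f z" if "norm z < \<rho>" for z
    using holomorphic_power_series[OF f, of z] that by (simp add: \<alpha>_def)
  obtain b where b: "a < b" "b < \<rho>" using a dense by blast
  have "summable (\<lambda>n. norm (\<alpha> n * of_real a ^ n))"
    by (rule powser_insidea[OF sums_summable[OF sums[of "of_real b"]]]) (use a b in simp_all)
  then have sm: "summable (\<lambda>n. norm (\<alpha> n) * a ^ n)" using a by (simp add: norm_mult norm_power)
  have "\<exists>K. \<forall>z. norm z \<le> a \<longrightarrow> norm (f z - (\<Sum>n<m. \<alpha> n * z ^ n)) \<le> K * norm z ^ m" for m
  proof (intro exI allI impI)
    fix z :: complex assume z: "norm z \<le> a"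
    have sm': "summable (\<lambda>n. norm (\<alpha> (n + m)) * a ^ n)"
    proof -
      have "summable (\<lambda>n. norm (\<alpha> (n + m)) * a ^ (n + m) / a ^ m)"
        by (intro summable_divide summable_ignore_initial_segment[OF sm])
      then show ?thesis using a by (simp add: power_add)
    qed
    have "(\<lambda>n. \<alpha> (n + m) * z ^ (n + m)) sums (f z - (\<Sum>n<m. \<alpha> n * z ^ n))"
      using z a by (intro sums_split_initial_segment sums) auto
    moreover have le: "norm (\<alpha> (n + m) * z ^ (n + m)) \<le> (norm (\<alpha> (n + m)) * a ^ n) * norm z ^ m" for n
    proof -
      have "norm z ^ n \<le> a ^ n" using z by (intro power_mono) auto
      then show ?thesis by (simp add: norm_mult norm_power power_add mult.assoc[symmetric] mult_left_mono mult_right_mono)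
    qed
    ultimately have "norm (f z - (\<Sum>n<m. \<alpha> n * z ^ n)) \<le> (\<Sum>n. (norm (\<alpha> (n + m)) * a ^ n) * norm z ^ m)"
      using norm_suminf_le[OF le summable_mult2[OF sm']] by (simp only: sums_iff)
    also have "\<dots> = (\<Sum>n. norm (\<alpha> (n + m)) * a ^ n) * norm z ^ m"
      by (rule suminf_mult2[OF sm', symmetric])
    finally show "norm (f z - (\<Sum>n<m. \<alpha> n * z ^ n)) \<le> (\<Sum>n. norm (\<alpha> (n + m)) * a ^ n) * norm z ^ m" .
  qed
  moreover have "\<alpha> 0 = f 0" by (simp add: \<alpha>_def)
  ultimately show ?thesis using that by blast
qed

text \<open>The integral of \<open>s ^ (2 * j) * exp (- s^2)\<close> over the line, that is, the
  Gamma function at \<open>j + 1/2\<close>.\<close>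

definition gauss_moment :: "nat \<Rightarrow> real" where
  "gauss_moment j = sqrt pi * (fact (2 * j) / (2 ^ (2 * j) * fact j))"

lemma has_bochner_integral_gauss_power:
  assumes r: "r > 0"
  shows "has_bochner_integral lborel (\<lambda>x::real. exp (- (r * x)\<^sup>2) * x ^ n)
    ((if even n then gauss_moment (n div 2) else 0) / r ^ (n + 1))"
proof -
  have 1: "has_bochner_integral lborel (\<lambda>x::real. exp (- x\<^sup>2) * x ^ n) (if even n then gauss_moment (n div 2) else 0)"
  proof (cases "even n")
    case True
    then obtain j where j: "n = 2 * j" by (elim evenE)
    show ?thesis
      using has_bochner_integral_even_function[OF gaussian_moment_even_pos[of j]]
      by (simp add: j gauss_moment_def)
  next
    case False
    then obtain j where j: "n = 2 * j + 1" by (elim oddE)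
    show ?thesis
      using has_bochner_integral_odd_function[OF gaussian_moment_odd_pos[of j]]
      by (simp add: j)
  qed
  have "has_bochner_integral lborel (\<lambda>x::real. exp (- (r * x)\<^sup>2) * (r * x) ^ n)
      ((if even n then gauss_moment (n div 2) else 0) / r)"
    using lborel_has_bochner_integral_real_affine_iff[THEN iffD1, OF _ 1, of r 0] r
    by (simp add: divide_inverse_commute)
  from has_bochner_integral_divide_zero[OF this, of "r ^ n"]
  show ?thesis using r by (simp add: power_mult_distrib field_simps)
qed

lemma half_power_eq:
  assumes "N \<ge> 1" shows "1 / sqrt (real N) ^ (2 * j + 1) = real N powr (- real j - 1/2)"
proof -
  have N: "real N > 0" using assms by simp
  have "sqrt (real N) ^ (2 * j + 1) = (real N powr (1/2)) ^ (2 * j + 1)"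
    using N by (simp add: powr_half_sqrt)
  also have "\<dots> = real N powr (real j + 1/2)"
    unfolding powr_realpow[symmetric, OF powr_gt_zero[of "real N" "1/2", THEN iffD2, OF N[THEN less_imp_neq, symmetric]]]
    by (simp add: powr_powr algebra_simps)
  finally have "1 / sqrt (real N) ^ (2 * j + 1) = 1 / real N powr (real j + 1/2)" by simp
  also have "\<dots> = real N powr (- (real j + 1/2))" by (simp only: powr_minus_divide)
  finally show ?thesis by simp
qed

lemma sum_even_terms:
  fixes f :: "nat \<Rightarrow> real"
  assumes "\<And>n. odd n \<Longrightarrow> f n = 0"
  shows "(\<Sum>n<2 * J. f n) = (\<Sum>j<J. f (2 * j))"
  by (induction J) (auto simp: assms)

text \<open>Watson's lemma for a Gaussian peak: subtracting the Taylor polynomial on the whole line,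
  and not only on \<open>{-a..a}\<close>, avoids tail estimates.\<close>

lemma watson:
  fixes g :: "real \<Rightarrow> real"
  assumes a: "a > 0" and g: "continuous_on {-a..a} g"
    and taylor: "\<And>m. \<exists>K. \<forall>s. \<bar>s\<bar> \<le> a \<longrightarrow> \<bar>g s - (\<Sum>n<m. \<alpha> n * s ^ n)\<bar> \<le> K * \<bar>s\<bar> ^ m"
  shows "has_half_power_expansion (\<lambda>N. integral {-a..a} (\<lambda>s. exp (- real N * s\<^sup>2) * g s))
    (\<lambda>j. \<alpha> (2 * j) * gauss_moment j)"
  unfolding has_half_power_expansion_def
proof
  fix J :: nat
  \<comment> \<open>The odd moments vanish, so \<open>J\<close> terms of the expansion use up
    \<open>2 * J\<close> Taylor coefficients; moreover \<open>s ^ m\<close> is nonnegative because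
    \<open>m\<close> is even.\<close>
  define m where "m = 2 * J"
  obtain K where K: "\<And>s. \<bar>s\<bar> \<le> a \<Longrightarrow> \<bar>g s - (\<Sum>n<m. \<alpha> n * s ^ n)\<bar> \<le> K * \<bar>s\<bar> ^ m"
    using taylor by blast
  \<comment> \<open>For \<open>\<bar>s\<bar> > a\<close> and \<open>n < m\<close> one has
    \<open>\<bar>s\<bar> ^ n \<le> \<bar>s\<bar> ^ m / a ^ (m - n)\<close>, so outside the interval
    the Taylor polynomial itself is of the size of the remainder.\<close>
  define K' where "K' = (\<Sum>n<m. \<bar>\<alpha> n\<bar> / a ^ (m - n))"
  define r where "r s = indicator {-a..a} s * g s - (\<Sum>n<m. \<alpha> n * s ^ n)" for s
  define L where "L = \<bar>K\<bar> + \<bar>K'\<bar>"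
  have r_le: "\<bar>r s\<bar> \<le> L * s ^ m" for s
  proof (cases "\<bar>s\<bar> \<le> a")
    case True
    then have "\<bar>r s\<bar> \<le> K * \<bar>s\<bar> ^ m" using K[OF True] by (simp add: r_def abs_le_iff)
    also have "\<dots> \<le> L * \<bar>s\<bar> ^ m" by (intro mult_right_mono) (auto simp: L_def)
    finally show ?thesis by (simp add: m_def power_even_abs)
  next
    case False
    then have s: "\<bar>s\<bar> > a" by simp
    have "\<bar>r s\<bar> = \<bar>\<Sum>n<m. \<alpha> n * s ^ n\<bar>" using False by (auto simp: r_def indicator_def)
    also have "\<dots> \<le> (\<Sum>n<m. \<bar>\<alpha> n\<bar> / a ^ (m - n) * \<bar>s\<bar> ^ m)"
    proof (rule order_trans[OF sum_abs sum_mono])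
      fix n assume "n \<in> {..<m}"
      then have "m = (m - n) + n" by simp
      then have "\<bar>s\<bar> ^ m = \<bar>s\<bar> ^ (m - n) * \<bar>s\<bar> ^ n" by (metis power_add)
      moreover have "a ^ (m - n) \<le> \<bar>s\<bar> ^ (m - n)" using s a by (intro power_mono) auto
      ultimately have "a ^ (m - n) * \<bar>s\<bar> ^ n \<le> \<bar>s\<bar> ^ m" by (simp add: mult_right_mono)
      then have "\<bar>s\<bar> ^ n \<le> \<bar>s\<bar> ^ m / a ^ (m - n)" using a by (simp add: field_simps)
      from mult_left_mono[OF this, of "\<bar>\<alpha> n\<bar>"]
      show "\<bar>\<alpha> n * s ^ n\<bar> \<le> \<bar>\<alpha> n\<bar> / a ^ (m - n) * \<bar>s\<bar> ^ m" by (simp add: abs_mult power_abs)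
    qed
    also have "\<dots> = K' * \<bar>s\<bar> ^ m" by (simp add: K'_def sum_distrib_right)
    also have "\<dots> \<le> L * \<bar>s\<bar> ^ m" by (intro mult_right_mono) (auto simp: L_def)
    finally show ?thesis by (simp add: m_def power_even_abs)
  qed
  define p where "p n = (if even n then gauss_moment (n div 2) else 0)" for n
  have bound: "\<bar>integral {-a..a} (\<lambda>s. exp (- real N * s\<^sup>2) * g s) - (\<Sum>j<J. \<alpha> (2 * j) * gauss_moment j * real N powr (- real j - 1/2))\<bar>
      \<le> L * gauss_moment J * real N powr (- real J - 1/2)" if N: "N \<ge> 1" for N
  proof -
    define q where "q = sqrt (real N)"
    have q: "q > 0" "q\<^sup>2 = real N" using N by (auto simp: q_def)
    have mom: "has_bochner_integral lborel (\<lambda>s. exp (- real N * s\<^sup>2) * s ^ n) (p n / q ^ (n + 1))" for n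
      using has_bochner_integral_gauss_power[OF q(1), of n] by (simp add: p_def power_mult_distrib q(2))
    have "continuous_on {-a..a} (\<lambda>s. exp (- real N * s\<^sup>2) * g s)"
      by (intro continuous_intros g)
    then have ig: "set_integrable lborel {-a..a} (\<lambda>s. exp (- real N * s\<^sup>2) * g s)"
      by (rule borel_integrable_atLeastAtMost')
    have eqI: "integral {-a..a} (\<lambda>s. exp (- real N * s\<^sup>2) * g s)
        = (\<integral>s. indicator {-a..a} s *\<^sub>R (exp (- real N * s\<^sup>2) * g s) \<partial>lborel)"
      using set_borel_integral_eq_integral(2)[OF ig] by (simp add: set_lebesgue_integral_def)
    have poly: "has_bochner_integral lborel (\<lambda>s. \<Sum>n<m. \<alpha> n * (exp (- real N * s\<^sup>2) * s ^ n)) (\<Sum>n<m. \<alpha> n * (p n / q ^ (n + 1)))"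
      by (intro has_bochner_integral_sum has_bochner_integral_mult_right mom)
    have r_eq: "exp (- real N * s\<^sup>2) * r s = indicator {-a..a} s *\<^sub>R (exp (- real N * s\<^sup>2) * g s) - (\<Sum>n<m. \<alpha> n * (exp (- real N * s\<^sup>2) * s ^ n))" for s
      unfolding r_def right_diff_distrib sum_distrib_left by (simp add: mult_ac)
    have int_r: "has_bochner_integral lborel (\<lambda>s. exp (- real N * s\<^sup>2) * r s)
        (integral {-a..a} (\<lambda>s. exp (- real N * s\<^sup>2) * g s) - (\<Sum>n<m. \<alpha> n * (p n / q ^ (n + 1))))"
      unfolding r_eq eqI using ig
      by (intro has_bochner_integral_diff poly has_bochner_integral_integrable) (simp add: set_integrable_def)
    have "\<bar>integral {-a..a} (\<lambda>s. exp (- real N * s\<^sup>2) * g s) - (\<Sum>n<m. \<alpha> n * (p n / q ^ (n + 1)))\<bar>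
        \<le> (\<integral>s. L * (exp (- real N * s\<^sup>2) * s ^ m) \<partial>lborel)"
      unfolding has_bochner_integral_integral_eq[OF int_r, symmetric]
    proof (rule order_trans[OF integral_abs_bound integral_mono])
      show "integrable lborel (\<lambda>s. \<bar>exp (- real N * s\<^sup>2) * r s\<bar>)"
        using int_r by (auto intro: integrable_abs has_bochner_integral_integrable simp: has_bochner_integral_iff)
      show "integrable lborel (\<lambda>s. L * (exp (- real N * s\<^sup>2) * s ^ m))"
        using mom[of m] by (auto simp: has_bochner_integral_iff)
      show "\<bar>exp (- real N * s\<^sup>2) * r s\<bar> \<le> L * (exp (- real N * s\<^sup>2) * s ^ m)" for s
        using mult_left_mono[OF r_le[of s], of "exp (- real N * s\<^sup>2)"] by (simp add: abs_mult mult_ac)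
    qed
    also have "\<dots> = L * (p m / q ^ (m + 1))"
      using mom[of m] by (simp add: has_bochner_integral_iff)
    also have "p m / q ^ (m + 1) = gauss_moment J * real N powr (- real J - 1/2)"
      unfolding half_power_eq[OF N, of J, symmetric] by (simp add: p_def m_def q_def)
    also have "(\<Sum>n<m. \<alpha> n * (p n / q ^ (n + 1))) = (\<Sum>j<J. \<alpha> (2 * j) * (p (2 * j) / q ^ (2 * j + 1)))"
      unfolding m_def by (rule sum_even_terms) (simp add: p_def)
    also have "\<dots> = (\<Sum>j<J. \<alpha> (2 * j) * gauss_moment j * real N powr (- real j - 1/2))"
    proof (intro sum.cong refl)
      fix j
      show "\<alpha> (2 * j) * (p (2 * j) / q ^ (2 * j + 1)) = \<alpha> (2 * j) * gauss_moment j * real N powr (- real j - 1/2)"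
        unfolding half_power_eq[OF N, of j, symmetric] by (simp add: p_def q_def)
    qed
    finally show ?thesis by (simp only: mult.assoc)
  qed
  show "(\<lambda>N. integral {-a..a} (\<lambda>s. exp (- real N * s\<^sup>2) * g s) - (\<Sum>j<J. \<alpha> (2 * j) * gauss_moment j * real N powr (- real j - 1/2)))
      \<in> O(\<lambda>N. real N powr (- real J - 1/2))"
  proof (rule bigoI[of _ "L * gauss_moment J"], rule eventually_sequentiallyI[of 1])
    fix N :: nat assume "1 \<le> N"
    from bound[OF this] show "norm (integral {-a..a} (\<lambda>s. exp (- real N * s\<^sup>2) * g s) - (\<Sum>j<J. \<alpha> (2 * j) * gauss_moment j * real N powr (- real j - 1/2)))
      \<le> L * gauss_moment J * norm (real N powr (- real J - 1/2))" by simp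
  qed
qed

lemma half_power_expansion_cmult:
  assumes "has_half_power_expansion a c"
  shows "has_half_power_expansion (\<lambda>N. x * a N) (\<lambda>j. x * c j)"
  unfolding has_half_power_expansion_def
proof
  fix J
  have "(\<lambda>N. x * (a N - (\<Sum>j<J. c j * real N powr (- real j - 1/2)))) \<in> O(\<lambda>N. real N powr (- real J - 1/2))"
    using assms by (cases "x = 0") (simp_all add: has_half_power_expansion_def)
  then show "(\<lambda>N. x * a N - (\<Sum>j<J. x * c j * real N powr (- real j - 1/2))) \<in> O(\<lambda>N. real N powr (- real J - 1/2))"
    by (simp add: right_diff_distrib sum_distrib_left mult.assoc)
qed

lemma half_power_expansion_add_exp_small:
  assumes "has_half_power_expansion a c" and d: "d \<in> O(\<lambda>N. exp (- b * real N))" and b: "b > 0"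
  shows "has_half_power_expansion (\<lambda>N. a N + d N) c"
  unfolding has_half_power_expansion_def
proof
  fix J
  have "(\<lambda>N. exp (- b * real N)) \<in> O(\<lambda>N. real N powr (- real J - 1/2))"
    using b by real_asymp
  then have d2: "d \<in> O(\<lambda>N. real N powr (- real J - 1/2))"
    using d landau_o.big_trans by blast
  then have "(\<lambda>N. (a N - (\<Sum>j<J. c j * real N powr (- real j - 1/2))) + d N) \<in> O(\<lambda>N. real N powr (- real J - 1/2))"
    using assms(1) by (intro sum_in_bigo(1)[OF _ d2]) (simp add: has_half_power_expansion_def)
  then show "(\<lambda>N. a N + d N - (\<Sum>j<J. c j * real N powr (- real j - 1/2))) \<in> O(\<lambda>N. real N powr (- real J - 1/2))"
    by (simp add: algebra_simps)
qed

section \<open>The mean over the circle and its expansion\<close>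

lemma has_integral_cis_int:
  "((\<lambda>t. cis (of_int m * t)) has_integral (if m = 0 then 2 * of_real pi else 0)) {-pi..pi}"
proof (cases "m = 0")
  case True
  then show ?thesis using has_integral_const_real[of "1::complex" "-pi" pi] by (simp add: scaleR_conv_of_real)
next
  case False
  have "((\<lambda>t. cis (of_int m * t)) has_integral
      cis (of_int m * pi) / (\<i> * of_int m) - cis (of_int m * (- pi)) / (\<i> * of_int m)) {-pi..pi}"
  proof (rule fundamental_theorem_of_calculus)
    fix t :: real
    have "((\<lambda>z. exp (c * z) / c) has_field_derivative exp (c * of_real t)) (at (of_real t))" if "c \<noteq> 0" for c
      using that by (auto intro!: derivative_eq_intros)
    from has_vector_derivative_real_field[OF this, of "\<i> * of_int m" UNIV] False
    show "((\<lambda>t. cis (of_int m * t) / (\<i> * of_int m)) has_vector_derivative cis (of_int m * t)) (at t within {-pi..pi})"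
      by (simp add: cis_conv_exp has_vector_derivative_at_within mult.assoc)
  qed simp
  moreover have "cis (of_int m * pi) = cis (of_int m * (- pi))"
    by (simp add: cis.ctr complex_eq_iff mult.commute sin_int_times_real)
  ultimately show ?thesis using False by simp
qed

text \<open>Expanding \<open>((cis t + cis (- t)) / 2) ^ l\<close>, only the constant frequency
  survives integration; it occurs for even \<open>l\<close> and carries the central binomial
  coefficient.\<close>

lemma has_integral_cos_power:
  "((\<lambda>t. cos t ^ l) has_integral 2 * pi * (if even l then real (l choose (l div 2)) / 2 ^ l else 0)) {-pi..pi}"
proof -
  have cos: "complex_of_real (cos t ^ l) = (\<Sum>j\<le>l. of_nat (l choose j) / 2 ^ l * cis (of_int (2 * int j - int l) * t))" for t
  proof -
    have "complex_of_real (cos t) = (cis t + cis (- t)) / 2"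
      by (simp add: complex_eq_iff)
    then have "complex_of_real (cos t ^ l) = (cis t + cis (- t)) ^ l / 2 ^ l"
      by (simp only: of_real_power power_divide)
    also have "(cis t + cis (- t)) ^ l = (\<Sum>j\<le>l. of_nat (l choose j) * cis t ^ j * cis (- t) ^ (l - j))"
      by (rule binomial_ring)
    also have "\<dots> = (\<Sum>j\<le>l. of_nat (l choose j) * cis (of_int (2 * int j - int l) * t))"
    proof (intro sum.cong refl)
      fix j assume "j \<in> {..l}"
      then have "real j * t + real (l - j) * (- t) = of_int (2 * int j - int l) * t"
        by (simp add: of_nat_diff algebra_simps)
      then show "of_nat (l choose j) * cis t ^ j * cis (- t) ^ (l - j) = of_nat (l choose j) * cis (of_int (2 * int j - int l) * t)"
        by (simp only: Complex.DeMoivre mult.assoc cis_mult)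
    qed
    finally show ?thesis by (simp add: sum_divide_distrib)
  qed
  have "((\<lambda>t. complex_of_real (cos t ^ l)) has_integral
      (\<Sum>j\<le>l. of_nat (l choose j) / 2 ^ l * (if 2 * int j - int l = 0 then 2 * of_real pi else 0))) {-pi..pi}"
    unfolding cos by (intro has_integral_sum has_integral_mult_right has_integral_cis_int) simp
  from has_integral_linear[OF this bounded_linear_Re]
  have "((\<lambda>t. cos t ^ l) has_integral
      Re (\<Sum>j\<le>l. of_nat (l choose j) / 2 ^ l * (if 2 * int j - int l = 0 then 2 * of_real pi else 0))) {-pi..pi}"
    by (simp add: o_def del: of_real_power)
  moreover have "(\<Sum>j\<le>l. of_nat (l choose j) / 2 ^ l * (if 2 * int j - int l = 0 then 2 * of_real pi else 0))
      = complex_of_real (2 * pi * (if even l then real (l choose (l div 2)) / 2 ^ l else 0))"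
  proof (cases "even l")
    case True
    then obtain i where i: "l = 2 * i" by (elim evenE)
    have "(\<Sum>j\<le>l. of_nat (l choose j) / 2 ^ l * (if 2 * int j - int l = 0 then 2 * of_real pi else 0))
      = (\<Sum>j\<le>l. if j = i then of_nat (l choose i) / 2 ^ l * (2 * complex_of_real pi) else 0)"
      by (intro sum.cong refl) (auto simp: i)
    then show ?thesis using True by (simp add: i)
  next
    case False
    have "2 * int j - int l \<noteq> 0" for j
      using False by presburger
    then show ?thesis using False by simp
  qed
  ultimately show ?thesis by (simp only: Re_complex_of_real)
qed

lemma has_integral_circle_mean:
  "((\<lambda>t. (1 + c * cos t) ^ N) has_integral 2 * pi * circle_mean N c) {-pi..pi}"
proof -
  have "((\<lambda>t. \<Sum>l\<le>N. real (N choose l) * c ^ l * cos t ^ l) has_integral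
      (\<Sum>l\<le>N. real (N choose l) * c ^ l * (2 * pi * (if even l then real (l choose (l div 2)) / 2 ^ l else 0)))) {-pi..pi}"
    by (intro has_integral_sum has_integral_mult_right has_integral_cos_power) simp
  moreover have "(1 + c * cos t) ^ N = (\<Sum>l\<le>N. real (N choose l) * c ^ l * cos t ^ l)" for t
    using binomial_ring[of "c * cos t" 1 N] by (simp add: power_mult_distrib add.commute mult.assoc)
  ultimately show ?thesis
    by (simp add: circle_mean_def sum_distrib_left mult_ac)
qed

text \<open>The substitution \<open>\<theta> = 2 arcsin (s sqrt (exp_quot (s\<^sup>2) / k))\<close> turns
  \<open>1 - k sin\<^sup>2 (\<theta> / 2)\<close> into \<open>exp (- s\<^sup>2)\<close> and is holomorphic near \<open>0\<close>.\<close>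

definition exp_quot :: "complex \<Rightarrow> complex" where
  "exp_quot w = (if w = 0 then 1 else (1 - exp (- w)) / w)"

lemma exp_quot_holomorphic: "exp_quot holomorphic_on UNIV"
proof -
  have "(\<lambda>w::complex. 1 - exp (- w)) holomorphic_on UNIV" by (intro holomorphic_intros)
  from pole_lemma_open[OF this open_UNIV, of 0]
  have "(\<lambda>w. if w = 0 then deriv (\<lambda>w. 1 - exp (- w)) 0 else (1 - exp (- w)) / w) holomorphic_on UNIV"
    by (simp only: minus_zero exp_zero diff_self diff_zero)
  note hol = this
  have d: "deriv (\<lambda>w::complex. 1 - exp (- w)) 0 = 1"
    by (rule DERIV_imp_deriv) (auto intro!: derivative_eq_intros)
  show ?thesis using hol unfolding d exp_quot_def[abs_def] .
qed

text \<open>The equation \<open>k * sin (\<theta> / 2)^2 = 1 - exp (- s^2)\<close> is solved without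
  a branch point at the origin, because \<open>s^2\<close> is split off before the square root is
  taken. \<Theta> is the complex derivative of the substitution; its real values are the Jacobian,
  and its holomorphy provides the Taylor bounds for Watson's lemma.\<close>

lemma peak_coordinate:
  fixes k :: real
  assumes k: "0 < k" "k < 1"
  obtains \<Theta> a b \<theta> where "a > 0" "0 < b" "b < pi"
    "\<Theta> holomorphic_on ball 0 (2 * a)" "\<Theta> 0 = of_real (2 / sqrt k)"
    "\<And>s. \<bar>s\<bar> \<le> a \<Longrightarrow> (\<theta> has_real_derivative Re (\<Theta> (of_real s))) (at s within {-a..a})"
    "\<And>s. \<bar>s\<bar> \<le> a \<Longrightarrow> 1 - k * (sin (\<theta> s / 2))\<^sup>2 = exp (- s\<^sup>2)"
    "\<And>s. \<bar>s\<bar> \<le> a \<Longrightarrow> \<bar>\<theta> s\<bar> \<le> pi" "\<theta> a = b" "\<theta> (- a) = - b"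
proof -
  define G where "G z = csqrt (exp_quot (z\<^sup>2) / of_real k)" for z
  define \<Phi> where "\<Phi> z = 2 * Arcsin (z * G z)" for z
  have "(exp_quot \<circ> (\<lambda>z. z\<^sup>2)) holomorphic_on UNIV"
    by (rule holomorphic_on_compose)
      (auto intro: holomorphic_intros holomorphic_on_subset[OF exp_quot_holomorphic])
  then have cE: "(\<lambda>z. exp_quot (z\<^sup>2)) holomorphic_on UNIV" by (simp add: o_def)
  then have "isCont (\<lambda>z. exp_quot (z\<^sup>2)) 0"
    using continuous_on_eq_continuous_at holomorphic_on_imp_continuous_on by blast
  then obtain \<rho>1 where \<rho>1: "\<rho>1 > 0" "\<And>z. norm z < \<rho>1 \<Longrightarrow> norm (exp_quot (z\<^sup>2) - 1) < 1"
    unfolding continuous_at_eps_delta by (auto simp: dist_norm exp_quot_def dest: spec[of _ 1])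
  \<comment> \<open>Near the origin \<open>exp_quot\<close> has positive real part, which keeps the
    square root off its branch cut.\<close>
  have G_nonpos: "exp_quot (z\<^sup>2) / of_real k \<notin> \<real>\<^sub>\<le>\<^sub>0" if "norm z < \<rho>1" for z
  proof -
    have "\<bar>Re (exp_quot (z\<^sup>2) - 1)\<bar> < 1" using \<rho>1(2)[OF that] abs_Re_le_cmod order_le_less_trans by blast
    then have "Re (exp_quot (z\<^sup>2)) > 0" by simp
    then have "Re (exp_quot (z\<^sup>2) / of_real k) > 0" using k by simp
    then show ?thesis using complex_nonpos_Reals_iff by force
  qed
  have hG: "G holomorphic_on ball 0 \<rho>1"
    unfolding G_def using k
    by (intro holomorphic_on_csqrt' holomorphic_intros holomorphic_on_subset[OF cE] G_nonpos) auto
  have hzG: "(\<lambda>z. z * G z) holomorphic_on ball 0 \<rho>1" by (intro holomorphic_intros hG)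
  then have "isCont (\<lambda>z. z * G z) 0"
    using \<rho>1(1) holomorphic_on_imp_continuous_on continuous_on_eq_continuous_at[of "ball 0 \<rho>1"] by force
  then obtain \<rho>2 where \<rho>2: "\<rho>2 > 0" "\<And>z. norm z < \<rho>2 \<Longrightarrow> norm (z * G z) < 1"
    unfolding continuous_at_eps_delta by (auto simp: dist_norm dest: spec[of _ 1])
  \<comment> \<open>Half of the admissible radius, so that the substitution is holomorphic on a ball
    strictly larger than the closed one of radius \<open>a\<close>.\<close>
  define a where "a = min \<rho>1 \<rho>2 / 2"
  have a: "a > 0" using \<rho>1 \<rho>2 by (simp add: a_def)
  have in2: "norm z < \<rho>1" "norm z < \<rho>2" if "norm z < 2 * a" for z :: complex using that by (auto simp: a_def)
  have h\<Phi>: "\<Phi> holomorphic_on ball 0 (2 * a)"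
  proof -
    have "Arcsin holomorphic_on ball 0 1"
      by (rule holomorphic_on_Arcsin) (use abs_Re_le_cmod order_le_less_trans in fastforce)
    moreover have "(\<lambda>z. z * G z) ` ball 0 (2 * a) \<subseteq> ball 0 1" using \<rho>2 in2 by auto
    ultimately have "(Arcsin \<circ> (\<lambda>z. z * G z)) holomorphic_on ball 0 (2 * a)"
      by (intro holomorphic_on_compose_gen[OF holomorphic_on_subset[OF hzG]]) (auto intro: in2)
    then show ?thesis unfolding \<Phi>_def by (auto simp: o_def intro: holomorphic_intros)
  qed
  define g where "g s = Re (of_real s * G (of_real s))" for s
  \<comment> \<open>For real \<open>s\<close> the quotient \<open>exp_quot (s^2)\<close> is a
    positive real number and even in \<open>s\<close>; hence the complex square root is the real one
    and \<open>g\<close> is odd.\<close>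
  have greal: "of_real s * G (of_real s) = of_real (g s)" and g2: "k * (g s)\<^sup>2 = 1 - exp (- s\<^sup>2)"
    and godd: "g (- s) = - g s" and g1: "\<bar>g s\<bar> < 1" and gpos: "s > 0 \<Longrightarrow> g s > 0" if s: "\<bar>s\<bar> < 2 * a" for s
  proof -
    define E where "E = (if s = 0 then 1 else (1 - exp (- s\<^sup>2)) / s\<^sup>2)"
    have E: "exp_quot ((of_real s)\<^sup>2) = of_real E"
    proof -
      have "exp (- ((complex_of_real s)\<^sup>2)) = of_real (exp (- s\<^sup>2))"
        by (simp add: exp_of_real[symmetric])
      then show ?thesis by (simp add: exp_quot_def E_def)
    qed
    have Epos: "E > 0" by (auto simp: E_def)
    have G: "G (of_real s) = of_real (sqrt (E / k))"
      unfolding G_def E of_real_divide[symmetric] using Epos k by (intro of_real_sqrt[symmetric]) auto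
    then show gr: "of_real s * G (of_real s) = of_real (g s)" by (simp add: g_def)
    have gs: "g s = s * sqrt (E / k)" by (simp add: g_def G)
    have "k * (g s)\<^sup>2 = s\<^sup>2 * E" using Epos k by (simp add: gs power_mult_distrib)
    also have "\<dots> = 1 - exp (- s\<^sup>2)" by (simp add: E_def)
    finally show "k * (g s)\<^sup>2 = 1 - exp (- s\<^sup>2)" .
    have "G (of_real (- s)) = G (of_real s)" by (simp add: G_def)
    then show "g (- s) = - g s" by (simp add: g_def)
    show "s > 0 \<Longrightarrow> g s > 0" using Epos k by (simp add: gs)
    have "norm (of_real s * G (of_real s)) < 1" using s in2[of "of_real s"] by (intro \<rho>2) auto
    then show "\<bar>g s\<bar> < 1" by (simp add: gr)
  qed
  define \<theta> where "\<theta> s = 2 * arcsin (g s)" for s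
  have \<Phi>\<theta>: "\<Phi> (of_real s) = of_real (\<theta> s)" if "\<bar>s\<bar> < 2 * a" for s
    using greal[OF that] g1[OF that] of_real_arcsin[of "g s"] by (simp add: \<Phi>_def \<theta>_def)
  have sin\<theta>: "sin (\<theta> s / 2) = g s" if "\<bar>s\<bar> < 2 * a" for s
    using g1[OF that] by (simp add: \<theta>_def)
  show ?thesis
  proof (rule that[of a "\<theta> a" "deriv \<Phi>" \<theta>])
    have a2: "\<bar>a\<bar> < 2 * a" using a by simp
    show "a > 0" by fact
    show "0 < \<theta> a" using arcsin_less_arcsin[of 0 "g a"] gpos[OF a2 a] g1[OF a2] by (simp add: \<theta>_def)
    show "\<theta> a < pi" using arcsin_less_arcsin[of "g a" 1] g1[OF a2] by (simp add: \<theta>_def abs_less_iff)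
    show "deriv \<Phi> holomorphic_on ball 0 (2 * a)" by (intro holomorphic_deriv h\<Phi>) auto
    show "deriv \<Phi> 0 = of_real (2 / sqrt k)"
    proof (rule DERIV_imp_deriv)
      obtain G' where G': "(G has_field_derivative G') (at 0)"
        using hG \<rho>1(1) by (metis centre_in_ball field_differentiable_def holomorphic_on_imp_differentiable_at open_ball)
      have G0: "G 0 = of_real (1 / sqrt k)"
      proof -
        have "G 0 = csqrt (of_real (1 / k))" by (simp add: G_def exp_quot_def)
        also have "\<dots> = of_real (sqrt (1 / k))" using k by (intro of_real_sqrt[symmetric]) auto
        finally show ?thesis by (simp add: real_sqrt_divide)
      qed
      have "((\<lambda>z. z * G z) has_field_derivative (of_real (1 / sqrt k))) (at 0)"
        using DERIV_mult[OF DERIV_ident G'] by (simp add: G0)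
      moreover have "(Arcsin has_field_derivative 1) (at (0 * G 0))"
        using has_field_derivative_Arcsin[of 0] by simp
      ultimately have "((\<lambda>z. Arcsin (z * G z)) has_field_derivative 1 * of_real (1 / sqrt k)) (at 0)"
        by (rule DERIV_chain2[rotated])
      from DERIV_cmult[OF this, of 2] show "(\<Phi> has_field_derivative of_real (2 / sqrt k)) (at 0)"
        by (simp add: \<Phi>_def[abs_def])
    qed
    show "(\<theta> has_real_derivative Re (deriv \<Phi> (of_real s))) (at s within {-a..a})" if s: "\<bar>s\<bar> \<le> a" for s
    proof -
      have s2: "\<bar>s\<bar> < 2 * a" using s a by simp
      have "(\<Phi> has_field_derivative deriv \<Phi> (of_real s)) (at (of_real s))"
        using h\<Phi> s2 by (intro holomorphic_derivI[of _ "ball 0 (2 * a)"]) auto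
      from has_vector_derivative_real_field[OF this]
      have "((\<lambda>s. \<Phi> (of_real s)) has_vector_derivative deriv \<Phi> (of_real s)) (at s)" .
      from bounded_linear.has_vector_derivative[OF bounded_linear_Re this]
      have "((\<lambda>s. Re (\<Phi> (of_real s))) has_real_derivative Re (deriv \<Phi> (of_real s))) (at s)"
        by (simp add: has_real_derivative_iff_has_vector_derivative)
      then have "(\<theta> has_real_derivative Re (deriv \<Phi> (of_real s))) (at s)"
        by (rule has_field_derivative_transform_within_open[of _ _ _ "{- 2 * a<..<2 * a}"])
          (use s2 \<Phi>\<theta> in auto)
      then show ?thesis by (rule has_field_derivative_at_within)
    qed
    show "1 - k * (sin (\<theta> s / 2))\<^sup>2 = exp (- s\<^sup>2)" if "\<bar>s\<bar> \<le> a" for s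
      using that a g2[of s] sin\<theta>[of s] by simp
    show "\<bar>\<theta> s\<bar> \<le> pi" if s: "\<bar>s\<bar> \<le> a" for s
    proof -
      have "\<bar>g s\<bar> < 1" using s a by (intro g1) auto
      then have "- (pi / 2) \<le> arcsin (g s) \<and> arcsin (g s) \<le> pi / 2"
        by (intro arcsin_bounded) (auto simp: abs_less_iff)
      then show ?thesis by (simp add: \<theta>_def abs_le_iff)
    qed
    show "\<theta> (- a) = - \<theta> a"
      using godd[OF a2] g1[OF a2] by (simp add: \<theta>_def arcsin_minus)
  qed simp
qed

text \<open>With \<open>k = 2 * c / (1 + c)\<close>, the normalised integrand
  \<open>(1 + c * cos t) / (1 + c)\<close> equals \<open>1 - k * sin (t / 2)^2\<close>, whose only
  maximum on the circle is at \<open>t = 0\<close>. The arc from \<open>- b\<close> to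
  \<open>b\<close> becomes a Gaussian integral, and the rest is exponentially small.\<close>

lemma circle_mean_expansion:
  assumes c: "0 < c" "c < 1"
  obtains \<alpha> where "has_half_power_expansion (\<lambda>N. circle_mean N c / (1 + c) ^ N) \<alpha>"
    "\<alpha> 0 = 1 / (sqrt pi * sqrt (2 * c / (1 + c)))"
proof -
  define k where "k = 2 * c / (1 + c)"
  have k: "0 < k" "k < 1" using c by (auto simp: k_def field_simps)
  obtain \<Theta> a b \<theta> where P: "a > 0" "0 < b" "b < pi"
    "\<Theta> holomorphic_on ball 0 (2 * a)" "\<Theta> 0 = of_real (2 / sqrt k)"
    "\<And>s. \<bar>s\<bar> \<le> a \<Longrightarrow> (\<theta> has_real_derivative Re (\<Theta> (of_real s))) (at s within {-a..a})"
    "\<And>s. \<bar>s\<bar> \<le> a \<Longrightarrow> 1 - k * (sin (\<theta> s / 2))\<^sup>2 = exp (- s\<^sup>2)"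
    "\<And>s. \<bar>s\<bar> \<le> a \<Longrightarrow> \<bar>\<theta> s\<bar> \<le> pi" "\<theta> a = b" "\<theta> (- a) = - b"
    using peak_coordinate[OF k] by metis
  obtain A where A: "A 0 = \<Theta> 0"
    "\<And>m. \<exists>K. \<forall>z. norm z \<le> a \<longrightarrow> norm (\<Theta> z - (\<Sum>n<m. A n * z ^ n)) \<le> K * norm z ^ m"
    using holomorphic_taylor_bound[OF P(4), of a] P(1) by auto
  define g where "g s = Re (\<Theta> (of_real s))" for s
  have cont: "continuous_on {-a..a} g"
  proof -
    have "continuous_on (ball 0 (2 * a)) \<Theta>" by (rule holomorphic_on_imp_continuous_on[OF P(4)])
    then have "continuous_on {-a..a} (\<lambda>s. \<Theta> (of_real s))"
      by (rule continuous_on_compose2) (use P(1) in \<open>auto intro!: continuous_intros\<close>)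
    then show ?thesis unfolding g_def by (rule continuous_on_Re)
  qed
  have "has_half_power_expansion (\<lambda>N. integral {-a..a} (\<lambda>s. exp (- real N * s\<^sup>2) * g s))
      (\<lambda>j. Re (A (2 * j)) * gauss_moment j)"
  proof (rule watson[OF P(1) cont])
    fix m
    obtain K where K: "\<And>z. norm z \<le> a \<Longrightarrow> norm (\<Theta> z - (\<Sum>n<m. A n * z ^ n)) \<le> K * norm z ^ m"
      using A(2) by blast
    have "\<bar>g s - (\<Sum>n<m. Re (A n) * s ^ n)\<bar> \<le> K * \<bar>s\<bar> ^ m" if "\<bar>s\<bar> \<le> a" for s
    proof -
      have "g s - (\<Sum>n<m. Re (A n) * s ^ n) = Re (\<Theta> (of_real s) - (\<Sum>n<m. A n * of_real s ^ n))"
        by (simp add: g_def flip: of_real_power)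
      also have "\<bar>\<dots>\<bar> \<le> K * \<bar>s\<bar> ^ m"
        using order_trans[OF abs_Re_le_cmod K[of "of_real s"]] that by simp
      finally show ?thesis .
    qed
    then show "\<exists>K. \<forall>s. \<bar>s\<bar> \<le> a \<longrightarrow> \<bar>g s - (\<Sum>n<m. Re (A n) * s ^ n)\<bar> \<le> K * \<bar>s\<bar> ^ m" by blast
  qed
  note W = this
  define F where "F N t = (1 - k * (sin (t / 2))\<^sup>2) ^ N" for N :: nat and t
  have cF: "continuous_on S (F N)" for S N unfolding F_def by (intro continuous_intros) auto
  have F01: "0 \<le> 1 - k * (sin (t / 2))\<^sup>2" for t
  proof -
    have "k * (sin (t / 2))\<^sup>2 \<le> 1 * 1" using k by (intro mult_mono) (auto simp: abs_square_le_1)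
    then show ?thesis by simp
  qed
  have peak: "integral {-b..b} (F N) = integral {-a..a} (\<lambda>s. exp (- real N * s\<^sup>2) * g s)" for N
  proof -
    have "((\<lambda>s. g s *\<^sub>R F N (\<theta> s)) has_integral (integral {\<theta> (- a)..\<theta> a} (F N))) {-a..a}"
    proof (rule has_integral_substitution[where c = "- pi" and d = pi])
      show "\<theta> ` {- a..a} \<subseteq> {- pi..pi}" using P(8) by (force simp: abs_le_iff)
      show "continuous_on {- pi..pi} (F N)" by (rule cF)
      show "(\<theta> has_real_derivative g s) (at s within {- a..a})" if "s \<in> {- a..a}" for s
        using that P(6)[of s] by (simp add: g_def abs_le_iff)
    qed (use P in auto)
    then have "integral {-b..b} (F N) = integral {-a..a} (\<lambda>s. g s *\<^sub>R F N (\<theta> s))"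
      using P(9,10) by (simp add: integral_unique)
    also have "\<dots> = integral {-a..a} (\<lambda>s. exp (- real N * s\<^sup>2) * g s)"
    proof (rule integral_cong)
      fix s assume "s \<in> {-a..a}"
      then have "F N (\<theta> s) = exp (- s\<^sup>2) ^ N" using P(7)[of s] by (simp add: F_def abs_le_iff)
      then show "g s *\<^sub>R F N (\<theta> s) = exp (- real N * s\<^sup>2) * g s"
        by (simp add: exp_of_nat_mult[symmetric])
    qed
    finally show ?thesis .
  qed
  have total: "circle_mean N c / (1 + c) ^ N = 1 / (2 * pi) * integral {-pi..pi} (F N)" for N
  proof -
    have "F N t = (1 + c * cos t) ^ N / (1 + c) ^ N" for t
    proof -
      have "cos t = 1 - 2 * (sin (t / 2))\<^sup>2" using cos_double_sin[of "t / 2"] by simp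
      then have "(1 + c * cos t) / (1 + c) = (1 + c * (1 - 2 * (sin (t / 2))\<^sup>2)) / (1 + c)"
        by (simp only:)
      also have "\<dots> = 1 - k * (sin (t / 2))\<^sup>2"
        using c by (simp add: k_def field_simps)
      finally have "1 - k * (sin (t / 2))\<^sup>2 = (1 + c * cos t) / (1 + c)" ..
      then show ?thesis by (simp add: F_def power_divide)
    qed
    then have "(F N has_integral 2 * pi * circle_mean N c / (1 + c) ^ N) {-pi..pi}"
      using has_integral_divide[OF has_integral_circle_mean] by (metis (no_types, lifting) ext)
    then show ?thesis by (simp add: integral_unique)
  qed
  define d where "d N = integral {-pi..-b} (F N) + integral {b..pi} (F N)" for N
  have split: "integral {-pi..pi} (F N) = integral {-b..b} (F N) + d N" for N
  proof -
    have i: "F N integrable_on {x..y}" for x y by (rule integrable_continuous_real[OF cF])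
    have "integral {-pi..pi} (F N) = integral {-pi..b} (F N) + integral {b..pi} (F N)"
      by (rule Henstock_Kurzweil_Integration.integral_combine[symmetric, OF _ _ i]) (use P(2,3) in auto)
    also have "integral {-pi..b} (F N) = integral {-pi..-b} (F N) + integral {-b..b} (F N)"
      by (rule Henstock_Kurzweil_Integration.integral_combine[symmetric, OF _ _ i]) (use P(2,3) in auto)
    finally show ?thesis by (simp add: d_def)
  qed
  \<comment> \<open>The substitution sends \<open>a\<close> to \<open>b\<close>, so at
    \<open>\<bar>t\<bar> = b\<close> the base of the power is exactly \<open>exp (- a^2)\<close>;
    farther out the sine of the half angle only grows.\<close>
  have F_le: "norm (F N t) \<le> exp (- a\<^sup>2 * real N)" if t: "b \<le> \<bar>t\<bar>" "\<bar>t\<bar> \<le> pi" for N t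
  proof -
    have "sin (b / 2) \<le> sin (\<bar>t\<bar> / 2)" using t P by (intro sin_monotone_2pi_le) auto
    moreover have "sin (b / 2) \<ge> 0" using P by (intro sin_ge_zero) auto
    ultimately have "(sin (b / 2))\<^sup>2 \<le> (sin (\<bar>t\<bar> / 2))\<^sup>2" by (rule power_mono)
    also have "(sin (\<bar>t\<bar> / 2))\<^sup>2 = (sin (t / 2))\<^sup>2" by (cases "t \<ge> 0") auto
    finally have "1 - k * (sin (t / 2))\<^sup>2 \<le> 1 - k * (sin (b / 2))\<^sup>2" using k by simp
    also have "\<dots> = exp (- a\<^sup>2)" using P(7)[of a] P(1,9) by simp
    finally have "F N t \<le> exp (- a\<^sup>2) ^ N" unfolding F_def by (intro power_mono F01)
    moreover have "F N t \<ge> 0" unfolding F_def by (intro zero_le_power F01)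
    ultimately show ?thesis by (simp add: exp_of_nat_mult[symmetric] mult.commute)
  qed
  have d: "d \<in> O(\<lambda>N. exp (- a\<^sup>2 * real N))"
  proof (rule bigoI[of _ "2 * pi"], rule always_eventually, rule allI)
    fix N
    have "norm (integral {-pi..-b} (F N)) \<le> exp (- a\<^sup>2 * real N) * (- b - (- pi))"
      by (rule integral_bound) (use P cF F_le in \<open>auto simp: abs_le_iff\<close>)
    moreover have "norm (integral {b..pi} (F N)) \<le> exp (- a\<^sup>2 * real N) * (pi - b)"
      by (rule integral_bound) (use P cF F_le in \<open>auto simp: abs_le_iff\<close>)
    ultimately have "norm (d N) \<le> exp (- a\<^sup>2 * real N) * (- b - (- pi)) + exp (- a\<^sup>2 * real N) * (pi - b)"
      unfolding d_def by (rule norm_triangle_mono)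
    also have "\<dots> = exp (- a\<^sup>2 * real N) * (2 * (pi - b))" by (simp add: algebra_simps)
    also have "\<dots> \<le> exp (- a\<^sup>2 * real N) * (2 * pi)" using P by (intro mult_left_mono) auto
    finally show "norm (d N) \<le> 2 * pi * norm (exp (- a\<^sup>2 * real N))" by (simp add: mult.commute)
  qed
  have "has_half_power_expansion (\<lambda>N. 1 / (2 * pi) * (integral {-a..a} (\<lambda>s. exp (- real N * s\<^sup>2) * g s) + d N))
      (\<lambda>j. 1 / (2 * pi) * (Re (A (2 * j)) * gauss_moment j))"
    by (intro half_power_expansion_cmult half_power_expansion_add_exp_small[OF W d]) (use P in simp)
  then have "has_half_power_expansion (\<lambda>N. circle_mean N c / (1 + c) ^ N)
      (\<lambda>j. 1 / (2 * pi) * (Re (A (2 * j)) * gauss_moment j))"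
    unfolding total split peak .
  \<comment> \<open>The three factors are the normalisation of the mean, the Jacobian
    \<open>2 / sqrt k\<close> at the peak and the zeroth moment \<open>sqrt pi\<close>.\<close>
  moreover have "1 / (2 * pi) * (Re (A (2 * 0)) * gauss_moment 0) = 1 / (sqrt pi * sqrt (2 * c / (1 + c)))"
  proof -
    have "1 / (2 * pi) * (2 / r * sqrt pi) = 1 / (sqrt pi * r)" if "r > 0" for r
      using that by (simp add: field_simps)
    from this[of "sqrt k"] show ?thesis using k by (simp add: A(1) P(5) gauss_moment_def k_def)
  qed
  ultimately show ?thesis using that by blast
qed


section \<open>The norm of the spectral projections\<close>

lemma circle_mean_nonneg: "c \<ge> 0 \<Longrightarrow> circle_mean N c \<ge> 0"
  unfolding circle_mean_def by (intro sum_nonneg) auto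

context gauss_weyl
begin

text \<open>This is the modulus of \<open>C_plus\<close>, rewritten from the roots
  \<open>2 \<i> \<sigma>\<close> and \<open>- 2 \<i> \<tau>\<close>.\<close>

definition C_mod :: real where "C_mod = cmod (\<sigma> - cnj \<tau>) / cmod \<gamma>"

lemma one_minus_C_mod_power2: "1 - C_mod\<^sup>2 = 4 * Re \<sigma> * Re \<tau> / (cmod \<gamma>)\<^sup>2"
proof -
  have "(cmod \<gamma>)\<^sup>2 - (cmod (\<sigma> - cnj \<tau>))\<^sup>2 = 4 * Re \<sigma> * Re \<tau>"
    unfolding cmod_power2 \<gamma>_def by (simp add: power2_eq_square algebra_simps)
  then show ?thesis using \<gamma>_nz by (simp add: C_mod_def power_divide diff_divide_eq_iff)
qed

lemma C_mod_less_1: "C_mod < 1"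
proof -
  have "1 - C_mod\<^sup>2 > 0" using Re_\<sigma> Re_\<tau> \<gamma>_nz by (simp add: one_minus_C_mod_power2)
  then show ?thesis using power2_less_imp_less[of C_mod 1] by simp
qed

text \<open>Both Gaussian weights lead to the same circle mean, because
  \<open>2 * Re \<sigma> - \<gamma>\<close> and \<open>2 * Re \<tau> - \<gamma>\<close> have the
  same modulus as \<open>\<sigma> - cnj \<tau>\<close>. Squares are used because the integrals give
  squared norms.\<close>

lemma norm_spectral_projection_power2:
  "(norm (spectral_projection A (level N)))\<^sup>2
    = (circle_mean N C_mod)\<^sup>2 * (1 / (1 - C_mod\<^sup>2)) ^ N * sqrt (1 / (1 - C_mod\<^sup>2))"
proof -
  define x y where "x = 2 * Re \<sigma>" and "y = 2 * Re \<tau>"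
  have xy: "x > 0" "y > 0" using Re_\<sigma> Re_\<tau> by (auto simp: x_def y_def)
  define G where "G = cmod \<gamma>"
  have G: "G > 0" using \<gamma>_nz by (simp add: G_def)
  define T where "T = circle_mean N C_mod"

  have c1: "cmod (of_real x - \<gamma>) / cmod \<gamma> = C_mod"
  proof -
    have "of_real x - \<gamma> = cnj (\<sigma> - cnj \<tau>)" by (simp add: x_def \<gamma>_def complex_eq_iff)
    then show ?thesis unfolding C_mod_def by (simp only: complex_mod_cnj)
  qed
  have c2: "cmod (of_real y - \<gamma>) / cmod \<gamma> = C_mod"
  proof -
    have "of_real y - \<gamma> = - (\<sigma> - cnj \<tau>)" by (simp add: y_def \<gamma>_def complex_eq_iff)
    then show ?thesis unfolding C_mod_def by (simp only: norm_minus_cancel)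
  qed
  have e: "(norm (e (herm \<gamma> N)))\<^sup>2 = sqrt (pi / x) * fact N * (2 * G\<^sup>2 / x) ^ N * T"
    unfolding norm_gp_L2[OF Re_\<sigma>] integral_gp_herm[OF Re_\<sigma> \<gamma>_nz x_def] c1 T_def G_def ..
  have v: "(norm (gp_L2 \<tau> (herm \<gamma> N)))\<^sup>2 = sqrt (pi / y) * fact N * (2 * G\<^sup>2 / y) ^ N * T"
    unfolding norm_gp_L2[OF Re_\<tau>] integral_gp_herm[OF Re_\<tau> \<gamma>_nz y_def] c2 T_def G_def ..
  have p: "cmod (pairing (e (herm \<gamma> N)) (gp_L2 \<tau> (herm \<gamma> N))) = (2 * G) ^ N * fact N * sqrt (pi / G)"
    by (simp add: pairing_gp_L2[OF Re_\<sigma> Re_\<tau>] \<gamma>_def[symmetric] gp_integral_herm_herm[OF Re_\<gamma>] norm_mult norm_power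
        cmod_gp_integral_1[OF Re_\<gamma>] G_def)
  have D: "1 / (1 - C_mod\<^sup>2) = G\<^sup>2 / (x * y)"
    using Re_\<sigma> Re_\<tau> by (simp add: one_minus_C_mod_power2 x_def y_def G_def)
  have sq: "sqrt (pi / x) * sqrt (pi / y) / (sqrt (pi / G))\<^sup>2 = sqrt (G\<^sup>2 / (x * y))"
  proof -
    have "(sqrt (pi / G))\<^sup>2 = pi / G" using G by simp
    then show ?thesis using xy G by (simp add: real_sqrt_divide real_sqrt_mult)
  qed
  have pw: "(2 * G\<^sup>2 / x) ^ N * (2 * G\<^sup>2 / y) ^ N / ((2 * G) ^ N)\<^sup>2 = (G\<^sup>2 / (x * y)) ^ N"
  proof -
    have "(2 * G\<^sup>2 / x) * (2 * G\<^sup>2 / y) / (2 * G)\<^sup>2 = G\<^sup>2 / (x * y)"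
      using xy G by (simp add: power2_eq_square field_simps)
    moreover have "((2 * G) ^ N)\<^sup>2 = ((2 * G)\<^sup>2) ^ N" by (simp only: power_mult[symmetric] mult.commute)
    ultimately show ?thesis by (simp only: power_mult_distrib[symmetric] power_divide[symmetric])
  qed
  have "(norm (spectral_projection A (level N)))\<^sup>2
      = (sqrt (pi / x) * fact N * (2 * G\<^sup>2 / x) ^ N * T) * (sqrt (pi / y) * fact N * (2 * G\<^sup>2 / y) ^ N * T)
        / ((2 * G) ^ N * fact N * sqrt (pi / G))\<^sup>2"
    unfolding norm_spectral_projection power_divide power_mult_distrib[of "norm _"] e v p ..
  also have "\<dots> = T\<^sup>2 * ((2 * G\<^sup>2 / x) ^ N * (2 * G\<^sup>2 / y) ^ N / ((2 * G) ^ N)\<^sup>2)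
      * (sqrt (pi / x) * sqrt (pi / y) / (sqrt (pi / G))\<^sup>2)"
  proof -
    have "(s * f * u * t) * (s' * f * u' * t) / (w * f * z)\<^sup>2 = t\<^sup>2 * (u * u' / w\<^sup>2) * (s * s' / z\<^sup>2)"
      if "f \<noteq> 0" for s s' f u u' t w z :: real
      using that by (simp add: power2_eq_square mult_ac)
    then show ?thesis by simp
  qed
  also have "\<dots> = T\<^sup>2 * (1 / (1 - C_mod\<^sup>2)) ^ N * sqrt (1 / (1 - C_mod\<^sup>2))"
    unfolding sq pw D ..
  finally show ?thesis by (simp add: T_def)
qed

text \<open>Since \<open>1 - C_mod^2 = (1 - C_mod) * (1 + C_mod)\<close>, the scaling turns the
  growth factor \<open>(1 - C_mod^2) powr (- N / 2)\<close> into
  \<open>(1 + C_mod) powr (- N)\<close>, which normalises the peak of the circle integrand to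
  1.\<close>

lemma scaled_norm_spectral_projection:
  "((1 - C_mod) / (1 + C_mod)) powr (real N / 2) * norm (spectral_projection A (level N))
    = sqrt (sqrt (1 / (1 - C_mod\<^sup>2))) * (circle_mean N C_mod / (1 + C_mod) ^ N)"
proof (rule power2_eq_imp_eq)
  have c: "0 \<le> C_mod" "C_mod < 1" using C_mod_less_1 by (simp_all add: C_mod_def)
  have f: "1 - C_mod\<^sup>2 = (1 - C_mod) * (1 + C_mod)" by (simp add: power2_eq_square algebra_simps)
  have pos: "1 - C_mod\<^sup>2 > 0" unfolding f using c by simp
  have "(((1 - C_mod) / (1 + C_mod)) powr (real N / 2))\<^sup>2 = ((1 - C_mod) / (1 + C_mod)) powr (real N)"
    using c by (simp add: power2_eq_square powr_add[symmetric])
  also have "\<dots> = ((1 - C_mod) / (1 + C_mod)) ^ N" using c by (intro powr_realpow) auto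
  finally have "(((1 - C_mod) / (1 + C_mod)) powr (real N / 2) * norm (spectral_projection A (level N)))\<^sup>2
      = (circle_mean N C_mod)\<^sup>2 * (((1 - C_mod) / (1 + C_mod)) * (1 / (1 - C_mod\<^sup>2))) ^ N * sqrt (1 / (1 - C_mod\<^sup>2))"
    by (simp only: power_mult_distrib norm_spectral_projection_power2) (simp only: mult_ac)
  also have "((1 - C_mod) / (1 + C_mod)) * (1 / (1 - C_mod\<^sup>2)) = 1 / (1 + C_mod)\<^sup>2"
    unfolding f using c by (simp add: power2_eq_square)
  also have "(1 / (1 + C_mod)\<^sup>2) ^ N = 1 / ((1 + C_mod) ^ N)\<^sup>2"
    by (simp add: power_divide power_mult[symmetric] mult.commute)
  also have "(circle_mean N C_mod)\<^sup>2 * (1 / ((1 + C_mod) ^ N)\<^sup>2) * sqrt (1 / (1 - C_mod\<^sup>2))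
      = (sqrt (sqrt (1 / (1 - C_mod\<^sup>2))) * (circle_mean N C_mod / (1 + C_mod) ^ N))\<^sup>2"
    using pos by (simp add: power_mult_distrib power_divide)
  finally show "(((1 - C_mod) / (1 + C_mod)) powr (real N / 2) * norm (spectral_projection A (level N)))\<^sup>2
    = (sqrt (sqrt (1 / (1 - C_mod\<^sup>2))) * (circle_mean N C_mod / (1 + C_mod) ^ N))\<^sup>2" .
  show "0 \<le> sqrt (sqrt (1 / (1 - C_mod\<^sup>2))) * (circle_mean N C_mod / (1 + C_mod) ^ N)"
    using c pos circle_mean_nonneg[OF c(1), of N] by simp
qed simp

end

lemma scaled_circle_mean_expansion:
  assumes c: "0 < c" "c < 1"
  shows "\<exists>\<alpha>. has_half_power_expansion (\<lambda>N. sqrt (sqrt (1 / (1 - c\<^sup>2))) * (circle_mean N c / (1 + c) ^ N)) \<alpha>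
    \<and> \<alpha> 0 = (2 * pi * c) powr (- 1/2) * ((1 + c) / (1 - c)) powr (1/4)"
proof -
  obtain \<alpha> where \<alpha>: "has_half_power_expansion (\<lambda>N. circle_mean N c / (1 + c) ^ N) \<alpha>"
    "\<alpha> 0 = 1 / (sqrt pi * sqrt (2 * c / (1 + c)))"
    using circle_mean_expansion[OF c] by blast
  have pos: "1 - c\<^sup>2 > 0" using c by (simp add: power_less_one_iff abs_square_less_1)
  have "sqrt (sqrt (1 / (1 - c\<^sup>2))) * \<alpha> 0 = (2 * pi * c) powr (- 1/2) * ((1 + c) / (1 - c)) powr (1/4)"
  proof -
    have q: "x powr (1/4) = sqrt (sqrt x)" if "x \<ge> 0" for x :: real
      using that by (simp add: powr_half_sqrt[symmetric] powr_powr)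
    have h: "x powr (- 1/2) = 1 / sqrt x" if "x > 0" for x :: real
      using that by (simp add: powr_minus_divide powr_half_sqrt[symmetric])
    \<comment> \<open>Its fourth root splits into \<open>sqrt (1 + c)\<close>, coming from the
      Laplace constant, and the fourth root of \<open>1 / (1 - c^2)\<close>, coming from the
      norms.\<close>
    have "(1 + c) / (1 - c) = (1 + c)\<^sup>2 * (1 / (1 - c\<^sup>2))"
    proof -
      have "1 - c\<^sup>2 = (1 - c) * (1 + c)" by (simp add: power2_eq_square algebra_simps)
      then show ?thesis using c by (simp add: power2_eq_square)
    qed
    then have "sqrt (sqrt ((1 + c) / (1 - c))) = sqrt (1 + c) * sqrt (sqrt (1 / (1 - c\<^sup>2)))"
      using c by (simp only: real_sqrt_mult) simp
    moreover have "1 / (sqrt pi * sqrt (2 * c / (1 + c))) = 1 / sqrt (2 * pi * c) * sqrt (1 + c)"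
      using c by (simp add: real_sqrt_divide real_sqrt_mult)
    moreover have "(2 * pi * c) powr (- 1/2) = 1 / sqrt (2 * pi * c)" using c by (intro h) simp
    moreover have "((1 + c) / (1 - c)) powr (1/4) = sqrt (sqrt ((1 + c) / (1 - c)))" using c by (intro q) simp
    ultimately show ?thesis unfolding \<alpha>(2) by (simp only: mult_ac)
  qed
  then show ?thesis using half_power_expansion_cmult[OF \<alpha>(1)] by blast
qed

text \<open>The coefficients form a function of \<open>C_plus\<close> chosen before
  \<open>q\<close>, which expresses that they depend on nothing else. For
  \<open>C_plus q = 0\<close> the circle integrand has no peak: the scaled norms are constantly 1,
  which admits no expansion starting at \<open>N powr (- 1/2)\<close>, and the formula for the
  leading coefficient degenerates.\<close>

theorem corollary1p7:
  shows "\<exists>c :: complex \<Rightarrow> nat \<Rightarrow> real. \<forall>q :: quadratic_form.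
    partially_elliptic q \<and> singular_space q = {0} \<longrightarrow>
      cmod (C_plus q) < 1 \<and>
      (C_plus q \<noteq> 0 \<longrightarrow>
        has_half_power_expansion
          (\<lambda>N. ((1 - cmod (C_plus q)) / (1 + cmod (C_plus q))) powr (real N / 2)
                * norm (spectral_projection (weyl q) (mu q N)))
          (c (C_plus q)) \<and>
        c (C_plus q) 0 = (2 * pi * cmod (C_plus q)) powr (- 1/2)
          * ((1 + cmod (C_plus q)) / (1 - cmod (C_plus q))) powr (1/4))"
proof -
  define good where "good r \<alpha> \<longleftrightarrow>
    has_half_power_expansion (\<lambda>N. sqrt (sqrt (1 / (1 - r\<^sup>2))) * (circle_mean N r / (1 + r) ^ N)) \<alpha>
    \<and> \<alpha> 0 = (2 * pi * r) powr (- 1/2) * ((1 + r) / (1 - r)) powr (1/4)" for r \<alpha>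
  \<comment> \<open>The choice mentions only the modulus of \<open>C\<close>, so one sequence serves
    all forms with this value.\<close>
  define c where "c C = (SOME \<alpha>. good (cmod C) \<alpha>)" for C
  have good_c: "good (cmod C) (c C)" if "cmod C < 1" "C \<noteq> 0" for C
  proof -
    have "\<exists>\<alpha>. good (cmod C) \<alpha>"
      unfolding good_def by (rule scaled_circle_mean_expansion) (use that in auto)
    then show ?thesis unfolding c_def by (rule someI_ex)
  qed
  have main: "cmod (C_plus q) < 1 \<and> (\<forall>N. ((1 - cmod (C_plus q)) / (1 + cmod (C_plus q))) powr (real N / 2)
        * norm (spectral_projection (weyl q) (mu q N))
      = sqrt (sqrt (1 / (1 - (cmod (C_plus q))\<^sup>2))) * (circle_mean N (cmod (C_plus q)) / (1 + cmod (C_plus q)) ^ N))"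
    if q: "partially_elliptic q" "singular_space q = {0}" for q
  proof -
    obtain k p m where kpm: "q = factored_form k p m" "k \<noteq> 0" "Im p > 0" "Im m < 0"
      "Im (k * (p - m) / 2) > 0"
      using factored_form_exists[OF q] by blast
    define \<sigma> \<tau> where "\<sigma> = - \<i> * p / 2" and "\<tau> = \<i> * m / 2"
    have pm: "p = 2 * \<i> * \<sigma>" "m = - 2 * \<i> * \<tau>" by (simp_all add: \<sigma>_def \<tau>_def)
    interpret gauss_weyl \<sigma> \<tau> "\<sigma> + \<tau>" k
      using kpm by unfold_locales (auto simp: \<sigma>_def \<tau>_def)
    have form: "q = gauss_form k \<sigma> \<tau>" unfolding kpm(1) gauss_form_def pm ..
    have "C_plus q = - ((p - cnj m) / (p - m))"
      unfolding kpm(1) by (rule C_plus_factored_form) fact+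
    also have "p - cnj m = 2 * \<i> * (\<sigma> - cnj \<tau>)" by (simp add: pm algebra_simps)
    also have "p - m = 2 * \<i> * (\<sigma> + \<tau>)" by (simp add: pm algebra_simps)
    finally have C: "cmod (C_plus q) = C_mod" by (simp add: norm_divide norm_mult C_mod_def)
    have mu: "mu q N = level N" for N
    proof -
      have "lambda_plus q = k * (p - m) / 2" unfolding kpm(1) by (rule lambda_factored_form) fact+
      also have "\<dots> / \<i> = k * (\<sigma> + \<tau>)" by (simp add: pm field_simps)
      finally show ?thesis by (simp add: mu_def level_def)
    qed
    show ?thesis
      using C_mod_less_1 scaled_norm_spectral_projection unfolding C mu unfolding form by blast
  qed
  show ?thesis
    using main good_c unfolding good_def by (intro exI[of _ c]) (simp add: fun_eq_iff)
qed

end
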